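(* Let $\{T_{X_t,Y_t}\}_{t}$ be a P-divisible family of $n$-mode Gaussian channels such that each $X_t$ is invertible and $t\mapsto\det X_t$ is differentiable. Then $$\frac{\mathrm{d}}{\mathrm{d}t}\left(\det X_t\right)\le 0.$$
   Context: Let $\mathcal{H}=L^2(\mathbb{R}^n)$. For $\mathbf{k},\mathbf{h}\in\mathbb{R}^n$ let $(U(\mathbf{k})f)(\mathbf{x})=e^{\imath\langle\mathbf{k},\mathbf{x}\rangle}f(\mathbf{x})$, $(V(\mathbf{h})f)(\mathbf{x})=f(\mathbf{x}-\mathbf{h})$, and let $W(\mathbf{k},\mathbf{h})=U(\mathbf{k})V(\mathbf{h})$ be the Weyl operator. Let $J=\begin{bmatrix}0&\mathbb{I}_n\\-\mathbb{I}_n&0\end{bmatrix}$. Gaussian channels $T_{X,Y}:\mathcal{B}(\mathcal{H})\to\mathcal{B}(\mathcal{H})$ are labelled by pairs $(X,Y)$ of real $2n\times 2n$ matrices satisfying $Y\ge \imath(J-X^tJX)$; the channel acts on Weyl operators by $$T_{X,Y}(W(\mathbf{k},\mathbf{h}))=\exp\left(\frac{\imath}{2}\left\langle\begin{bmatrix}\mathbf{k}\\\mathbf{h}\end{bmatrix},Y\begin{bmatrix}\mathbf{k}\\\mathbf{h}\end{bmatrix}\right\rangle\right)W\left(X\begin{bmatrix}\mathbf{k}\\\mathbf{h}\end{bmatrix}\right).$$ For a function $\phi$ on $\mathbb{R}^n\times\mathbb{R}^n$, $W(\phi)=\int_{\mathbb{R}^n}\int_{\mathbb{R}^n}\phi(\mathbf{k},\mathbf{h})W(\mathbf{k},\mathbf{h})\,\mathrm{d}\mathbf{k}\,\mathrm{d}\mathbf{h}$,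 and $T_{X,Y}$ acts on $W(\phi)$ by acting under the integral sign. A one-parameter family $\{\Lambda_t\}_{t\ge 0}$ of maps on the trace class operators $\mathcal{B}_1(\mathcal{H})$ is P-divisible if for all $0\le s\le t$ there is a positive and trace preserving linear map $\Phi_{t,s}:\mathcal{B}_1(\mathcal{H})\to\mathcal{B}_1(\mathcal{H})$ with $\Lambda_t=\Phi_{t,s}\Lambda_s$. The paper applies this notion to the family $\Lambda_t=T_{X_t,Y_t}$. *)

theory Defs
  imports "HOL-Analysis.Analysis"
begin

section \<open>The complex Hilbert space \<open>L\<^sup>2\<close>\<close>

definition square_integrable :: "('a::euclidean_space \<Rightarrow> complex) \<Rightarrow> bool" where
  "square_integrable f \<longleftrightarrow>
     f \<in> borel_measurable lborel \<and> integrable lborel (\<lambda>x. (cmod (f x))\<^sup>2)"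

definition l2_rel :: "('a::euclidean_space \<Rightarrow> complex) \<Rightarrow> ('a \<Rightarrow> complex) \<Rightarrow> bool" where
  "l2_rel f g \<longleftrightarrow> square_integrable f \<and> square_integrable g \<and> (AE x in lborel. f x = g x)"

lemma square_integrable_zero: "square_integrable (\<lambda>_. 0)"
  by (simp add: square_integrable_def)

lemma square_integrable_add:
  assumes "square_integrable f" "square_integrable g"
  shows "square_integrable (\<lambda>x. f x + g x)"
proof -
  have m [measurable]: "f \<in> borel_measurable lborel" "g \<in> borel_measurable lborel"
    and i: "integrable lborel (\<lambda>x. (cmod (f x))\<^sup>2)" "integrable lborel (\<lambda>x. (cmod (g x))\<^sup>2)"
    using assms by (auto simp: square_integrable_def)
  have b: "(cmod (f x + g x))\<^sup>2 \<le> 2 * (cmod (f x))\<^sup>2 + 2 * (cmod (g x))\<^sup>2" for x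
  proof -
    have "(cmod (f x + g x))\<^sup>2 \<le> (cmod (f x) + cmod (g x))\<^sup>2"
      by (intro power_mono norm_triangle_ineq norm_ge_zero)
    also have "\<dots> \<le> 2 * (cmod (f x))\<^sup>2 + 2 * (cmod (g x))\<^sup>2"
      using zero_le_power2[of "cmod (f x) - cmod (g x)"]
      by (simp add: power2_eq_square algebra_simps)
    finally show ?thesis .
  qed
  have "integrable lborel (\<lambda>x. (cmod (f x + g x))\<^sup>2)"
    by (rule Bochner_Integration.integrable_bound
        [where f = "\<lambda>x. 2 * (cmod (f x))\<^sup>2 + 2 * (cmod (g x))\<^sup>2"])
      (use i b in \<open>auto intro!: AE_I2\<close>)
  then show ?thesis by (simp add: square_integrable_def)
qed

lemma square_integrable_mult:
  assumes "square_integrable f" "u \<in> borel_measurable lborel" "\<And>x. cmod (u x) \<le> B"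
  shows "square_integrable (\<lambda>x. u x * f x)"
proof -
  have m [measurable]: "f \<in> borel_measurable lborel" "u \<in> borel_measurable lborel"
    and i: "integrable lborel (\<lambda>x. (cmod (f x))\<^sup>2)"
    using assms by (auto simp: square_integrable_def)
  have b: "(cmod (u x * f x))\<^sup>2 \<le> B\<^sup>2 * (cmod (f x))\<^sup>2" for x
    by (simp add: norm_mult power_mult_distrib assms(3) mult_right_mono power_mono)
  have "integrable lborel (\<lambda>x. (cmod (u x * f x))\<^sup>2)"
    by (rule Bochner_Integration.integrable_bound[where f = "\<lambda>x. B\<^sup>2 * (cmod (f x))\<^sup>2"])
      (use i b in \<open>auto intro!: AE_I2\<close>)
  then show ?thesis by (simp add: square_integrable_def)
qed

lemma square_integrable_scale: "square_integrable f \<Longrightarrow> square_integrable (\<lambda>x. c * f x)"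
  by (rule square_integrable_mult[where B = "cmod c"]) auto

lemma square_integrable_translate:
  assumes "square_integrable f"
  shows "square_integrable (\<lambda>x. f (x - h))"
proof -
  have m [measurable]: "f \<in> borel_measurable lborel"
    and i: "integrable lborel (\<lambda>x. (cmod (f x))\<^sup>2)"
    using assms by (auto simp: square_integrable_def)
  have "integrable (distr lborel borel ((+) (-h))) (\<lambda>x. (cmod (f x))\<^sup>2)"
    using i by (simp add: lborel_distr_plus)
  then have "integrable lborel (\<lambda>x. (cmod (f (x - h)))\<^sup>2)"
    by (subst (asm) integrable_distr_eq) auto
  then show ?thesis by (simp add: square_integrable_def)
qed

lemma AE_lborel_translate:
  fixes h :: "'a::euclidean_space"
  assumes "AE x in lborel. P x"
  shows "AE x in lborel. P (x - h)"
proof -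
  have "AE x in distr lborel borel ((+) (-h)). P x"
    unfolding lborel_distr_plus by (rule assms)
  then have "AE x in lborel. P ((+) (-h) x)"
    by (rule AE_distrD[rotated]) simp
  then show ?thesis by simp
qed

lemma borel_measurable_cnj [measurable]: "cnj \<in> borel_measurable borel"
  by (intro borel_measurable_continuous_onI continuous_intros)

lemma part_equivp_l2_rel: "part_equivp (l2_rel :: ('a::euclidean_space \<Rightarrow> complex) \<Rightarrow> _)"
proof (rule part_equivpI)
  show "\<exists>f :: 'a \<Rightarrow> complex. l2_rel f f"
    by (rule exI[of _ "\<lambda>_. 0"]) (simp add: l2_rel_def square_integrable_zero)
  show "symp (l2_rel :: ('a \<Rightarrow> complex) \<Rightarrow> _)"
    by (auto simp: symp_def l2_rel_def elim: eventually_mono)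
  show "transp (l2_rel :: ('a \<Rightarrow> complex) \<Rightarrow> _)"
    by (auto simp: transp_def l2_rel_def elim: eventually_elim2)
qed

quotient_type (overloaded) 'a l2 = "'a::euclidean_space \<Rightarrow> complex" / partial: l2_rel
  by (rule part_equivp_l2_rel)

lift_definition scaleC :: "complex \<Rightarrow> 'a::euclidean_space l2 \<Rightarrow> 'a l2" (infixr \<open>*\<^sub>C\<close> 75)
  is "\<lambda>c f x. c * f x"
  by (auto simp: l2_rel_def square_integrable_scale elim: eventually_mono)

lift_definition cinner :: "'a::euclidean_space l2 \<Rightarrow> 'a l2 \<Rightarrow> complex"
  is "\<lambda>f g. \<integral>x. cnj (f x) * g x \<partial>lborel"
proof -
  fix f f' g g' :: "'a \<Rightarrow> complex"
  assume a: "l2_rel f f'" "l2_rel g g'"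
  then have [measurable]: "f \<in> borel_measurable borel" "g \<in> borel_measurable borel"
     "f' \<in> borel_measurable borel" "g' \<in> borel_measurable borel"
    by (auto simp: l2_rel_def square_integrable_def)
  have "(\<lambda>x. cnj (f x) * g x) \<in> borel_measurable lborel"
    "(\<lambda>x. cnj (f' x) * g' x) \<in> borel_measurable lborel"
    by measurable
  then show "(\<integral>x. cnj (f x) * g x \<partial>lborel) = (\<integral>x. cnj (f' x) * g' x \<partial>lborel)"
    by (rule integral_cong_AE)
      (use a in \<open>auto simp: l2_rel_def elim: eventually_elim2\<close>)
qed

lemma integrable_cinner:
  assumes "square_integrable f" "square_integrable g"
  shows "integrable lborel (\<lambda>x. cnj (f x) * g x)"
proof -
  have m [measurable]: "f \<in> borel_measurable lborel" "g \<in> borel_measurable lborel"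
    and i: "integrable lborel (\<lambda>x. (cmod (f x))\<^sup>2)" "integrable lborel (\<lambda>x. (cmod (g x))\<^sup>2)"
    using assms by (auto simp: square_integrable_def)
  have b: "cmod (f x) * cmod (g x) \<le> (cmod (f x))\<^sup>2 + (cmod (g x))\<^sup>2" for x
  proof -
    have "2 * (cmod (f x) * cmod (g x)) \<le> (cmod (f x))\<^sup>2 + (cmod (g x))\<^sup>2"
      using zero_le_power2[of "cmod (f x) - cmod (g x)"] by (simp add: power2_diff)
    moreover have "0 \<le> cmod (f x) * cmod (g x)" by simp
    ultimately show ?thesis by linarith
  qed
  show ?thesis
    by (rule Bochner_Integration.integrable_bound
        [where f = "\<lambda>x. (cmod (f x))\<^sup>2 + (cmod (g x))\<^sup>2"])
      (use i b in \<open>auto intro!: AE_I2 simp: norm_mult\<close>)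
qed

instantiation l2 :: (euclidean_space) real_inner
begin

lift_definition zero_l2 :: "'a l2" is "\<lambda>_. 0"
  by (simp add: l2_rel_def square_integrable_zero)

lift_definition plus_l2 :: "'a l2 \<Rightarrow> 'a l2 \<Rightarrow> 'a l2" is "\<lambda>f g x. f x + g x"
  by (auto simp: l2_rel_def square_integrable_add elim: eventually_elim2)

definition scaleR_l2 :: "real \<Rightarrow> 'a l2 \<Rightarrow> 'a l2" where "scaleR_l2 r f = complex_of_real r *\<^sub>C f"

definition uminus_l2 :: "'a l2 \<Rightarrow> 'a l2" where "uminus_l2 f = (- 1) *\<^sub>C f"

definition minus_l2 :: "'a l2 \<Rightarrow> 'a l2 \<Rightarrow> 'a l2" where "minus_l2 f g = f + - g"

definition inner_l2 :: "'a l2 \<Rightarrow> 'a l2 \<Rightarrow> real" where "inner_l2 f g = Re (cinner f g)"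

definition norm_l2 :: "'a l2 \<Rightarrow> real" where "norm_l2 f = sqrt (inner f f)"

definition sgn_l2 :: "'a l2 \<Rightarrow> 'a l2" where "sgn_l2 f = scaleR (inverse (norm f)) f"

definition dist_l2 :: "'a l2 \<Rightarrow> 'a l2 \<Rightarrow> real" where "dist_l2 f g = norm (f - g)"

definition uniformity_l2 :: "('a l2 \<times> 'a l2) filter" where
  "uniformity_l2 = (INF e\<in>{0<..}. principal {(x, y). dist x y < e})"

definition open_l2 :: "'a l2 set \<Rightarrow> bool" where
  "open_l2 U \<longleftrightarrow> (\<forall>x\<in>U. eventually (\<lambda>(x', y). x' = x \<longrightarrow> y \<in> U) uniformity)"

instance
proof
  fix f g h :: "'a l2" and a b :: real
  show "f + g + h = f + (g + h)"
    by transfer (auto simp: l2_rel_def add.assoc intro!: square_integrable_add)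
  show "f + g = g + f"
    by transfer (auto simp: l2_rel_def add.commute intro!: square_integrable_add)
  show "0 + f = f" by transfer (auto simp: l2_rel_def)
  show "- f + f = 0" unfolding uminus_l2_def
    by transfer (auto simp: l2_rel_def square_integrable_zero)
  show "f - g = f + - g" by (simp add: minus_l2_def)
  show "a *\<^sub>R (f + g) = a *\<^sub>R f + a *\<^sub>R g" unfolding scaleR_l2_def
    by transfer (auto simp: l2_rel_def distrib_left intro!: square_integrable_add square_integrable_scale)
  show "(a + b) *\<^sub>R f = a *\<^sub>R f + b *\<^sub>R f" unfolding scaleR_l2_def
    by transfer (auto simp: l2_rel_def distrib_right intro!: square_integrable_add square_integrable_scale)
  show "a *\<^sub>R b *\<^sub>R f = (a * b) *\<^sub>R f" unfolding scaleR_l2_def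
    by transfer (auto simp: l2_rel_def mult.assoc intro!: square_integrable_scale)
  show "1 *\<^sub>R f = f" unfolding scaleR_l2_def
    by transfer (auto simp: l2_rel_def)
  show "sgn f = inverse (norm f) *\<^sub>R f" by (simp add: sgn_l2_def)
  show "dist f g = norm (f - g)" by (simp add: dist_l2_def)
  show "(uniformity :: ('a l2 \<times> 'a l2) filter) = (INF e\<in>{0<..}. principal {(x, y). dist x y < e})"
    by (simp add: uniformity_l2_def)
  show "open U \<longleftrightarrow> (\<forall>x\<in>U. eventually (\<lambda>(x', y). x' = x \<longrightarrow> y \<in> U) uniformity)" for U :: "'a l2 set"
    by (simp add: open_l2_def)
  show "inner f g = inner g f" unfolding inner_l2_def
  proof transfer
    fix f g :: "'a \<Rightarrow> complex"
    have "(\<integral>x. cnj (f x) * g x \<partial>lborel) = cnj (\<integral>x. cnj (g x) * f x \<partial>lborel)"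
      by (simp add: mult.commute flip: Bochner_Integration.integral_cnj)
    then show "Re (\<integral>x. cnj (f x) * g x \<partial>lborel) = Re (\<integral>x. cnj (g x) * f x \<partial>lborel)"
      by simp
  qed
  show "inner (f + g) h = inner f h + inner g h" unfolding inner_l2_def
    by transfer (simp add: l2_rel_def distrib_right integrable_cinner)
  show "inner (a *\<^sub>R f) g = a * inner f g" unfolding inner_l2_def scaleR_l2_def
    by transfer (simp add: l2_rel_def mult.assoc)
  have sq: "Re (\<integral>x. cnj (u x) * u x \<partial>lborel) = (\<integral>x. (cmod (u x))\<^sup>2 \<partial>lborel)"
    for u :: "'a \<Rightarrow> complex"
  proof -
    have "(\<integral>x. cnj (u x) * u x \<partial>lborel) = (\<integral>x. complex_of_real ((cmod (u x))\<^sup>2) \<partial>lborel)"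
      by (simp add: complex_norm_square mult.commute flip: of_real_power)
    then show ?thesis by (simp only: integral_complex_of_real complex.sel Re_complex_of_real)
  qed
  show "0 \<le> inner f f" unfolding inner_l2_def
    by transfer (simp add: sq)
  show "inner f f = 0 \<longleftrightarrow> f = 0" unfolding inner_l2_def
    by transfer (auto simp: sq l2_rel_def square_integrable_def integral_nonneg_eq_0_iff_AE)
  show "norm f = sqrt (inner f f)" by (simp add: norm_l2_def)
qed

end

section \<open>Bounded and trace class operators\<close>

type_synonym 'n op = "(real^'n) l2 \<Rightarrow> (real^'n) l2"

definition bounded_op :: "'n::finite op \<Rightarrow> bool" where
  "bounded_op A \<longleftrightarrow> bounded_linear A \<and> (\<forall>c f. A (c *\<^sub>C f) = c *\<^sub>C A f)"

definition positive_op :: "'n::finite op \<Rightarrow> bool" where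
  "positive_op A \<longleftrightarrow> bounded_op A \<and> (\<forall>f. cinner f (A f) \<in> \<real>\<^sub>\<ge>\<^sub>0)"

text \<open>The positive operator \<open>P = |A|\<close> with \<open>P\<^sup>2 = A\<^sup>*A\<close>; the last condition is this identity in
  sesquilinear form, with \<open>P\<close> self-adjoint because it is positive.\<close>

definition is_abs_op :: "'n::finite op \<Rightarrow> 'n op \<Rightarrow> bool" where
  "is_abs_op A P \<longleftrightarrow> positive_op P \<and> (\<forall>f g. cinner (P f) (P g) = cinner (A f) (A g))"

definition orthonormal_basis :: "'a::euclidean_space l2 set \<Rightarrow> bool" where
  "orthonormal_basis B \<longleftrightarrow>
     (\<forall>e\<in>B. \<forall>e'\<in>B. cinner e e' = (if e = e' then 1 else 0)) \<and>
     (\<forall>f. (\<forall>e\<in>B. cinner e f = 0) \<longrightarrow> f = 0)"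

definition trace_class :: "'n::finite op \<Rightarrow> bool" where
  "trace_class A \<longleftrightarrow> bounded_op A \<and>
     (\<exists>P B. is_abs_op A P \<and> orthonormal_basis B \<and> (\<lambda>e. cinner e (P e)) summable_on B)"

text \<open>For trace class operators the value does not depend on the chosen basis.\<close>

definition op_trace :: "'n::finite op \<Rightarrow> complex" where
  "op_trace A = (\<Sum>\<^sub>\<infinity>e\<in>(SOME B. orthonormal_basis B). cinner e (A e))"

definition linear_superop :: "('n::finite op \<Rightarrow> bool) \<Rightarrow> ('n op \<Rightarrow> 'n op) \<Rightarrow> bool" where
  "linear_superop D \<Phi> \<longleftrightarrow>
     (\<forall>A. D A \<longrightarrow> D (\<Phi> A)) \<and>
     (\<forall>A B. D A \<longrightarrow> D B \<longrightarrow> \<Phi> (\<lambda>f. A f + B f) = (\<lambda>f. \<Phi> A f + \<Phi> B f)) \<and>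
     (\<forall>c A. D A \<longrightarrow> \<Phi> (\<lambda>f. c *\<^sub>C A f) = (\<lambda>f. c *\<^sub>C \<Phi> A f))"

definition positive_trace_preserving :: "('n::finite op \<Rightarrow> 'n op) \<Rightarrow> bool" where
  "positive_trace_preserving \<Phi> \<longleftrightarrow>
     linear_superop trace_class \<Phi> \<and>
     (\<forall>A. trace_class A \<longrightarrow> positive_op A \<longrightarrow> positive_op (\<Phi> A)) \<and>
     (\<forall>A. trace_class A \<longrightarrow> op_trace (\<Phi> A) = op_trace A)"

definition P_divisible :: "(real \<Rightarrow> 'n::finite op \<Rightarrow> 'n op) \<Rightarrow> bool" where
  "P_divisible \<Lambda> \<longleftrightarrow>
     (\<forall>t\<ge>0. \<forall>A. trace_class A \<longrightarrow> trace_class (\<Lambda> t A)) \<and>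
     (\<forall>s t. 0 \<le> s \<longrightarrow> s \<le> t \<longrightarrow>
        (\<exists>\<Phi>. positive_trace_preserving \<Phi> \<and>
             (\<forall>A. trace_class A \<longrightarrow> \<Lambda> t A = \<Phi> (\<Lambda> s A))))"

section \<open>Weyl operators and Gaussian channels\<close>

lift_definition U_op :: "real^'n \<Rightarrow> 'n::finite op"
  is "\<lambda>k f x. exp (\<i> * complex_of_real (k \<bullet> x)) * f x"
  by (auto simp: l2_rel_def intro!: square_integrable_mult[where B = 1] elim: eventually_mono)

lift_definition V_op :: "real^'n \<Rightarrow> 'n::finite op"
  is "\<lambda>h f x. f (x - h)"
  by (auto simp: l2_rel_def intro!: square_integrable_translate AE_lborel_translate)

definition weyl :: "real^'n \<Rightarrow> real^'n \<Rightarrow> 'n::finite op" where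
  "weyl k h = U_op k \<circ> V_op h"

text \<open>Phase space is \<open>\<real>\<^sup>2\<^sup>n\<close> with index type \<^typ>\<open>'n + 'n\<close>: the left summand carries \<open>k\<close>,
  the right summand \<open>h\<close>.\<close>

definition stack :: "real^'n \<Rightarrow> real^'n \<Rightarrow> real^('n::finite + 'n)" where
  "stack k h = (\<chi> i. case i of Inl a \<Rightarrow> k $ a | Inr a \<Rightarrow> h $ a)"

definition weyl_vec :: "real^('n::finite + 'n) \<Rightarrow> 'n op" where
  "weyl_vec z = weyl (\<chi> a. z $ Inl a) (\<chi> a. z $ Inr a)"

definition sympl_J :: "real^('n::finite + 'n)^('n + 'n)" where
  "sympl_J = (\<chi> i j. case (i, j) of
      (Inl a, Inr b) \<Rightarrow> (if a = b then 1 else 0)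
    | (Inr a, Inl b) \<Rightarrow> (if a = b then - 1 else 0)
    | _ \<Rightarrow> 0)"

definition complex_psd :: "complex^'m^'m::finite \<Rightarrow> bool" where
  "complex_psd M \<longleftrightarrow> (\<forall>v :: complex^'m. (\<Sum>i\<in>UNIV. cnj (v $ i) * (M *v v) $ i) \<in> \<real>\<^sub>\<ge>\<^sub>0)"

text \<open>\<open>Y \<ge> \<i>(J - X\<^sup>tJX)\<close> in the order of Hermitian matrices; in particular \<open>Y\<close> is symmetric.\<close>

definition gaussian_pair ::
    "real^('n::finite + 'n)^('n + 'n) \<Rightarrow> real^('n + 'n)^('n + 'n) \<Rightarrow> bool" where
  "gaussian_pair X Y \<longleftrightarrow>
     complex_psd (\<chi> i j. complex_of_real (Y $ i $ j)
       - \<i> * complex_of_real ((sympl_J - transpose X ** sympl_J ** X) $ i $ j))"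

text \<open>\<open>A = \<integral> F(k, h) dk dh\<close>, understood in the weak sense.\<close>

definition has_op_integral :: "((real^'n) \<times> (real^'n) \<Rightarrow> 'n::finite op) \<Rightarrow> 'n op \<Rightarrow> bool" where
  "has_op_integral F A \<longleftrightarrow> bounded_op A \<and>
     (\<forall>f g. integrable lborel (\<lambda>z. cinner f (F z g)) \<and>
            cinner f (A g) = (\<integral>z. cinner f (F z g) \<partial>lborel))"

definition is_weyl_integral :: "((real^'n) \<times> (real^'n) \<Rightarrow> complex) \<Rightarrow> 'n::finite op \<Rightarrow> bool" where
  "is_weyl_integral \<phi> A \<longleftrightarrow> has_op_integral (\<lambda>(k, h) f. \<phi> (k, h) *\<^sub>C weyl k h f) A"

text \<open>\<open>T\<close> acts on bounded operators as \<open>T\<^sub>X\<^sub>,\<^sub>Y\<close>. No nonzero linear combination of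
  Weyl operators is trace class, so the restriction of \<open>T\<close> to the trace class is governed by the last
  clause: \<open>T\<close> acts on \<open>W(\<phi>)\<close>, for integrable \<open>\<phi>\<close>, under the integral sign.
  Complete positivity is not demanded, so the definition covers every channel with this action.\<close>

definition gaussian_channel ::
    "real^('n::finite + 'n)^('n + 'n) \<Rightarrow> real^('n + 'n)^('n + 'n) \<Rightarrow> ('n op \<Rightarrow> 'n op) \<Rightarrow> bool" where
  "gaussian_channel X Y T \<longleftrightarrow>
     gaussian_pair X Y \<and>
     linear_superop bounded_op T \<and>
     (\<forall>k h. T (weyl k h) =
        (\<lambda>f. exp (\<i> / 2 * complex_of_real (stack k h \<bullet> (Y *v stack k h)))
               *\<^sub>C weyl_vec (X *v stack k h) f)) \<and>
     (\<forall>\<phi> A. integrable lborel \<phi> \<longrightarrow> is_weyl_integral \<phi> A \<longrightarrow>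
        has_op_integral (\<lambda>(k, h) f. \<phi> (k, h) *\<^sub>C T (weyl k h) f) (T A))"

end

theory Submission
  imports Defs "HOL-Probability.Distributions" "HOL-Real_Asymp.Real_Asymp"
begin

text \<open>The trace of \<open>W(\<phi>)\<close> is \<open>(2 \<pi>)\<^sup>n \<phi>(0)\<close>, and substituting \<open>w = X z\<close> shows that \<open>T\<^sub>X\<^sub>,\<^sub>Y\<close> divides
  traces by \<open>\<bar>det X\<bar>\<close>. As the intermediate maps preserve the trace, \<open>\<bar>det X\<^sub>t\<bar>\<close> is constant, and by
  continuity so is \<open>det X\<^sub>t\<close>: the derivative in question is in fact zero.

  To compute the trace in an arbitrary orthonormal basis, it suffices to evaluate the channels on one
  Gaussian rank one operator. The Weyl symbol of the image is a complex Gaussian. It is the symbol of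
  another, slowly decaying rank one operator, whose trace is given by Parseval's identity, times
  finitely many factors \<open>exp (- \<alpha> (l \<bullet> z)\<^sup>2)\<close> with \<open>Re \<alpha> > 0\<close>. Each such factor averages the
  operator over Weyl conjugations with an integrable weight of total mass one, which leaves the trace
  unchanged.\<close>

section \<open>Complex Gaussians on the line\<close>

text \<open>The trace is a sum over an unspecified orthonormal basis, while the image of an operator
  under a channel is known only through weak integrals of matrix elements. Sum and integral cannot
  be interchanged directly, since a single Weyl operator is not trace class. So the computation
  starts from an operator whose diagonal sum is explicit and applies only operations that keep both
  the sum and a bound on its finite partial sums, uniformly over all bases.

  The slow operator is built from two different Gaussians. With equal parameters the decay rates of
  the symbol in \<open>k\<close> and in \<open>h\<close> have a fixed product; parameters
  \<open>a\<close> and \<open>1 / a\<close> make both rates equal and small together. Dividing the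
  image symbol by the slow one leaves a quadratic exponent whose real part is close to a multiple of
  the identity, so that it splits explicitly into squares. Its imaginary part, which contains the
  phase coming from \<open>Y\<close>, may have any size; hence the complex coefficients.

  The factor that multiplies \<open>1 / \<bar>det X\<bar>\<close> depends on \<open>a\<close> alone.
  Two times are compared with one \<open>a\<close> that is small enough for both, and the factor
  cancels because it is nonzero.\<close>

lemma has_vector_derivative_quotient:
  fixes F :: "real \<Rightarrow> 'a::real_normed_vector"
  shows "(F has_vector_derivative D) (at t) \<longleftrightarrow> ((\<lambda>h. (F (t + h) - F t) /\<^sub>R h) \<longlongrightarrow> D) (at 0)"
proof -
  have "((\<lambda>h. norm (F (t + h) - F t - h *\<^sub>R D) / norm h) \<longlongrightarrow> 0) (at 0)
      \<longleftrightarrow> ((\<lambda>h. norm ((F (t + h) - F t) /\<^sub>R h - D)) \<longlongrightarrow> 0) (at 0)"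
  proof (rule filterlim_cong[OF refl refl])
    have "norm (F (t + h) - F t - h *\<^sub>R D) / norm h = norm ((F (t + h) - F t) /\<^sub>R h - D)"
      if "h \<noteq> 0" for h
    proof -
      have "norm (F (t + h) - F t - h *\<^sub>R D) / norm h = norm ((F (t + h) - F t - h *\<^sub>R D) /\<^sub>R h)"
        by (simp add: divide_inverse_commute)
      also have "(F (t + h) - F t - h *\<^sub>R D) /\<^sub>R h = (F (t + h) - F t) /\<^sub>R h - D"
        using that by (simp add: scaleR_diff_right)
      finally show ?thesis .
    qed
    then show "\<forall>\<^sub>F h in at 0. norm (F (t + h) - F t - h *\<^sub>R D) / norm h = norm ((F (t + h) - F t) /\<^sub>R h - D)"
      by (auto simp: eventually_at_filter)
  qed
  then show ?thesis
    unfolding has_vector_derivative_def has_derivative_at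
    by (simp add: bounded_linear_scaleR_left tendsto_norm_zero_iff LIM_zero_iff)
qed

text \<open>Difference quotients are tested along sequences, where dominated convergence applies;
  the mean value inequality bounds them by the same \<open>w\<close> that bounds the
  derivative.\<close>

lemma has_vector_derivative_lebesgue_param:
  fixes f f' :: "real \<Rightarrow> 'a \<Rightarrow> 'b::{banach, second_countable_topology}"
  assumes f: "\<And>t. integrable M (f t)"
    and f': "\<And>t s. ((\<lambda>t. f t s) has_vector_derivative f' t s) (at t)"
    and w: "\<And>t s. norm (f' t s) \<le> w s" "integrable M w"
    and meas: "\<And>t. f' t \<in> borel_measurable M"
  shows "((\<lambda>t. \<integral>s. f t s \<partial>M) has_vector_derivative (\<integral>s. f' t s \<partial>M)) (at t)"
  unfolding has_vector_derivative_quotient tendsto_at_iff_sequentially o_def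
proof (intro allI impI)
  fix X :: "nat \<Rightarrow> real" assume X: "\<forall>i. X i \<in> UNIV - {0}" and X0: "X \<longlonglongrightarrow> 0"
  have "(\<lambda>n. \<integral>s. (f (t + X n) s - f t s) /\<^sub>R X n \<partial>M) \<longlonglongrightarrow> (\<integral>s. f' t s \<partial>M)"
  proof (rule integral_dominated_convergence[where w = w])
    show "AE s in M. (\<lambda>n. (f (t + X n) s - f t s) /\<^sub>R X n) \<longlonglongrightarrow> f' t s"
      using f'[of _ t] X X0
      unfolding has_vector_derivative_quotient tendsto_at_iff_sequentially o_def by blast
    show "AE s in M. norm ((f (t + X n) s - f t s) /\<^sub>R X n) \<le> w s" for n
    proof (rule AE_I2)
      fix s
      have "norm (f (t + X n) s - f t s) \<le> w s * norm ((t + X n) - t)"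
      proof (rule differentiable_bound[where S = UNIV and f' = "\<lambda>x h. h *\<^sub>R f' x s"])
        show "((\<lambda>t. f t s) has_derivative (\<lambda>h. h *\<^sub>R f' x s)) (at x within UNIV)" for x
          using f'[where t = x and s = s] by (simp add: has_vector_derivative_def)
        show "onorm (\<lambda>h. h *\<^sub>R f' x s) \<le> w s" for x
          by (rule onorm_le) (use w(1)[of x s] in \<open>simp add: mult.commute[of "w s"] mult_left_mono\<close>)
      qed auto
      moreover have "X n \<noteq> 0" using X by simp
      ultimately show "norm ((f (t + X n) s - f t s) /\<^sub>R X n) \<le> w s"
        by (simp add: divide_inverse_commute[symmetric] pos_divide_le_eq)
    qed
  qed (use f w meas in \<open>auto intro!: borel_measurable_integrable\<close>)
  then show "(\<lambda>n. ((\<integral>s. f (t + X n) s \<partial>M) - (\<integral>s. f t s \<partial>M)) /\<^sub>R X n) \<longlonglongrightarrow> (\<integral>s. f' t s \<partial>M)"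
    by (simp add: f Bochner_Integration.integral_diff)
qed

text \<open>Up to a factor the integrand is a moment of the centred normal density of variance 1 /
  (2 a). Moments up to order two suffice for differentiating in the Fourier variable and in the
  imaginary part of the coefficient.\<close>

lemma integrable_gaussian_moment:
  assumes a: "(a::real) > 0" and k: "k \<le> 2"
  shows "integrable lborel (\<lambda>s. \<bar>s\<bar> ^ k * exp (- a * s\<^sup>2))"
proof -
  define \<sigma> where "\<sigma> = sqrt (1 / (2 * a))"
  have \<sigma>: "\<sigma> > 0" "\<sigma>\<^sup>2 = 1 / (2 * a)" using a by (auto simp: \<sigma>_def)
  have nd: "exp (- a * s\<^sup>2) = sqrt (2 * pi * \<sigma>\<^sup>2) * normal_density 0 \<sigma> s" for s
    using \<sigma> a by (simp add: normal_density_def)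
  have "integrable lborel (\<lambda>s. normal_density 0 \<sigma> s * \<bar>s\<bar> ^ k)"
  proof -
    consider "k = 0" | "k = 1" | "k = 2" using k by linarith
    then show ?thesis
    proof cases
      case 1 then show ?thesis using normal_moment_even[OF \<sigma>(1), of 0 0] by (auto simp: has_bochner_integral_iff)
    next
      case 2 then show ?thesis using normal_moment_abs_odd[OF \<sigma>(1), of 0 0] by (auto simp: has_bochner_integral_iff)
    next
      case 3 then show ?thesis using normal_moment_even[OF \<sigma>(1), of 0 1] by (auto simp: has_bochner_integral_iff)
    qed
  qed
  then have "integrable lborel (\<lambda>s. sqrt (2 * pi * \<sigma>\<^sup>2) * (normal_density 0 \<sigma> s * \<bar>s\<bar> ^ k))"
    by (rule integrable_mult_right)
  then show ?thesis unfolding nd by (simp add: mult_ac)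
qed

text \<open>Serves as integration by parts in the moment identities below.\<close>

lemma integral_derivative_eq_0:
  fixes g g' :: "real \<Rightarrow> complex"
  assumes g: "\<And>s. (g has_vector_derivative g' s) (at s)"
    and c: "continuous_on UNIV g'" and i: "integrable lborel g'"
    and l: "(g \<longlongrightarrow> 0) at_top" "(g \<longlongrightarrow> 0) at_bot"
  shows "(\<integral>s. g' s \<partial>lborel) = 0"
proof -
  have "(LBINT x=-\<infinity>..\<infinity>. g' x) = 0 - 0"
  proof (rule interval_integral_FTC_integrable)
    show "isCont g' x" for x using c by (simp add: continuous_on_eq_continuous_at)
    show "set_integrable lborel (einterval (-\<infinity>) \<infinity>) g'"
      using i by (simp add: set_integrable_def)
    show "((g \<circ> real_of_ereal) \<longlongrightarrow> 0) (at_right (- \<infinity>))"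
      using l(2) by (simp add: ereal_tendsto_simps del: o_apply)
    show "((g \<circ> real_of_ereal) \<longlongrightarrow> 0) (at_left \<infinity>)"
      using l(1) by (simp add: ereal_tendsto_simps del: o_apply)
  qed (use g in auto)
  then show ?thesis by (simp add: interval_lebesgue_integral_def set_lebesgue_integral_def)
qed

section \<open>Moments and Fourier transform of a complex Gaussian\<close>

definition cgauss :: "complex \<Rightarrow> real \<Rightarrow> real \<Rightarrow> complex" where
  "cgauss \<beta> x s = exp (- \<beta> * of_real s ^ 2 + \<i> * of_real s * of_real x)"

lemma norm_cgauss: "norm (cgauss \<beta> x s) = exp (- Re \<beta> * s\<^sup>2)"
  by (simp add: cgauss_def flip: of_real_power)

lemma continuous_cgauss: "continuous_on A (cgauss \<beta> x)"
  unfolding cgauss_def by (intro continuous_intros)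

lemma borel_measurable_cgauss [measurable]: "cgauss \<beta> x \<in> borel_measurable borel"
  by (intro borel_measurable_continuous_onI continuous_cgauss)

lemma cgauss_derivative:
  "(cgauss \<beta> x has_vector_derivative (\<i> * of_real x - 2 * \<beta> * of_real s) * cgauss \<beta> x s) (at s)"
  unfolding cgauss_def
  by (auto intro!: derivative_eq_intros has_vector_derivative_real_field simp: algebra_simps)

context
  fixes \<beta> :: complex assumes \<beta>: "Re \<beta> > 0"
begin

lemma integrable_cgauss:
  assumes "k \<le> 2"
  shows "integrable lborel (\<lambda>s. of_real s ^ k * cgauss \<beta> x s)"
  by (rule Bochner_Integration.integrable_bound[OF integrable_gaussian_moment[OF \<beta> assms]])
    (auto simp: norm_mult norm_power norm_cgauss)

lemma tendsto_cgauss: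
  assumes "k \<le> 1"
  shows "((\<lambda>s. of_real s ^ k * cgauss \<beta> x s) \<longlongrightarrow> 0) at_top"
    "((\<lambda>s. of_real s ^ k * cgauss \<beta> x s) \<longlongrightarrow> 0) at_bot"
proof -
  obtain a where a: "a = Re \<beta>" "a > 0" using \<beta> by auto
  have "((\<lambda>s. \<bar>s\<bar> ^ 0 * exp (- a * s\<^sup>2)) \<longlongrightarrow> 0) at_top" "((\<lambda>s. \<bar>s\<bar> ^ 0 * exp (- a * s\<^sup>2)) \<longlongrightarrow> 0) at_bot"
    "((\<lambda>s. \<bar>s\<bar> ^ 1 * exp (- a * s\<^sup>2)) \<longlongrightarrow> 0) at_top" "((\<lambda>s. \<bar>s\<bar> ^ 1 * exp (- a * s\<^sup>2)) \<longlongrightarrow> 0) at_bot"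
    using a(2) by real_asymp+
  moreover have "k = 0 \<or> k = 1" using assms by auto
  ultimately have "((\<lambda>s. \<bar>s\<bar> ^ k * exp (- a * s\<^sup>2)) \<longlongrightarrow> 0) at_top"
    "((\<lambda>s. \<bar>s\<bar> ^ k * exp (- a * s\<^sup>2)) \<longlongrightarrow> 0) at_bot"
    by blast+
  then show "((\<lambda>s. of_real s ^ k * cgauss \<beta> x s) \<longlongrightarrow> 0) at_top"
    "((\<lambda>s. of_real s ^ k * cgauss \<beta> x s) \<longlongrightarrow> 0) at_bot"
    unfolding a(1)
    by (subst tendsto_norm_zero_iff[symmetric], simp add: norm_mult norm_power norm_cgauss)+
qed

text \<open>The derivative of \<open>cgauss \<beta> x\<close> integrates to zero.\<close>

lemma cgauss_first_moment:
  "2 * \<beta> * (\<integral>s. of_real s * cgauss \<beta> x s \<partial>lborel) = \<i> * of_real x * (\<integral>s. cgauss \<beta> x s \<partial>lborel)"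
proof -
  have i0: "integrable lborel (\<lambda>s. \<i> * of_real x * cgauss \<beta> x s)"
    using integrable_cgauss[of 0 x] by (auto simp: mult.assoc)
  have i1: "integrable lborel (\<lambda>s. 2 * \<beta> * (of_real s * cgauss \<beta> x s))"
    using integrable_cgauss[of 1 x] by auto
  have eq: "(\<i> * of_real x - 2 * \<beta> * of_real s) * cgauss \<beta> x s
      = \<i> * of_real x * cgauss \<beta> x s - 2 * \<beta> * (of_real s * cgauss \<beta> x s)" for s
    by (simp add: algebra_simps)
  have "(\<integral>s. \<i> * of_real x * cgauss \<beta> x s - 2 * \<beta> * (of_real s * cgauss \<beta> x s) \<partial>lborel) = 0"
  proof (rule integral_derivative_eq_0)
    show "(cgauss \<beta> x has_vector_derivative \<i> * of_real x * cgauss \<beta> x s - 2 * \<beta> * (of_real s * cgauss \<beta> x s)) (at s)" for s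
      using cgauss_derivative[of \<beta> x s] unfolding eq .
    show "integrable lborel (\<lambda>s. \<i> * of_real x * cgauss \<beta> x s - 2 * \<beta> * (of_real s * cgauss \<beta> x s))"
      by (rule Bochner_Integration.integrable_diff[OF i0 i1])
  qed (use tendsto_cgauss[of 0 x] in \<open>auto intro!: continuous_intros continuous_cgauss\<close>)
  then show ?thesis
    unfolding Bochner_Integration.integral_diff[OF i0 i1] by simp
qed

text \<open>The derivative of \<open>s * cgauss \<beta> 0 s\<close> integrates to zero.\<close>

lemma cgauss_second_moment:
  "2 * \<beta> * (\<integral>s. of_real s ^ 2 * cgauss \<beta> 0 s \<partial>lborel) = (\<integral>s. cgauss \<beta> 0 s \<partial>lborel)"
proof -
  have i0: "integrable lborel (\<lambda>s. cgauss \<beta> 0 s)"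
    using integrable_cgauss[of 0 0] by auto
  have i1: "integrable lborel (\<lambda>s. 2 * \<beta> * (of_real s ^ 2 * cgauss \<beta> 0 s))"
    using integrable_cgauss[of 2 0] by auto
  have "(\<integral>s. cgauss \<beta> 0 s - 2 * \<beta> * (of_real s ^ 2 * cgauss \<beta> 0 s) \<partial>lborel) = 0"
  proof (rule integral_derivative_eq_0)
    show "((\<lambda>s. of_real s * cgauss \<beta> 0 s) has_vector_derivative cgauss \<beta> 0 s - 2 * \<beta> * (of_real s ^ 2 * cgauss \<beta> 0 s)) (at s)" for s
      by (rule has_vector_derivative_eq_rhs, rule has_vector_derivative_mult[OF _ cgauss_derivative])
        (auto intro!: derivative_eq_intros simp: algebra_simps power2_eq_square)
    show "integrable lborel (\<lambda>s. cgauss \<beta> 0 s - 2 * \<beta> * (of_real s ^ 2 * cgauss \<beta> 0 s))"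
      by (rule Bochner_Integration.integrable_diff[OF i0 i1])
  qed (use tendsto_cgauss[of 1 0] in \<open>auto intro!: continuous_intros continuous_cgauss\<close>)
  then show ?thesis
    unfolding Bochner_Integration.integral_diff[OF i0 i1] by simp
qed

text \<open>By the first moment identity, differentiation under the integral gives the linear
  equation F' = - x F / (2 \<beta>), which the integrating factor in \<open>G\<close>
  solves.\<close>

lemma cgauss_fourier:
  "(\<integral>s. cgauss \<beta> x s \<partial>lborel) = (\<integral>s. cgauss \<beta> 0 s \<partial>lborel) * exp (- (of_real x ^ 2) / (4 * \<beta>))"
proof -
  have \<beta>0: "\<beta> \<noteq> 0" using \<beta> by auto
  define F where "F x = (\<integral>s. cgauss \<beta> x s \<partial>lborel)" for x
  have "(F has_vector_derivative (\<integral>s. \<i> * (of_real s * cgauss \<beta> x s) \<partial>lborel)) (at x)" for x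
    unfolding F_def
  proof (rule has_vector_derivative_lebesgue_param[where w = "\<lambda>s. \<bar>s\<bar> ^ 1 * exp (- Re \<beta> * s\<^sup>2)"
      and f = "\<lambda>t s. cgauss \<beta> t s" and f' = "\<lambda>t s. \<i> * (of_real s * cgauss \<beta> t s)"])
    show "integrable lborel (\<lambda>s. cgauss \<beta> t s)" for t
      using integrable_cgauss[of 0 t] by simp
    show "((\<lambda>t. cgauss \<beta> t s) has_vector_derivative \<i> * (of_real s * cgauss \<beta> t s)) (at t)" for s t :: real
      unfolding cgauss_def
      by (auto intro!: derivative_eq_intros has_vector_derivative_real_field simp: algebra_simps)
    show "norm (\<i> * (of_real s * cgauss \<beta> t s)) \<le> \<bar>s\<bar> ^ 1 * exp (- Re \<beta> * s\<^sup>2)" for s t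
      by (simp add: norm_mult norm_cgauss)
    show "integrable lborel (\<lambda>s. \<bar>s\<bar> ^ 1 * exp (- Re \<beta> * s\<^sup>2))"
      by (rule integrable_gaussian_moment[OF \<beta>]) simp
    show "(\<lambda>s. \<i> * (of_real s * cgauss \<beta> t s)) \<in> borel_measurable lborel" for t
      by measurable
  qed
  moreover have "(\<integral>s. \<i> * (of_real s * cgauss \<beta> x s) \<partial>lborel) = - (of_real x / (2 * \<beta>)) * F x" for x
  proof -
    have "2 * \<beta> * (\<integral>s. \<i> * (of_real s * cgauss \<beta> x s) \<partial>lborel) = - (of_real x * F x)"
      using arg_cong[OF cgauss_first_moment[of x], of "(*) \<i>"] by (simp add: F_def mult_ac)
    then show ?thesis using \<beta>0 by (simp add: field_simps)
  qed
  ultimately have F': "(F has_vector_derivative - (of_real x / (2 * \<beta>)) * F x) (at x)" for x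
    by simp
  define G where "G x = F x * exp (of_real x ^ 2 / (4 * \<beta>))" for x :: real
  have E': "((\<lambda>x. exp (of_real x ^ 2 / (4 * \<beta>))) has_vector_derivative
      of_real x / (2 * \<beta>) * exp (of_real x ^ 2 / (4 * \<beta>))) (at x)" for x
    by (rule has_vector_derivative_real_field) (auto intro!: derivative_eq_intros simp: \<beta>0)
  have "(G has_vector_derivative 0) (at x within UNIV)" for x
    unfolding G_def
    by (rule has_vector_derivative_eq_rhs, rule has_vector_derivative_mult[OF F' E']) simp
  then obtain C where "\<And>x. G x = C"
    using has_vector_derivative_zero_constant[of UNIV G] by auto
  then have "G x = G 0" by simp
  then have "F 0 = F x * exp (of_real x ^ 2 / (4 * \<beta>))" by (simp add: G_def)
  then have "F 0 * exp (- (of_real x ^ 2) / (4 * \<beta>)) = F x"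
    by (simp add: mult.assoc mult_exp_exp)
  then show ?thesis
    by (simp only: F_def)
qed

end

text \<open>\<open>\<beta> (\<integral> exp (- \<beta> s\<^sup>2) ds)\<^sup>2\<close> does not depend on the imaginary part of \<open>\<beta>\<close>.\<close>

lemma cgauss_integral_nonzero:
  assumes \<beta>: "Re \<beta> > 0"
  shows "(\<integral>s. cgauss \<beta> 0 s \<partial>lborel) \<noteq> 0"
proof -
  define a where "a = Re \<beta>"
  have a: "a > 0" using \<beta> by (simp add: a_def)
  \<comment> \<open>\<open>B\<close> runs along the vertical line through \<beta>, from the real
    point \<open>a\<close> at parameter 0, and stays in the right half plane.\<close>
  define B where "B b = Complex a b" for b
  have B: "Re (B b) > 0" "Re (B b) = a" "B b \<noteq> 0" for b using a by (auto simp: B_def complex_eq_iff)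
  have B_eq: "B = (\<lambda>b. of_real a + \<i> * of_real b)" by (auto simp: B_def Complex_eq)
  have B': "(B has_vector_derivative \<i>) (at b)" for b
    unfolding B_eq by (auto intro!: derivative_eq_intros has_vector_derivative_real_field)
  define J where "J b = (\<integral>s. cgauss (B b) 0 s \<partial>lborel)" for b
  have "(J has_vector_derivative (\<integral>s. - \<i> * (of_real s ^ 2 * cgauss (B b) 0 s) \<partial>lborel)) (at b)" for b
    unfolding J_def
  proof (rule has_vector_derivative_lebesgue_param[where w = "\<lambda>s. \<bar>s\<bar> ^ 2 * exp (- a * s\<^sup>2)"
      and f = "\<lambda>t s. cgauss (B t) 0 s" and f' = "\<lambda>t s. - \<i> * (of_real s ^ 2 * cgauss (B t) 0 s)"])
    show "integrable lborel (\<lambda>s. cgauss (B b) 0 s)" for b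
      using integrable_cgauss[OF B(1), of 0 b 0] by simp
    show "((\<lambda>b. cgauss (B b) 0 s) has_vector_derivative - \<i> * (of_real s ^ 2 * cgauss (B b) 0 s)) (at b)" for s b :: real
      unfolding B_eq cgauss_def
      by (auto intro!: derivative_eq_intros has_vector_derivative_real_field simp: algebra_simps)
    show "norm (- \<i> * (of_real s ^ 2 * cgauss (B b) 0 s)) \<le> \<bar>s\<bar> ^ 2 * exp (- a * s\<^sup>2)" for s b
      by (simp add: norm_mult norm_power norm_cgauss B(2))
    show "integrable lborel (\<lambda>s. \<bar>s\<bar> ^ 2 * exp (- a * s\<^sup>2))"
      by (rule integrable_gaussian_moment[OF a]) simp
    show "(\<lambda>s. - \<i> * (of_real s ^ 2 * cgauss (B b) 0 s)) \<in> borel_measurable lborel" for b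
      by measurable
  qed
  moreover have "(\<integral>s. - \<i> * (of_real s ^ 2 * cgauss (B b) 0 s) \<partial>lborel) = - \<i> * (J b / (2 * B b))" for b
    unfolding J_def cgauss_second_moment[OF B(1), symmetric] using B(3)[of b] by simp
  ultimately have J': "(J has_vector_derivative - \<i> * (J b / (2 * B b))) (at b)" for b
    by simp
  \<comment> \<open>The second moment identity gives J' = - i J / (2 B), so the derivative of J J
    equals - i J J / B and cancels against B' = i.\<close>
  have "((\<lambda>b. J b * J b * B b) has_vector_derivative 0) (at b within UNIV)" for b
    by (rule has_vector_derivative_eq_rhs,
        rule has_vector_derivative_mult[OF has_vector_derivative_mult[OF J' J'] B'])
      (simp add: B(3))
  then obtain C where C: "\<And>b. J b * J b * B b = C"
    using has_vector_derivative_zero_constant[of UNIV "\<lambda>b. J b * J b * B b"] by auto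
  have "cgauss (B 0) 0 s = of_real (exp (- a * s\<^sup>2))" for s
    by (simp add: cgauss_def B_eq exp_of_real[symmetric])
  then have "J 0 = of_real (\<integral>s. exp (- a * s\<^sup>2) \<partial>lborel)"
    unfolding J_def by (subst integral_complex_of_real[symmetric]) (rule Bochner_Integration.integral_cong, simp_all)
  moreover have "(\<integral>s. exp (- a * s\<^sup>2) \<partial>lborel) \<noteq> 0"
  proof
    assume "(\<integral>s. exp (- a * s\<^sup>2) \<partial>lborel) = 0"
    moreover have "integrable lborel (\<lambda>s. exp (- a * s\<^sup>2))"
      using integrable_gaussian_moment[OF a, of 0] by simp
    ultimately have "AE s in lborel. exp (- a * (s::real)\<^sup>2) = 0"
      by (subst (asm) integral_nonneg_eq_0_iff_AE) auto
    then have "AE s in (lborel :: real measure). False" by simp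
    then show False
      using ae_filter_eq_bot_iff[of "lborel :: real measure"] by (simp add: trivial_limit_def)
  qed
  ultimately have "J 0 * J 0 * B 0 \<noteq> 0" using B(3) by simp
  then have "J (Im \<beta>) \<noteq> 0" using C[of "Im \<beta>"] C[of 0] by auto
  then show ?thesis by (simp add: J_def B_def a_def)
qed

text \<open>The parameter 1 / (4 \<alpha>) lies in the right half plane again, and its Gaussian
  transforms into a multiple of the required function. Normalising divides by the Gaussian integral,
  which is why that integral had to be nonzero for complex parameters.\<close>

lemma cgauss_is_fourier_transform:
  assumes \<alpha>: "Re \<alpha> > 0"
  obtains c :: "real \<Rightarrow> complex" where "integrable lborel c"
    "\<And>x. (\<integral>s. c s * exp (\<i> * of_real (s * x)) \<partial>lborel) = exp (- \<alpha> * of_real x ^ 2)"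
proof -
  define \<beta> where "\<beta> = 1 / (4 * \<alpha>)"
  have \<alpha>0: "\<alpha> \<noteq> 0" using \<alpha> by auto
  have "0 < Re \<alpha> ^ 2 + Im \<alpha> ^ 2" using \<alpha> by (intro add_pos_nonneg) auto
  then have \<beta>: "Re \<beta> > 0" using \<alpha> unfolding \<beta>_def by (simp add: Re_divide power2_eq_square)
  define I where "I = (\<integral>s. cgauss \<beta> 0 s \<partial>lborel)"
  have I: "I \<noteq> 0" using cgauss_integral_nonzero[OF \<beta>] by (simp add: I_def)
  show ?thesis
  proof (rule that[of "\<lambda>s. cgauss \<beta> 0 s / I"])
    show "integrable lborel (\<lambda>s. cgauss \<beta> 0 s / I)" using integrable_cgauss[OF \<beta>, of 0 0] by simp
    fix x
    have "cgauss \<beta> 0 s / I * exp (\<i> * of_real (s * x)) = cgauss \<beta> x s / I" for s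
      unfolding cgauss_def by (simp add: mult_exp_exp mult.assoc)
    then have "(\<integral>s. cgauss \<beta> 0 s / I * exp (\<i> * of_real (s * x)) \<partial>lborel) = (\<integral>s. cgauss \<beta> x s / I \<partial>lborel)"
      by (simp only:)
    also have "\<dots> = exp (- (of_real x ^ 2) / (4 * \<beta>))"
      using I by (simp add: cgauss_fourier[OF \<beta>, of x] I_def)
    finally show "(\<integral>s. cgauss \<beta> 0 s / I * exp (\<i> * of_real (s * x)) \<partial>lborel) = exp (- \<alpha> * of_real x ^ 2)"
      using \<alpha>0 by (simp add: \<beta>_def mult.commute)
  qed
qed

section \<open>The Hilbert space of square integrable functions\<close>

lemma l2_cases:
  obtains F where "square_integrable F" "f = abs_l2 F"
proof -
  have "l2_rel (rep_l2 f) (rep_l2 f)" "abs_l2 (rep_l2 f) = f"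
    using Quotient3_l2 by (auto simp: Quotient3_def)
  then show ?thesis by (intro that[of "rep_l2 f"]) (auto simp: l2_rel_def)
qed

lemma l2_rel_refl: "l2_rel F F \<longleftrightarrow> square_integrable F"
  by (simp add: l2_rel_def)

lemma cinner_add_right: "cinner f (g + h) = cinner f g + cinner f h"
  by transfer (simp add: l2_rel_def distrib_left integrable_cinner)

lemma cinner_scaleC_right: "cinner f (c *\<^sub>C g) = c * cinner f g"
  by transfer (simp add: l2_rel_def mult.left_commute)

lemma cinner_commute: "cinner g f = cnj (cinner f g)"
  by transfer (simp add: mult.commute flip: Bochner_Integration.integral_cnj)

lemma cinner_scaleC_left: "cinner (c *\<^sub>C f) g = cnj c * cinner f g"
  using cinner_scaleC_right[of g c f] by (simp add: cinner_commute[of _ g])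

lemma cinner_uminus_right: "cinner f (- g) = - cinner f g"
  using cinner_scaleC_right[of f "-1" g] by (simp add: uminus_l2_def)

lemma cinner_diff_right: "cinner f (g - h) = cinner f g - cinner f h"
  using cinner_add_right[of f g "- h"] by (simp add: cinner_uminus_right)

lemma cinner_diff_left: "cinner (f - g) h = cinner f h - cinner g h"
  using cinner_diff_right[of h f g] by (simp add: cinner_commute[of _ h])

lemma cinner_0_right [simp]: "cinner f 0 = 0"
  using cinner_add_right[of f 0 0] by simp

lemma cinner_sum_right: "cinner f (\<Sum>i\<in>I. g i) = (\<Sum>i\<in>I. cinner f (g i))"
  by (induction I rule: infinite_finite_induct) (auto simp: cinner_add_right)

lemma cinner_self: "cinner f f = of_real ((norm f)\<^sup>2)"
proof -
  have "Re (cinner f f) = (norm f)\<^sup>2"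
    by (metis inner_l2_def power2_norm_eq_inner)
  moreover have "Im (cinner f f) = 0"
    using cinner_commute[of f f] by (simp add: complex_eq_iff)
  ultimately show ?thesis by (simp add: complex_eq_iff)
qed

lemma norm_scaleC: "norm (c *\<^sub>C f) = cmod c * norm f"
proof -
  have "complex_of_real ((norm (c *\<^sub>C f))\<^sup>2) = (cnj c * c) * of_real ((norm f)\<^sup>2)"
    unfolding cinner_self[symmetric] by (simp add: cinner_scaleC_left cinner_scaleC_right)
  also have "cnj c * c = of_real ((cmod c)\<^sup>2)"
    by (simp only: complex_norm_square mult.commute)
  finally have "(norm (c *\<^sub>C f))\<^sup>2 = (cmod c * norm f)\<^sup>2"
    by (simp only: of_real_eq_iff power_mult_distrib flip: of_real_mult)
  then show ?thesis by (simp add: power2_eq_iff_nonneg)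
qed

text \<open>Rotating \<open>f\<close> by the phase of the inner product makes it real and
  nonnegative, so the inequality for the real inner product applies.\<close>

lemma cinner_Cauchy_Schwarz: "cmod (cinner f g) \<le> norm f * norm g"
proof (cases "cinner f g = 0")
  case False
  define w where "w = cinner f g"
  define u where "u = sgn w"
  have u: "cmod u = 1" using False by (simp add: u_def w_def norm_sgn)
  have "w = of_real (cmod w) * u"
    using False by (simp add: u_def w_def sgn_div_norm scaleR_conv_of_real)
  then have "cnj u * w = of_real (cmod w) * (u * cnj u)"
    by (metis mult.assoc mult.commute)
  also have "u * cnj u = 1"
    using u by (metis complex_norm_square of_real_1 one_power2)
  finally have "cmod w = inner (u *\<^sub>C f) g"
    by (simp add: inner_l2_def cinner_scaleC_left w_def)
  also have "\<dots> \<le> norm (u *\<^sub>C f) * norm g"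
    by (rule norm_cauchy_schwarz)
  finally show ?thesis by (simp add: norm_scaleC u w_def)
qed simp

lemma norm_abs_l2:
  assumes "square_integrable F"
  shows "(norm (abs_l2 F))\<^sup>2 = (\<integral>x. (cmod (F x))\<^sup>2 \<partial>lborel)"
proof -
  have "complex_of_real ((norm (abs_l2 F))\<^sup>2) = (\<integral>x. cnj (F x) * F x \<partial>lborel)"
    unfolding cinner_self[symmetric] using assms by (simp add: cinner.abs_eq l2_rel_refl)
  also have "\<dots> = (\<integral>x. complex_of_real ((cmod (F x))\<^sup>2) \<partial>lborel)"
    by (simp add: complex_norm_square mult.commute flip: of_real_power)
  finally show ?thesis by (simp only: integral_complex_of_real of_real_eq_iff)
qed

section \<open>Convergence of geometrically bounded series\<close>

lemma square_integrable_sum: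
  "(\<And>i. i \<in> I \<Longrightarrow> square_integrable (F i)) \<Longrightarrow> square_integrable (\<lambda>x. \<Sum>i\<in>I. F i x)"
  by (induction I rule: infinite_finite_induct) (auto intro!: square_integrable_zero square_integrable_add)

lemma abs_l2_sum:
  assumes "\<And>i. i \<in> I \<Longrightarrow> square_integrable (F i)"
  shows "(\<Sum>i\<in>I. abs_l2 (F i)) = abs_l2 (\<lambda>x. \<Sum>i\<in>I. F i x)"
  using assms
proof (induction I rule: infinite_finite_induct)
  case (insert i I)
  then show ?case by (simp add: plus_l2.abs_eq l2_rel_refl square_integrable_sum)
qed (simp_all add: zero_l2_def)

lemma abs_l2_diff:
  assumes "square_integrable F" "square_integrable G"
  shows "abs_l2 F - abs_l2 G = abs_l2 (\<lambda>x. F x - G x)"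
  using assms
  by (simp add: minus_l2_def uminus_l2_def plus_l2.abs_eq scaleC.abs_eq l2_rel_refl square_integrable_scale[where c = "-1", simplified])

text \<open>Cauchy-Schwarz with weights \<open>2 ^ n\<close>; the constant
  \<open>2 * (1 / 2) ^ N\<close> is the sum of the inverse weights from \<open>N\<close> on.\<close>

lemma weighted_tail_bound:
  fixes z :: "nat \<Rightarrow> complex"
  assumes "summable (\<lambda>n. 2 ^ n * (cmod (z n))\<^sup>2)"
  shows "summable z" "(cmod (suminf z - (\<Sum>n<N. z n)))\<^sup>2 \<le> 2 * (1 / 2) ^ N * (\<Sum>n. 2 ^ n * (cmod (z n))\<^sup>2)"
proof -
  have "cmod (z n) \<le> (1 / 2) ^ n + 2 ^ n * (cmod (z n))\<^sup>2" for n
  proof -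
    have "0 \<le> ((1 / 2) ^ n :: real) * (2 ^ n * cmod (z n) - 1)\<^sup>2" by simp
    also have "\<dots> = (1 / 2) ^ n + 2 ^ n * (cmod (z n))\<^sup>2 - 2 * cmod (z n)"
      by (simp add: power2_eq_square field_simps)
    finally show ?thesis using norm_ge_zero[of "z n"] by linarith
  qed
  then show s: "summable z"
    by (intro summable_norm_cancel[OF summable_comparison_test'[OF summable_add[OF summable_geometric[of "1/2"] assms]]]) auto
  have bnd: "(cmod (\<Sum>n\<in>{N..<M}. z n))\<^sup>2 \<le> 2 * (1 / 2) ^ N * (\<Sum>n. 2 ^ n * (cmod (z n))\<^sup>2)" if "N \<le> M" for M
  proof -
    have "(cmod (\<Sum>n\<in>{N..<M}. z n))\<^sup>2 \<le> (\<Sum>n\<in>{N..<M}. sqrt ((1 / 2) ^ n) * (sqrt (2 ^ n) * cmod (z n)))\<^sup>2"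
      by (intro power_mono order.trans[OF norm_sum] sum_mono)
        (auto simp flip: real_sqrt_mult power_mult_distrib mult.assoc)
    also have "\<dots> \<le> (\<Sum>n\<in>{N..<M}. (sqrt ((1 / 2) ^ n))\<^sup>2) * (\<Sum>n\<in>{N..<M}. (sqrt (2 ^ n) * cmod (z n))\<^sup>2)"
      by (rule Cauchy_Schwarz_ineq_sum)
    also have "\<dots> = (\<Sum>n\<in>{N..<M}. (1 / 2) ^ n) * (\<Sum>n\<in>{N..<M}. 2 ^ n * (cmod (z n))\<^sup>2)"
      by (simp add: power_mult_distrib)
    also have "\<dots> \<le> (2 * (1 / 2) ^ N) * (\<Sum>n. 2 ^ n * (cmod (z n))\<^sup>2)"
    proof (rule mult_mono)
      have "(\<Sum>n\<in>{N..<M}. (1 / 2 :: real) ^ n) = 2 * ((1 / 2) ^ N - (1 / 2) ^ M)"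
        using that by (induction M rule: dec_induct) auto
      then show "(\<Sum>n\<in>{N..<M}. (1 / 2 :: real) ^ n) \<le> 2 * (1 / 2) ^ N" by simp
      show "(\<Sum>n\<in>{N..<M}. 2 ^ n * (cmod (z n))\<^sup>2) \<le> (\<Sum>n. 2 ^ n * (cmod (z n))\<^sup>2)"
        using assms by (intro sum_le_suminf) auto
    qed (auto intro!: sum_nonneg)
    finally show ?thesis .
  qed
  have "(\<lambda>M. (cmod ((\<Sum>n<M. z n) - (\<Sum>n<N. z n)))\<^sup>2) \<longlonglongrightarrow> (cmod (suminf z - (\<Sum>n<N. z n)))\<^sup>2"
    using summable_LIMSEQ[OF s] by (intro tendsto_intros)
  then show "(cmod (suminf z - (\<Sum>n<N. z n)))\<^sup>2 \<le> 2 * (1 / 2) ^ N * (\<Sum>n. 2 ^ n * (cmod (z n))\<^sup>2)"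
  proof (rule LIMSEQ_le_const2)
    have "(\<Sum>n<M. z n) - (\<Sum>n<N. z n) = (\<Sum>n\<in>{N..<M}. z n)" if "N \<le> M" for M
      using that by (metis sum_diff_nat_ivl lessThan_atLeast0 zero_le)
    then show "\<exists>N'. \<forall>M\<ge>N'. (cmod ((\<Sum>n<M. z n) - (\<Sum>n<N. z n)))\<^sup>2 \<le> 2 * (1 / 2) ^ N * (\<Sum>n. 2 ^ n * (cmod (z n))\<^sup>2)"
      using bnd by (intro exI[of _ N]) simp
  qed
qed

text \<open>The form of completeness on which the approximation by orthonormal bases rests. The
  weighted sum of squares \<open>H\<close> has finite integral, so the representatives can be summed
  almost everywhere, and the tail bound multiplied by \<open>H\<close> controls the error in
  norm.\<close>

lemma l2_summable_geometric:
  fixes g :: "nat \<Rightarrow> 'a::euclidean_space l2"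
  assumes g: "\<And>n. norm (g n) \<le> (1 / 2) ^ n"
  obtains s where "(\<lambda>N. \<Sum>n<N. g n) \<longlonglongrightarrow> s"
proof -
  have "\<exists>G. \<forall>n. square_integrable (G n) \<and> g n = abs_l2 (G n)"
    by (intro choice) (metis l2_cases)
  then obtain G where G: "\<And>n. square_integrable (G n)" "\<And>n. g n = abs_l2 (G n)" by auto
  have [measurable]: "G n \<in> borel_measurable borel" for n
    using G(1)[of n] by (simp add: square_integrable_def)
  have Gi: "integrable lborel (\<lambda>x. (cmod (G n x))\<^sup>2)" for n
    using G(1)[of n] by (simp add: square_integrable_def)
  define H where "H x = (\<Sum>n. ennreal (2 ^ n * (cmod (G n x))\<^sup>2))" for x
  have [measurable]: "H \<in> borel_measurable borel"
    unfolding H_def by measurable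
  have "(\<integral>\<^sup>+x. H x \<partial>lborel) = (\<Sum>n. \<integral>\<^sup>+x. ennreal (2 ^ n * (cmod (G n x))\<^sup>2) \<partial>lborel)"
    unfolding H_def by (rule nn_integral_suminf) auto
  also have "\<dots> = (\<Sum>n. ennreal (2 ^ n * (norm (g n))\<^sup>2))"
    using Gi by (simp add: nn_integral_eq_integral G norm_abs_l2)
  also have "\<dots> \<le> (\<Sum>n. ennreal ((1 / 2) ^ n))"
  proof (intro suminf_le ennreal_leI)
    fix n
    have "2 ^ n * (norm (g n))\<^sup>2 \<le> 2 ^ n * ((1 / 2) ^ n)\<^sup>2"
      by (intro mult_left_mono power_mono g) auto
    also have "\<dots> = (1 / 2) ^ n"
      by (simp add: power2_eq_square power_one_over field_simps)
    finally show "2 ^ n * (norm (g n))\<^sup>2 \<le> (1 / 2) ^ n" .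
  qed auto
  also have "\<dots> = 2"
    by (subst suminf_ennreal2) (auto simp: suminf_geometric)
  finally have H2: "(\<integral>\<^sup>+x. H x \<partial>lborel) \<le> 2" .
  then have Hfin: "AE x in lborel. H x \<noteq> \<infinity>"
    by (intro nn_integral_PInf_AE) (auto simp: top_unique)
  \<comment> \<open>Where the series diverges \<open>suminf\<close> has an arbitrary value; such
    points lie in the null set on which \<open>H\<close> is infinite.\<close>
  define S where "S x = (\<Sum>n. G n x)" for x
  have [measurable]: "S \<in> borel_measurable borel"
    unfolding S_def by measurable
  have bound: "AE x in lborel. ennreal ((cmod (S x - (\<Sum>n<N. G n x)))\<^sup>2) \<le> ennreal (2 * (1 / 2) ^ N) * H x" for N
    using Hfin
  proof eventually_elim
    fix x assume "H x \<noteq> \<infinity>"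
    then have s: "summable (\<lambda>n. 2 ^ n * (cmod (G n x))\<^sup>2)"
      unfolding H_def by (intro summable_suminf_not_top) auto
    have "ennreal ((cmod (S x - (\<Sum>n<N. G n x)))\<^sup>2) \<le> ennreal (2 * (1 / 2) ^ N * (\<Sum>n. 2 ^ n * (cmod (G n x))\<^sup>2))"
      unfolding S_def by (intro ennreal_leI weighted_tail_bound(2) s)
    also have "\<dots> = ennreal (2 * (1 / 2) ^ N) * ennreal (\<Sum>n. 2 ^ n * (cmod (G n x))\<^sup>2)"
      by (rule ennreal_mult) (auto intro!: suminf_nonneg s)
    also have "ennreal (\<Sum>n. 2 ^ n * (cmod (G n x))\<^sup>2) = H x"
      unfolding H_def using s by (intro suminf_ennreal2[symmetric]) auto
    finally show "ennreal ((cmod (S x - (\<Sum>n<N. G n x)))\<^sup>2) \<le> ennreal (2 * (1 / 2) ^ N) * H x" .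
  qed
  have nn: "(\<integral>\<^sup>+x. ennreal ((cmod (S x - (\<Sum>n<N. G n x)))\<^sup>2) \<partial>lborel) \<le> ennreal (4 * (1 / 2) ^ N)" for N
  proof -
    have "(\<integral>\<^sup>+x. ennreal ((cmod (S x - (\<Sum>n<N. G n x)))\<^sup>2) \<partial>lborel)
        \<le> (\<integral>\<^sup>+x. ennreal (2 * (1 / 2) ^ N) * H x \<partial>lborel)"
      by (rule nn_integral_mono_AE[OF bound])
    also have "\<dots> = ennreal (2 * (1 / 2) ^ N) * (\<integral>\<^sup>+x. H x \<partial>lborel)"
      by (rule nn_integral_cmult) auto
    also have "\<dots> \<le> ennreal (2 * (1 / 2) ^ N) * 2"
      by (intro mult_left_mono H2) auto
    also have "\<dots> = ennreal (4 * (1 / 2) ^ N)"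
      using ennreal_mult[of "2 * (1 / 2) ^ N" 2] by (simp add: mult.assoc mult.commute)
    finally show ?thesis .
  qed
  have sqd: "square_integrable (\<lambda>x. S x - (\<Sum>n<N. G n x))" for N
    unfolding square_integrable_def integrable_iff_bounded
    using nn[of N] by (auto intro: le_less_trans)
  have sqS: "square_integrable S" using sqd[of 0] by simp
  have le: "(norm (abs_l2 S - (\<Sum>n<N. g n)))\<^sup>2 \<le> 4 * (1 / 2) ^ N" for N
  proof -
    have "(norm (abs_l2 S - (\<Sum>n<N. g n)))\<^sup>2 = (\<integral>x. (cmod (S x - (\<Sum>n<N. G n x)))\<^sup>2 \<partial>lborel)"
      by (simp add: G abs_l2_sum abs_l2_diff sqS square_integrable_sum norm_abs_l2 sqd)
    then have "ennreal ((norm (abs_l2 S - (\<Sum>n<N. g n)))\<^sup>2) \<le> ennreal (4 * (1 / 2) ^ N)"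
      using nn[of N] sqd[of N] by (simp add: nn_integral_eq_integral square_integrable_def)
    then show ?thesis by simp
  qed
  have "(\<lambda>N. (norm (abs_l2 S - (\<Sum>n<N. g n)))\<^sup>2) \<longlonglongrightarrow> 0"
  proof (rule tendsto_sandwich[where f = "\<lambda>N. 0 :: real" and h = "\<lambda>N. 4 * (1 / 2) ^ N"])
    show "(\<lambda>N. 4 * (1 / 2 :: real) ^ N) \<longlonglongrightarrow> 0"
      by (rule tendsto_mult_right_zero, rule LIMSEQ_power_zero) simp
  qed (use le in simp_all)
  then have "(\<lambda>N. sqrt ((norm (abs_l2 S - (\<Sum>n<N. g n)))\<^sup>2)) \<longlonglongrightarrow> sqrt 0"
    by (rule tendsto_real_sqrt)
  then have "(\<lambda>N. \<Sum>n<N. g n) \<longlonglongrightarrow> abs_l2 S"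
    by (subst LIM_zero_iff[symmetric], subst tendsto_norm_zero_iff[symmetric]) (simp add: norm_minus_commute)
  then show ?thesis by (rule that)
qed

section \<open>Orthonormal systems: Bessel, Parseval, existence of bases\<close>

definition orthonormal :: "'a::euclidean_space l2 set \<Rightarrow> bool" where
  "orthonormal B \<longleftrightarrow> (\<forall>e\<in>B. \<forall>e'\<in>B. cinner e e' = (if e = e' then 1 else 0))"

lemma orthonormal_basis_iff:
  "orthonormal_basis B \<longleftrightarrow> orthonormal B \<and> (\<forall>f. (\<forall>e\<in>B. cinner e f = 0) \<longrightarrow> f = 0)"
  by (simp add: orthonormal_basis_def orthonormal_def)

lemma orthonormal_projection:
  assumes B: "orthonormal B" and F: "finite F" "F \<subseteq> B"
  defines "p \<equiv> (\<lambda>f. \<Sum>e\<in>F. cinner e f *\<^sub>C e)"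
  shows "e \<in> B \<Longrightarrow> cinner e (p f) = (if e \<in> F then cinner e f else 0)"
    and "(norm (f - p f))\<^sup>2 = (norm f)\<^sup>2 - (\<Sum>e\<in>F. (cmod (cinner e f))\<^sup>2)"
    and "(norm (p f))\<^sup>2 = (\<Sum>e\<in>F. (cmod (cinner e f))\<^sup>2)"
proof -
  show 1: "cinner e (p f) = (if e \<in> F then cinner e f else 0)" if "e \<in> B" for e
  proof -
    have "cinner e (p f) = (\<Sum>e'\<in>F. if e = e' then cinner e' f else 0)"
      unfolding p_def cinner_sum_right cinner_scaleC_right
      using B that F by (intro sum.cong) (auto simp: orthonormal_def)
    then show ?thesis using F by (simp add: sum.delta)
  qed
  have gp: "cinner g (p f) = (\<Sum>e\<in>F. cinner e f * cinner g e)" for g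
    unfolding p_def cinner_sum_right cinner_scaleC_right ..
  have fp: "cinner f (p f) = of_real (\<Sum>e\<in>F. (cmod (cinner e f))\<^sup>2)"
    unfolding gp of_real_sum complex_norm_square
    by (intro sum.cong) (auto simp: cinner_commute[of f])
  have "cinner (p f) e = cinner f e" if "e \<in> F" for e
  proof -
    have "cinner e (p f) = cinner e f" using 1[of e] that F by auto
    then show ?thesis by (metis cinner_commute)
  qed
  then have pp: "cinner (p f) (p f) = cinner f (p f)"
    unfolding gp by (intro sum.cong) auto
  have "complex_of_real ((norm (p f))\<^sup>2) = of_real (\<Sum>e\<in>F. (cmod (cinner e f))\<^sup>2)"
    unfolding cinner_self[symmetric] pp fp ..
  then show 3: "(norm (p f))\<^sup>2 = (\<Sum>e\<in>F. (cmod (cinner e f))\<^sup>2)" by (simp only: of_real_eq_iff)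
  have "complex_of_real ((norm (f - p f))\<^sup>2) = cinner f f - cinner f (p f) - (cnj (cinner f (p f)) - cinner (p f) (p f))"
    unfolding cinner_self[symmetric] cinner_diff_left cinner_diff_right
    by (simp add: cinner_commute[of "p f" f] algebra_simps)
  also have "\<dots> = of_real ((norm f)\<^sup>2 - (\<Sum>e\<in>F. (cmod (cinner e f))\<^sup>2))"
    unfolding pp fp by (simp only: cinner_self complex_cnj_complex_of_real of_real_diff diff_self diff_0_right)
  finally show "(norm (f - p f))\<^sup>2 = (norm f)\<^sup>2 - (\<Sum>e\<in>F. (cmod (cinner e f))\<^sup>2)"
    by (simp only: of_real_eq_iff)
qed

lemma bessel:
  assumes "orthonormal B" "finite F" "F \<subseteq> B"
  shows "(\<Sum>e\<in>F. (cmod (cinner e f))\<^sup>2) \<le> (norm f)\<^sup>2"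
  using orthonormal_projection(2)[OF assms, of f] by (smt (verit) zero_le_power2)

lemma tendsto_cinner_right:
  assumes "(g \<longlongrightarrow> h) F"
  shows "((\<lambda>x. cinner f (g x)) \<longlongrightarrow> cinner f h) F"
proof -
  have l: "((\<lambda>x. norm f * norm (g x - h)) \<longlongrightarrow> norm f * 0) F"
    by (rule tendsto_mult[OF tendsto_const tendsto_norm_zero[OF LIM_zero[OF assms]]])
  have "((\<lambda>x. cinner f (g x) - cinner f h) \<longlongrightarrow> 0) F"
    by (rule Lim_null_comparison[where g = "\<lambda>x. norm f * norm (g x - h)"])
      (use l in \<open>simp_all add: cinner_Cauchy_Schwarz flip: cinner_diff_right\<close>)
  then show ?thesis by (simp add: LIM_zero_iff)
qed

text \<open>Projections onto increasing finite sets with almost maximal Bessel sum form a Cauchy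
  sequence. The difference between \<open>f\<close> and their limit is orthogonal to all of
  \<open>B\<close>, hence zero. The basis itself may be uncountable.\<close>

lemma orthonormal_basis_approx:
  fixes B :: "'a::euclidean_space l2 set"
  assumes B: "orthonormal_basis B" and \<epsilon>: "\<epsilon> > 0"
  obtains F where "finite F" "F \<subseteq> B" "norm (f - (\<Sum>e\<in>F. cinner e f *\<^sub>C e)) < \<epsilon>"
proof -
  have o: "orthonormal B" and max: "\<And>f. (\<And>e. e \<in> B \<Longrightarrow> cinner e f = 0) \<Longrightarrow> f = 0"
    using B by (auto simp: orthonormal_basis_iff)
  define p where "p F = (\<Sum>e\<in>F. cinner e f *\<^sub>C e)" for F
  define q where "q F = (\<Sum>e\<in>F. (cmod (cinner e f))\<^sup>2)" for F
  define \<F> where "\<F> = {F. finite F \<and> F \<subseteq> B}"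
  define T where "T = Sup (q ` \<F>)"
  have bdd: "bdd_above (q ` \<F>)"
    by (rule bdd_aboveI[of _ "(norm f)\<^sup>2"]) (auto simp: \<F>_def q_def intro!: bessel[OF o])
  have qT: "q F \<le> T" if "F \<in> \<F>" for F
    unfolding T_def using bdd that by (intro cSup_upper) auto
  have ne: "q ` \<F> \<noteq> {}" by (auto simp: \<F>_def)
  \<comment> \<open>The slack is the square of the rate \<open>(1 / 2) ^ n\<close> at which
    successive projections have to approach each other.\<close>
  have "\<exists>F\<in>\<F>. T - (1 / 4) ^ n < q F" for n
    using less_cSup_iff[OF ne bdd, of "T - (1 / 4) ^ n"] by (auto simp: T_def)
  then obtain F where F: "\<And>n. F n \<in> \<F>" "\<And>n. T - (1 / 4) ^ n < q (F n)" by metis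
  define E where "E n = (\<Union>k\<le>n. F k)" for n
  have EF: "E n \<in> \<F>" for n using F(1) by (auto simp: E_def \<F>_def)
  have E_Suc: "E n \<subseteq> E (Suc n)" for n by (auto simp: E_def le_Suc_eq)
  have q_mono: "q F1 \<le> q F2" if "F1 \<subseteq> F2" "F2 \<in> \<F>" for F1 F2
    unfolding q_def using that by (intro sum_mono2) (auto simp: \<F>_def)
  have qE: "T - (1 / 4) ^ n < q (E n)" for n
  proof -
    have "F n \<subseteq> E n" by (auto simp: E_def)
    then show ?thesis using F(2)[of n] q_mono[OF _ EF[of n], of "F n"] by linarith
  qed
  have "norm (p (E (Suc n)) - p (E n)) \<le> (1 / 2) ^ n" for n
  proof -
    let ?D = "E (Suc n) - E n"
    have D: "finite ?D" "?D \<subseteq> B" using EF[of "Suc n"] by (auto simp: \<F>_def)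
    have fin: "finite (E (Suc n))" using EF[of "Suc n"] by (auto simp: \<F>_def)
    have "p (E (Suc n)) - p (E n) = p ?D"
      unfolding p_def using sum_diff[OF fin E_Suc[of n], of "\<lambda>e. cinner e f *\<^sub>C e"] by simp
    then have "(norm (p (E (Suc n)) - p (E n)))\<^sup>2 = q ?D"
      using orthonormal_projection(3)[OF o D, of f] by (simp add: p_def q_def)
    also have "\<dots> = q (E (Suc n)) - q (E n)"
      unfolding q_def using sum_diff[OF fin E_Suc[of n]] by simp
    also have "\<dots> \<le> (1 / 4) ^ n"
      using qT[OF EF[of "Suc n"]] qE[of n] by linarith
    also have "\<dots> = ((1 / 2) ^ n)\<^sup>2"
      by (simp add: power2_eq_square flip: power_mult_distrib)
    finally show ?thesis by (rule power2_le_imp_le) simp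
  qed
  then obtain s where "(\<lambda>N. \<Sum>n<N. p (E (Suc n)) - p (E n)) \<longlonglongrightarrow> s"
    by (rule l2_summable_geometric)
  then have "(\<lambda>N. p (E N) - p (E 0)) \<longlonglongrightarrow> s"
    by (simp only: sum_lessThan_telescope[of "\<lambda>n. p (E n)"])
  then have lim: "(\<lambda>N. p (E N)) \<longlonglongrightarrow> s + p (E 0)"
    using tendsto_add[OF _ tendsto_const, of "\<lambda>N. p (E N) - p (E 0)" s sequentially "p (E 0)"] by simp
  have "f - (s + p (E 0)) = 0"
  proof (rule max)
    fix e assume e: "e \<in> B"
    have c: "cinner e (p (E N)) = (if e \<in> E N then cinner e f else 0)" for N
      using orthonormal_projection(1)[OF o _ _ e, of "E N" f] EF[of N] by (auto simp: \<F>_def p_def)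
    have "(\<lambda>N. cinner e (p (E N))) \<longlonglongrightarrow> cinner e f"
    proof (cases "\<exists>M. e \<in> E M")
      case True
      then obtain M where "e \<in> E M" by auto
      then have "e \<in> E N" if "N \<ge> M" for N
        using that by (auto simp: E_def intro: order_trans)
      then show ?thesis
        unfolding c by (intro tendsto_eventually eventually_sequentiallyI[of M]) auto
    next
      case False
      \<comment> \<open>A basis vector outside every \<open>E n\<close> could be added to each of
        them, so its coefficient is bounded by the slack in the supremum.\<close>
      have le: "(cmod (cinner e f))\<^sup>2 \<le> (1 / 4) ^ n" for n
      proof -
        have "insert e (E n) \<in> \<F>" using EF[of n] e by (auto simp: \<F>_def)
        from qT[OF this] have "(cmod (cinner e f))\<^sup>2 + q (E n) \<le> T"
          using EF[of n] False by (simp add: q_def \<F>_def)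
        then show ?thesis using qE[of n] by linarith
      qed
      have "(cmod (cinner e f))\<^sup>2 \<le> 0"
        by (rule LIMSEQ_le_const[OF LIMSEQ_power_zero[of "1 / 4 :: real"]]) (use le in auto)
      then have "cinner e f = 0" by simp
      then show ?thesis using False by (simp add: c)
    qed
    then have "cinner e f = cinner e (s + p (E 0))"
      using tendsto_cinner_right[OF lim, of e] LIMSEQ_unique by blast
    then show "cinner e (f - (s + p (E 0))) = 0" by (simp add: cinner_diff_right)
  qed
  with lim have "(\<lambda>N. p (E N)) \<longlonglongrightarrow> f" by simp
  then have "\<forall>\<^sub>F N in sequentially. norm (p (E N) - f) < \<epsilon>"
    using \<epsilon> by (simp add: tendsto_iff dist_norm)
  then obtain N where "norm (p (E N) - f) < \<epsilon>"
    by (auto simp: eventually_sequentially)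
  then show ?thesis
    using EF[of N] by (intro that[of "E N"]) (auto simp: \<F>_def p_def norm_minus_commute)
qed

text \<open>Enlarging a finite set only improves the approximation of \<open>g\<close>, because the
  squared error is the squared norm minus the Bessel sum. One good set therefore controls all larger
  ones.\<close>

lemma parseval:
  assumes B: "orthonormal_basis B"
  shows "((\<lambda>e. cinner f e * cinner e g) has_sum cinner f g) B"
  unfolding has_sum_def tendsto_iff eventually_finite_subsets_at_top
proof (intro allI impI)
  fix \<epsilon> :: real assume \<epsilon>: "\<epsilon> > 0"
  have o: "orthonormal B" using B by (simp add: orthonormal_basis_iff)
  define p where "p F = (\<Sum>e\<in>F. cinner e g *\<^sub>C e)" for F
  \<comment> \<open>The summand 1 keeps the denominator positive when \<open>f\<close> is
    zero.\<close>
  have "\<epsilon> / (norm f + 1) > 0" using \<epsilon> by (simp add: add_nonneg_pos)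
  then obtain F where F: "finite F" "F \<subseteq> B" "norm (g - p F) < \<epsilon> / (norm f + 1)"
    unfolding p_def using orthonormal_basis_approx[OF B] by blast
  have "dist (\<Sum>e\<in>G. cinner f e * cinner e g) (cinner f g) < \<epsilon>" if G: "finite G" "F \<subseteq> G" "G \<subseteq> B" for G
  proof -
    have "(\<Sum>e\<in>G. cinner f e * cinner e g) = cinner f (p G)"
      unfolding p_def cinner_sum_right cinner_scaleC_right by (simp add: mult.commute)
    then have "dist (\<Sum>e\<in>G. cinner f e * cinner e g) (cinner f g) = cmod (cinner f (g - p G))"
      by (simp add: dist_norm cinner_diff_right norm_minus_commute)
    also have "\<dots> \<le> norm f * norm (g - p G)" by (rule cinner_Cauchy_Schwarz)
    also have "\<dots> \<le> norm f * norm (g - p F)"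
    proof (rule mult_left_mono)
      have "(\<Sum>e\<in>F. (cmod (cinner e g))\<^sup>2) \<le> (\<Sum>e\<in>G. (cmod (cinner e g))\<^sup>2)"
        using G by (intro sum_mono2) auto
      then have "(norm (g - p G))\<^sup>2 \<le> (norm (g - p F))\<^sup>2"
        unfolding p_def using orthonormal_projection(2)[OF o, of _ g] F G by simp
      then show "norm (g - p G) \<le> norm (g - p F)" by (rule power2_le_imp_le) simp
    qed simp
    also have "\<dots> \<le> (norm f + 1) * norm (g - p F)" by (intro mult_right_mono) auto
    also have "\<dots> < \<epsilon>"
      using F(3) by (simp add: pos_less_divide_eq add_nonneg_pos mult.commute)
    finally show ?thesis .
  qed
  then show "\<exists>X. finite X \<and> X \<subseteq> B \<and> (\<forall>Y. finite Y \<and> X \<subseteq> Y \<and> Y \<subseteq> B \<longrightarrow>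
      dist (\<Sum>e\<in>Y. cinner f e * cinner e g) (cinner f g) < \<epsilon>)"
    using F by blast
qed

text \<open>Cruder than Cauchy-Schwarz; what counts is that the bound is the same for every
  orthonormal system.\<close>

lemma bessel_product:
  assumes "orthonormal B" "finite F" "F \<subseteq> B"
  shows "(\<Sum>e\<in>F. cmod (cinner f e * cinner e g)) \<le> (norm f)\<^sup>2 + (norm g)\<^sup>2"
proof -
  have "cmod (cinner f e * cinner e g) \<le> (cmod (cinner e f))\<^sup>2 + (cmod (cinner e g))\<^sup>2" for e
  proof -
    have "cmod (cinner f e) = cmod (cinner e f)" by (metis cinner_commute complex_mod_cnj)
    moreover have "a * b \<le> a\<^sup>2 + b\<^sup>2" if "0 \<le> a" "0 \<le> b" for a b :: real
      using zero_le_power2[of "a - b"] mult_nonneg_nonneg[OF that] unfolding power2_diff by linarith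
    ultimately show ?thesis by (simp add: norm_mult)
  qed
  then have "(\<Sum>e\<in>F. cmod (cinner f e * cinner e g)) \<le> (\<Sum>e\<in>F. (cmod (cinner e f))\<^sup>2 + (cmod (cinner e g))\<^sup>2)"
    by (rule sum_mono)
  also have "\<dots> \<le> (norm f)\<^sup>2 + (norm g)\<^sup>2"
    unfolding sum.distrib by (intro add_mono bessel[OF assms])
  finally show ?thesis .
qed

text \<open>An orthonormal set that is maximal by Zorn is a basis: a nonzero vector orthogonal to it
  could be normalised and added.\<close>

lemma orthonormal_basis_exists: "\<exists>B :: 'a::euclidean_space l2 set. orthonormal_basis B"
proof -
  have "\<exists>M\<in>Collect orthonormal. \<forall>X\<in>Collect orthonormal. M \<subseteq> X \<longrightarrow> X = (M :: 'a l2 set)"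
  proof (rule subset_Zorn')
    fix C assume C: "subset.chain (Collect orthonormal) (C :: 'a l2 set set)"
    have "cinner e e' = (if e = e' then 1 else 0)" if ee: "e \<in> \<Union>C" "e' \<in> \<Union>C" for e e'
    proof -
      obtain X Y where "X \<in> C" "Y \<in> C" "e \<in> X" "e' \<in> Y" using ee by auto
      moreover from this have "X \<subseteq> Y \<or> Y \<subseteq> X" "orthonormal X" "orthonormal Y"
        using C by (auto simp: subset_chain_def)
      ultimately show ?thesis unfolding orthonormal_def by blast
    qed
    then show "\<Union>C \<in> Collect orthonormal" by (auto simp: orthonormal_def)
  qed
  then obtain M where M: "orthonormal M" "\<And>X. orthonormal X \<Longrightarrow> M \<subseteq> X \<Longrightarrow> X = (M :: 'a l2 set)" by auto
  have "f = 0" if f: "\<And>e. e \<in> M \<Longrightarrow> cinner e f = 0" for f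
  proof (rule ccontr)
    assume "f \<noteq> 0"
    define u where "u = complex_of_real (1 / norm f) *\<^sub>C f"
    have "norm u = 1" using \<open>f \<noteq> 0\<close> by (simp add: u_def norm_scaleC norm_divide)
    then have u: "cinner u u = 1" by (simp add: cinner_self)
    have eu: "cinner e u = 0" "cinner u e = 0" if "e \<in> M" for e
      using f[OF that] by (auto simp: u_def cinner_scaleC_right cinner_scaleC_left cinner_commute[of f e])
    have "orthonormal (insert u M)"
      using M(1) u eu by (auto simp: orthonormal_def)
    then have "u \<in> M" using M(2)[of "insert u M"] by auto
    then show False using eu[of u] u by simp
  qed
  then show ?thesis using M(1) by (auto simp: orthonormal_basis_iff)
qed

section \<open>Linear changes of variables\<close>

lemma nn_integral_lborel_translate:
  fixes c :: "'a::euclidean_space"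
  assumes [measurable]: "f \<in> borel_measurable borel"
  shows "(\<integral>\<^sup>+x. f (c + x) \<partial>lborel) = (\<integral>\<^sup>+x. f x \<partial>lborel)"
proof -
  have "(\<integral>\<^sup>+x. f x \<partial>lborel) = (\<integral>\<^sup>+x. f x \<partial>distr lborel borel ((+) c))"
    by (simp add: lborel_distr_plus)
  also have "\<dots> = (\<integral>\<^sup>+x. f (c + x) \<partial>lborel)"
    by (rule nn_integral_distr) auto
  finally show ?thesis by simp
qed

text \<open>Averaging over translations along \<open>b\<close>, with a weight of total mass one in that direction,
  turns the shear \<open>x + (a \<bullet> x) b\<close> into a translation.\<close>

lemma nn_integral_lborel_shear:
  fixes a b :: "'a::euclidean_space"
  assumes [measurable]: "f \<in> borel_measurable borel" and ab: "a \<bullet> b = 0"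
  shows "(\<integral>\<^sup>+x. f (x + (a \<bullet> x) *\<^sub>R b) \<partial>lborel) = (\<integral>\<^sup>+x. f x \<partial>lborel)"
proof (cases "b = 0")
  case False
  define \<beta> where "\<beta> x = (x \<bullet> b) / (b \<bullet> b)" for x
  define w where "w = (indicator {0..1} :: real \<Rightarrow> ennreal)"
  have [measurable]: "\<beta> \<in> borel_measurable borel" "w \<in> borel_measurable borel"
    unfolding \<beta>_def w_def by measurable
  have w1: "(\<integral>\<^sup>+s. w (t + s) \<partial>lborel) = 1" for t
    unfolding nn_integral_lborel_translate[of w, OF \<open>w \<in> borel_measurable borel\<close>]
    by (simp add: w_def)
  have \<beta>: "\<beta> ((- s) *\<^sub>R b + x) + s = \<beta> x" for x s
    using False by (simp add: \<beta>_def inner_add_left inner_diff_left add_divide_distrib diff_divide_distrib)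
  \<comment> \<open>Since \<open>\<beta>\<close> is the coordinate along \<open>b\<close>,
    translating \<open>x\<close> by \<open>- s *\<^sub>R b\<close> removes \<open>s\<close> from the
    weight. This leaves integrals over lines parallel to \<open>b\<close>, on each of which the
    shear is a translation because \<open>a\<close> is orthogonal to \<open>b\<close>.\<close>
  have slice: "(\<integral>\<^sup>+x. g x \<partial>lborel) = (\<integral>\<^sup>+x. w (\<beta> x) * (\<integral>\<^sup>+s. g ((- s) *\<^sub>R b + x) \<partial>lborel) \<partial>lborel)"
    if [measurable]: "g \<in> borel_measurable borel" for g :: "'a \<Rightarrow> ennreal"
  proof -
    have "(\<integral>\<^sup>+x. g x \<partial>lborel) = (\<integral>\<^sup>+x. \<integral>\<^sup>+s. g x * w (\<beta> x + s) \<partial>lborel \<partial>lborel)"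
      by (simp add: nn_integral_cmult w1)
    also have "\<dots> = (\<integral>\<^sup>+s. \<integral>\<^sup>+x. g x * w (\<beta> x + s) \<partial>lborel \<partial>lborel)"
      by (rule lborel_pair.Fubini') measurable
    also have "\<dots> = (\<integral>\<^sup>+s. \<integral>\<^sup>+x. g ((- s) *\<^sub>R b + x) * w (\<beta> x) \<partial>lborel \<partial>lborel)"
    proof (rule nn_integral_cong)
      fix s
      show "(\<integral>\<^sup>+x. g x * w (\<beta> x + s) \<partial>lborel) = (\<integral>\<^sup>+x. g ((- s) *\<^sub>R b + x) * w (\<beta> x) \<partial>lborel)"
        using nn_integral_lborel_translate[of "\<lambda>x. g x * w (\<beta> x + s)" "(- s) *\<^sub>R b"] unfolding \<beta>
        by simp
    qed
    also have "\<dots> = (\<integral>\<^sup>+x. \<integral>\<^sup>+s. g ((- s) *\<^sub>R b + x) * w (\<beta> x) \<partial>lborel \<partial>lborel)"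
      by (rule lborel_pair.Fubini') measurable
    also have "\<dots> = (\<integral>\<^sup>+x. w (\<beta> x) * (\<integral>\<^sup>+s. g ((- s) *\<^sub>R b + x) \<partial>lborel) \<partial>lborel)"
      unfolding mult.commute[of _ "w _"] by (intro nn_integral_cong nn_integral_cmult) measurable
    finally show ?thesis .
  qed
  have inner_eq: "(\<integral>\<^sup>+s. f ((- s) *\<^sub>R b + x + (a \<bullet> ((- s) *\<^sub>R b + x)) *\<^sub>R b) \<partial>lborel) = (\<integral>\<^sup>+s. f ((- s) *\<^sub>R b + x) \<partial>lborel)" for x
  proof -
    have "(\<integral>\<^sup>+s. f ((- (- (a \<bullet> x) + s)) *\<^sub>R b + x) \<partial>lborel) = (\<integral>\<^sup>+s. f ((- s) *\<^sub>R b + x) \<partial>lborel)"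
      by (rule nn_integral_lborel_translate) measurable
    moreover have "(- s) *\<^sub>R b + x + (a \<bullet> ((- s) *\<^sub>R b + x)) *\<^sub>R b = (- (- (a \<bullet> x) + s)) *\<^sub>R b + x" for s
      by (simp add: inner_add_right inner_diff_right ab algebra_simps)
    ultimately show ?thesis by (simp only:)
  qed
  have "(\<integral>\<^sup>+x. f (x + (a \<bullet> x) *\<^sub>R b) \<partial>lborel) = (\<integral>\<^sup>+x. w (\<beta> x) *
      (\<integral>\<^sup>+s. f ((- s) *\<^sub>R b + x + (a \<bullet> ((- s) *\<^sub>R b + x)) *\<^sub>R b) \<partial>lborel) \<partial>lborel)"
    by (rule slice) measurable
  also have "\<dots> = (\<integral>\<^sup>+x. f x \<partial>lborel)"
    unfolding inner_eq by (rule slice[symmetric]) measurable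
  finally show ?thesis .
qed simp

section \<open>Lebesgue measure under invertible matrices\<close>

lemma prod_Basis_cart:
  fixes x :: "real^'n" and g :: "real \<Rightarrow> 'a::comm_monoid_mult"
  shows "(\<Prod>b\<in>Basis. g (x \<bullet> b)) = (\<Prod>i\<in>UNIV. g (x $ i))"
proof -
  have B: "(Basis :: (real^'n) set) = (\<lambda>i. axis i 1) ` UNIV"
    by (auto simp: Basis_vec_def)
  have inj: "inj (\<lambda>i. axis i 1 :: real^'n)"
    by (auto simp: inj_on_def axis_eq_axis)
  have "(\<Prod>b\<in>Basis. g (x \<bullet> b)) = (\<Prod>i\<in>UNIV. g (x \<bullet> axis i 1))"
    unfolding B prod.reindex[OF inj] by simp
  then show ?thesis by (simp add: inner_axis)
qed

text \<open>An equality of measures with the determinant as a density passes to products of matrices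
  through nonnegative integrals and afterwards serves Bochner integrals as well.\<close>

definition scales_lborel :: "real^'n^'n::finite \<Rightarrow> bool" where
  "scales_lborel A \<longleftrightarrow> lborel = density (distr lborel borel ((*v) A)) (\<lambda>_. ennreal \<bar>det A\<bar>)"

lemma borel_measurable_matrix_vector_mult [measurable]:
  "(*v) (A :: real^'n^'m) \<in> borel_measurable borel"
  by (intro borel_measurable_continuous_onI linear_continuous_on) (simp add: linear_conv_bounded_linear[symmetric])

lemma scales_lborel_nn_integral:
  fixes A :: "real^'n^'n"
  shows "scales_lborel A \<longleftrightarrow> (\<forall>f\<in>borel_measurable borel. (\<integral>\<^sup>+x. f x \<partial>lborel) = ennreal \<bar>det A\<bar> * (\<integral>\<^sup>+x. f (A *v x) \<partial>lborel))"
proof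
  assume *: "scales_lborel A"
  show "\<forall>f\<in>borel_measurable borel. (\<integral>\<^sup>+x. f x \<partial>lborel) = ennreal \<bar>det A\<bar> * (\<integral>\<^sup>+x. f (A *v x) \<partial>lborel)"
  proof
    fix f :: "real^'n \<Rightarrow> ennreal" assume [measurable]: "f \<in> borel_measurable borel"
    show "(\<integral>\<^sup>+x. f x \<partial>lborel) = ennreal \<bar>det A\<bar> * (\<integral>\<^sup>+x. f (A *v x) \<partial>lborel)"
      by (subst *[unfolded scales_lborel_def]) (simp add: nn_integral_density nn_integral_distr nn_integral_cmult)
  qed
next
  assume *: "\<forall>f\<in>borel_measurable borel. (\<integral>\<^sup>+x. f x \<partial>lborel) = ennreal \<bar>det A\<bar> * (\<integral>\<^sup>+x. f (A *v x) \<partial>lborel)"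
  show "scales_lborel A"
    unfolding scales_lborel_def
  proof (rule measure_eqI)
    fix S :: "(real^'n) set" assume "S \<in> sets lborel"
    then have [measurable]: "S \<in> sets borel" by simp
    have "(\<lambda>x. indicator S (A *v x) :: ennreal) = indicator ((*v) A -` S)"
      by (auto simp: indicator_def)
    then show "emeasure lborel S = emeasure (density (distr lborel borel ((*v) A)) (\<lambda>_. ennreal \<bar>det A\<bar>)) S"
      using *[rule_format, of "indicator S"]
      by (simp add: emeasure_density nn_integral_cmult emeasure_distr measurable_sets_borel[OF borel_measurable_matrix_vector_mult])
  qed simp
qed

text \<open>A transposition squares to the identity, so its determinant has absolute value one, and
  it maps boxes to boxes with the same side lengths.\<close>

lemma scales_lborel_swap:
  assumes "m \<noteq> n"
  shows "scales_lborel (\<chi> i j. mat 1 $ i $ Transposition.transpose m n j :: real^'n^'n)" (is "scales_lborel ?A")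
proof -
  let ?t = "Transposition.transpose m n"
  have A: "?A *v x = (\<chi> i. x $ ?t i)" for x
  proof (rule vec_eq_iff[THEN iffD2], rule allI)
    fix i
    have "(?A *v x) $ i = (\<Sum>j\<in>UNIV. (if i = ?t j then 1 else 0) * x $ j)"
      by (simp add: matrix_vector_mult_def mat_def)
    also have "\<dots> = (\<Sum>j\<in>UNIV. if j = ?t i then x $ j else 0)"
      by (intro sum.cong) auto
    finally show "(?A *v x) $ i = (\<chi> i. x $ ?t i) $ i" by simp
  qed
  have "?A ** ?A = mat 1"
    by (simp add: matrix_eq A flip: matrix_vector_mul_assoc)
  then have "det ?A * det ?A = 1" by (metis det_I det_mul)
  then have det: "\<bar>det ?A\<bar> = 1" by (simp add: abs_square_eq_1 flip: power2_eq_square)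
  have "lborel = distr lborel borel ((*v) ?A)"
  proof (rule lborel_eqI)
    fix l u :: "real^'n" assume lu: "\<And>b. b \<in> Basis \<Longrightarrow> l \<bullet> b \<le> u \<bullet> b"
    have lu': "l $ i \<le> u $ i" for i using lu[of "axis i 1"] by (simp add: inner_axis)
    have "(*v) ?A -` box l u = box (?A *v l) (?A *v u)"
      unfolding A by (auto simp: mem_box_cart) (metis transpose_involutory)+
    then have "emeasure (distr lborel borel ((*v) ?A)) (box l u) = emeasure lborel (box (?A *v l) (?A *v u))"
      by (simp add: emeasure_distr)
    also have "\<dots> = (\<Prod>b\<in>Basis. ((?A *v u) - (?A *v l)) \<bullet> b)"
      using lu' by (intro emeasure_lborel_box) (auto simp: A Basis_vec_def inner_axis)
    also have "\<dots> = (\<Prod>i\<in>UNIV. (u - l) $ ?t i)"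
      unfolding prod_Basis_cart[of "\<lambda>y. y"] A by simp
    also have "\<dots> = (\<Prod>i\<in>UNIV. (u - l) $ i)"
      using prod.permute[OF permutes_swap_id[of m UNIV n], of "\<lambda>i. (u - l) $ i"] by (simp add: o_def)
    finally show "emeasure (distr lborel borel ((*v) ?A)) (box l u) = (\<Prod>b\<in>Basis. (u - l) \<bullet> b)"
      unfolding prod_Basis_cart[of "\<lambda>y. y"] .
  qed simp
  then show ?thesis unfolding scales_lborel_def det by (simp add: density_1)
qed

lemma scales_lborel_diagonal:
  assumes A: "\<And>i j. i \<noteq> j \<Longrightarrow> A $ i $ j = 0" and nz: "det A \<noteq> 0"
  shows "scales_lborel (A :: real^'n^'n)"
proof -
  have det: "det A = (\<Prod>i\<in>UNIV. A $ i $ i)" by (rule det_diagonal[OF A])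
  have nzi: "A $ i $ i \<noteq> 0" for i using nz unfolding det by simp
  define d where "d = (\<chi> i. A $ i $ i)"
  have Av: "(A *v x) $ i = A $ i $ i * x $ i" for x i
  proof -
    have "(A *v x) $ i = (\<Sum>j\<in>UNIV. A $ i $ j * x $ j)"
      by (simp add: matrix_vector_mult_def)
    also have "\<dots> = (\<Sum>j\<in>UNIV. if j = i then A $ i $ i * x $ i else 0)"
      by (intro sum.cong) (auto simp: A)
    finally show ?thesis by simp
  qed
  have T: "0 + (\<Sum>j\<in>Basis. ((d \<bullet> j) * (x \<bullet> j)) *\<^sub>R j) = A *v x" for x
  proof (rule euclidean_eqI)
    fix b :: "real^'n" assume b: "b \<in> Basis"
    then obtain i where i: "b = axis i 1" by (auto simp: Basis_vec_def)
    show "(0 + (\<Sum>j\<in>Basis. ((d \<bullet> j) * (x \<bullet> j)) *\<^sub>R j)) \<bullet> b = (A *v x) \<bullet> b"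
      using b by (simp add: inner_sum_left_Basis) (simp add: i inner_axis Av d_def)
  qed
  have "lborel = density (distr lborel borel (\<lambda>x. 0 + (\<Sum>j\<in>Basis. ((d \<bullet> j) * (x \<bullet> j)) *\<^sub>R j))) (\<lambda>_. (\<Prod>j\<in>Basis. \<bar>d \<bullet> j\<bar>))"
    by (rule lborel_affine_euclidean) (auto simp: Basis_vec_def inner_axis d_def nzi)
  then show ?thesis
    unfolding T prod_Basis_cart[of abs] scales_lborel_def det abs_prod by (simp add: d_def)
qed

text \<open>The matrix arises from the identity by a row operation, hence has determinant one, and
  acts as a shear along one axis controlled by an orthogonal one.\<close>

lemma scales_lborel_shear:
  assumes mn: "m \<noteq> n"
  shows "scales_lborel (\<chi> i j. if i = m \<and> j = n then c else of_bool (i = j) :: real^'n^'n)" (is "scales_lborel ?A")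
proof -
  have "?A = (\<chi> k. if k = m then row m (mat 1) + c *s row n (mat 1) else row k (mat 1))"
    using mn by (auto simp: vec_eq_iff row_def mat_def)
  then have det: "det ?A = 1" using det_row_operation[OF mn, of "mat 1 :: real^'n^'n" c] by simp
  have Av: "?A *v x = x + ((c *\<^sub>R axis n 1) \<bullet> x) *\<^sub>R axis m 1" for x
  proof (rule vec_eq_iff[THEN iffD2], rule allI)
    fix i
    have "(?A *v x) $ i = (\<Sum>j\<in>UNIV. (if i = m \<and> j = n then c else of_bool (i = j)) * x $ j)"
      by (simp add: matrix_vector_mult_def)
    also have "\<dots> = (\<Sum>j\<in>UNIV. (if j = i then x $ j else 0) + (if j = n then if i = m then c * x $ j else 0 else 0))"
      using mn by (intro sum.cong) auto
    also have "\<dots> = x $ i + (if i = m then c * x $ n else 0)"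
      unfolding sum.distrib by simp
    finally show "(?A *v x) $ i = (x + ((c *\<^sub>R axis n 1) \<bullet> x) *\<^sub>R axis m 1) $ i"
      by (simp add: inner_axis') (simp add: axis_def)
  qed
  have orth: "(c *\<^sub>R axis n 1) \<bullet> (axis m 1 :: real^'n) = 0"
    using mn by (simp add: inner_axis_axis)
  show ?thesis
    unfolding scales_lborel_nn_integral det Av
    using nn_integral_lborel_shear[OF _ orth] by simp
qed

text \<open>Induction over elementary matrices. The condition on the determinant sits inside the
  induction predicate: a product with nonzero determinant has two such factors, and a matrix with a
  zero row satisfies the predicate vacuously.\<close>

lemma lborel_matrix_vector_mult:
  assumes "det A \<noteq> 0"
  shows "lborel = density (distr lborel borel ((*v) A)) (\<lambda>_. ennreal \<bar>det (A :: real^'n^'n)\<bar>)"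
proof -
  have "det A \<noteq> 0 \<longrightarrow> scales_lborel A"
  proof (rule induct_matrix_elementary[where P = "\<lambda>A. det A \<noteq> 0 \<longrightarrow> scales_lborel A"])
    fix A B :: "real^'n^'n"
    assume AB: "det A \<noteq> 0 \<longrightarrow> scales_lborel A" "det B \<noteq> 0 \<longrightarrow> scales_lborel B"
    show "det (A ** B) \<noteq> 0 \<longrightarrow> scales_lborel (A ** B)"
    proof
      assume "det (A ** B) \<noteq> 0"
      then have A: "scales_lborel A" and B: "scales_lborel B" using AB by (auto simp: det_mul)
      show "scales_lborel (A ** B)"
        unfolding scales_lborel_nn_integral
      proof
        fix f :: "real^'n \<Rightarrow> ennreal" assume [measurable]: "f \<in> borel_measurable borel"
        have "(\<integral>\<^sup>+x. f x \<partial>lborel) = ennreal \<bar>det A\<bar> * (\<integral>\<^sup>+x. f (A *v x) \<partial>lborel)"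
          by (rule A[unfolded scales_lborel_nn_integral, rule_format]) measurable
        also have "(\<integral>\<^sup>+x. f (A *v x) \<partial>lborel) = ennreal \<bar>det B\<bar> * (\<integral>\<^sup>+x. f (A *v (B *v x)) \<partial>lborel)"
          by (rule B[unfolded scales_lborel_nn_integral, rule_format]) measurable
        finally show "(\<integral>\<^sup>+x. f x \<partial>lborel) = ennreal \<bar>det (A ** B)\<bar> * (\<integral>\<^sup>+x. f ((A ** B) *v x) \<partial>lborel)"
          by (simp only: det_mul abs_mult ennreal_mult[OF abs_ge_zero abs_ge_zero] mult.assoc matrix_vector_mul_assoc)
      qed
    qed
  next
    fix A :: "real^'n^'n" and i assume "row i A = 0"
    then show "det A \<noteq> 0 \<longrightarrow> scales_lborel A" by (simp add: det_zero_row)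
  next
    fix A :: "real^'n^'n" assume "\<And>i j. i \<noteq> j \<Longrightarrow> A $ i $ j = 0"
    then show "det A \<noteq> 0 \<longrightarrow> scales_lborel A" using scales_lborel_diagonal by blast
  next
    fix m n :: 'n assume "m \<noteq> n"
    then show "det (\<chi> i j. mat 1 $ i $ Transposition.transpose m n j :: real^'n^'n) \<noteq> 0 \<longrightarrow>
        scales_lborel (\<chi> i j. mat 1 $ i $ Transposition.transpose m n j :: real^'n^'n)"
      using scales_lborel_swap by blast
  next
    fix m n :: 'n and c :: real assume "m \<noteq> n"
    then show "det (\<chi> i j. if i = m \<and> j = n then c else of_bool (i = j) :: real^'n^'n) \<noteq> 0 \<longrightarrow>
        scales_lborel (\<chi> i j. if i = m \<and> j = n then c else of_bool (i = j) :: real^'n^'n)"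
      using scales_lborel_shear by blast
  qed
  then show ?thesis using assms by (simp add: scales_lborel_def)
qed

lemma integrable_scaleR_cancel:
  fixes f :: "'a \<Rightarrow> 'b::{banach, second_countable_topology}"
  assumes "c \<noteq> 0"
  shows "integrable M (\<lambda>x. c *\<^sub>R f x) \<longleftrightarrow> integrable M f"
  using assms integrable_scaleR_right[of "inverse c" M "\<lambda>x. c *\<^sub>R f x"] by auto

lemma lborel_integral_matrix_vector_mult:
  fixes F :: "real^'n \<Rightarrow> 'b::{banach, second_countable_topology}"
  assumes det: "det A \<noteq> 0" and [measurable]: "F \<in> borel_measurable borel"
  shows "integrable lborel (\<lambda>z. F (A *v z)) \<longleftrightarrow> integrable lborel F"
    and "(\<integral>z. F (A *v z) \<partial>lborel) = (\<integral>z. F z \<partial>lborel) /\<^sub>R \<bar>det A\<bar>"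
proof -
  have "integrable lborel F \<longleftrightarrow> integrable (density (distr lborel borel ((*v) A)) (\<lambda>_. ennreal \<bar>det A\<bar>)) F"
    using lborel_matrix_vector_mult[OF det] by simp
  also have "\<dots> \<longleftrightarrow> integrable lborel (\<lambda>z. F (A *v z))"
    using det by (subst integrable_density) (auto simp: integrable_distr_eq integrable_scaleR_cancel)
  finally show "integrable lborel (\<lambda>z. F (A *v z)) \<longleftrightarrow> integrable lborel F" ..
  have "(\<integral>z. F z \<partial>lborel) = (\<integral>z. F z \<partial>density (distr lborel borel ((*v) A)) (\<lambda>_. ennreal \<bar>det A\<bar>))"
    using lborel_matrix_vector_mult[OF det] by simp
  also have "\<dots> = \<bar>det A\<bar> *\<^sub>R (\<integral>z. F (A *v z) \<partial>lborel)"
    by (subst integral_density) (auto simp: integral_distr)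
  finally show "(\<integral>z. F (A *v z) \<partial>lborel) = (\<integral>z. F z \<partial>lborel) /\<^sub>R \<bar>det A\<bar>"
    using det by simp
qed

section \<open>Phase space as the product of the momentum and position spaces\<close>

lemma borel_measurable_stack [measurable]: "(\<lambda>p. stack (fst p) (snd p)) \<in> borel_measurable borel"
proof (intro borel_measurable_continuous_onI)
  show "continuous_on UNIV (\<lambda>p::(real^'n) \<times> (real^'n). stack (fst p) (snd p))"
    unfolding stack_def
  proof (intro continuous_on_vec_lambda)
    fix i :: "'n + 'n"
    show "continuous_on UNIV (\<lambda>p::(real^'n) \<times> (real^'n). case i of Inl a \<Rightarrow> fst p $ a | Inr a \<Rightarrow> snd p $ a)"
      by (cases i) (auto intro!: continuous_intros)
  qed
qed

text \<open>Boxes determine Lebesgue measure, and the preimage of a box under stacking is a product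
  of two boxes.\<close>

lemma lborel_stack:
  "distr (lborel :: ((real^'n) \<times> (real^'n)) measure) borel (\<lambda>p. stack (fst p) (snd p)) = lborel"
proof (rule lborel_eqI[symmetric])
  fix l u :: "real^('n + 'n)" assume lu: "\<And>b. b \<in> Basis \<Longrightarrow> l \<bullet> b \<le> u \<bullet> b"
  define L where "L f = (\<chi> a. f $ Inl a)" for f :: "real^('n + 'n)"
  define R where "R f = (\<chi> a. f $ Inr a)" for f :: "real^('n + 'n)"
  have lu': "l $ i \<le> u $ i" for i using lu[of "axis i 1"] by (simp add: inner_axis)
  have "(\<lambda>p. stack (fst p) (snd p)) -` box l u = box (L l) (L u) \<times> box (R l) (R u)"
    by (auto simp: mem_box_cart stack_def L_def R_def split_sum_all)
  then have "emeasure (distr lborel borel (\<lambda>p. stack (fst p) (snd p))) (box l u)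
      = emeasure (lborel \<Otimes>\<^sub>M lborel) (box (L l) (L u) \<times> box (R l) (R u))"
    by (simp add: emeasure_distr lborel_prod)
  also have "\<dots> = emeasure lborel (box (L l) (L u)) * emeasure lborel (box (R l) (R u))"
    by (rule lborel.emeasure_pair_measure_Times) auto
  also have "\<dots> = ennreal (\<Prod>a\<in>UNIV. (u - l) $ Inl a) * ennreal (\<Prod>a\<in>UNIV. (u - l) $ Inr a)"
  proof -
    have "emeasure lborel (box (L l) (L u)) = (\<Prod>b\<in>Basis. (L u - L l) \<bullet> b)"
      using lu' by (intro emeasure_lborel_box) (auto simp: L_def Basis_vec_def inner_axis)
    moreover have "emeasure lborel (box (R l) (R u)) = (\<Prod>b\<in>Basis. (R u - R l) \<bullet> b)"
      using lu' by (intro emeasure_lborel_box) (auto simp: R_def Basis_vec_def inner_axis)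
    ultimately show ?thesis
      unfolding prod_Basis_cart[of "\<lambda>y. y"] by (simp add: L_def R_def)
  qed
  also have "\<dots> = ennreal ((\<Prod>a\<in>UNIV. (u - l) $ Inl a) * (\<Prod>a\<in>UNIV. (u - l) $ Inr a))"
    using lu' by (intro ennreal_mult[symmetric] prod_nonneg) auto
  also have "(\<Prod>a\<in>UNIV. (u - l) $ Inl a) * (\<Prod>a\<in>UNIV. (u - l) $ Inr a) = (\<Prod>i\<in>UNIV. (u - l) $ i)"
    unfolding UNIV_Plus_UNIV[symmetric] by (subst prod.Plus) auto
  finally show "emeasure (distr lborel borel (\<lambda>p. stack (fst p) (snd p))) (box l u) = (\<Prod>b\<in>Basis. (u - l) \<bullet> b)"
    unfolding prod_Basis_cart[of "\<lambda>y. y"] .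
qed simp

lemma lborel_integral_stack:
  fixes F :: "real^('n::finite + 'n) \<Rightarrow> 'b::{banach, second_countable_topology}"
  assumes [measurable]: "F \<in> borel_measurable borel"
  shows "integrable lborel (\<lambda>p. F (stack (fst p) (snd p))) \<longleftrightarrow> integrable lborel F"
    and "(\<integral>p. F (stack (fst p) (snd p)) \<partial>lborel) = (\<integral>z. F z \<partial>lborel)"
proof -
  have "integrable lborel F \<longleftrightarrow> integrable (distr lborel borel (\<lambda>p. stack (fst p) (snd p))) F"
    by (simp add: lborel_stack)
  also have "\<dots> \<longleftrightarrow> integrable lborel (\<lambda>p. F (stack (fst p) (snd p)))"
    by (rule integrable_distr_eq) auto
  finally show "integrable lborel (\<lambda>p. F (stack (fst p) (snd p))) \<longleftrightarrow> integrable lborel F" ..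
  have "(\<integral>z. F z \<partial>lborel) = (\<integral>z. F z \<partial>distr lborel borel (\<lambda>p. stack (fst p) (snd p)))"
    by (simp add: lborel_stack)
  also have "\<dots> = (\<integral>p. F (stack (fst p) (snd p)) \<partial>lborel)"
    by (rule integral_distr) auto
  finally show "(\<integral>p. F (stack (fst p) (snd p)) \<partial>lborel) = (\<integral>z. F z \<partial>lborel)" ..
qed

section \<open>Summation under the integral and Weyl operators\<close>

text \<open>A summable family has countable support, which settles each rational parameter. By
  continuity an index that contributes at no rational parameter contributes nowhere.\<close>

lemma countable_support_continuous:
  fixes a :: "real \<Rightarrow> 'e \<Rightarrow> complex"
  assumes s: "\<And>s. a s summable_on B"
    and cont: "\<And>e. e \<in> B \<Longrightarrow> continuous_on UNIV (\<lambda>s. a s e)"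
  shows "countable {e\<in>B. \<exists>s. a s e \<noteq> 0}"
proof -
  have "{e\<in>B. \<exists>s. a s e \<noteq> 0} \<subseteq> (\<Union>s\<in>\<rat>. {e\<in>B. a s e \<noteq> 0})"
  proof
    fix e assume e: "e \<in> {e\<in>B. \<exists>s. a s e \<noteq> 0}"
    show "e \<in> (\<Union>s\<in>\<rat>. {e\<in>B. a s e \<noteq> 0})"
    proof (rule ccontr)
      assume "e \<notin> (\<Union>s\<in>\<rat>. {e\<in>B. a s e \<noteq> 0})"
      with e have z: "a s e = 0" if "s \<in> \<rat>" for s using that by auto
      have "a s e = 0" for s
        using continuous_constant_on_closure[of "\<rat>" "\<lambda>s. a s e" 0 s] z cont[of e] e
        by (auto simp: Rats_closure_real)
      with e show False by auto
    qed
  qed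
  moreover have "countable (\<Union>s\<in>\<rat>. {e\<in>B. a s e \<noteq> 0})"
    by (intro countable_UN countable_rat summable_countable_complex s)
  ultimately show ?thesis by (rule countable_subset)
qed

text \<open>The index set may be uncountable; continuity in the parameter reduces it to a countable one,
  where dominated convergence applies.\<close>

lemma has_sum_lebesgue_integral:
  fixes a :: "real \<Rightarrow> 'e \<Rightarrow> complex" and c :: "real \<Rightarrow> complex"
  assumes c: "integrable lborel c"
    and hs: "\<And>s. (a s has_sum \<tau>) B"
    and bound: "\<And>s F. finite F \<Longrightarrow> F \<subseteq> B \<Longrightarrow> (\<Sum>e\<in>F. cmod (a s e)) \<le> C"
    and cont: "\<And>e. e \<in> B \<Longrightarrow> continuous_on UNIV (\<lambda>s. a s e)"
  shows "finite F \<Longrightarrow> F \<subseteq> B \<Longrightarrow> (\<Sum>e\<in>F. cmod (\<integral>s. c s * a s e \<partial>lborel)) \<le> C * (\<integral>s. cmod (c s) \<partial>lborel)"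
    and "((\<lambda>e. \<integral>s. c s * a s e \<partial>lborel) has_sum (\<integral>s. c s \<partial>lborel) * \<tau>) B"
proof -
  have [measurable]: "c \<in> borel_measurable borel" using borel_measurable_integrable[OF c] by simp
  have am: "(\<lambda>s. a s e) \<in> borel_measurable borel" if "e \<in> B" for e
    using cont[OF that] by (rule borel_measurable_continuous_onI)
  have sC: "cmod (\<Sum>e\<in>F. a s e) \<le> C" if "finite F" "F \<subseteq> B" for s F
    using norm_sum[of "a s" F] bound[OF that, of s] by linarith
  have ci: "integrable lborel (\<lambda>s. c s * a s e)" if e: "e \<in> B" for e
  proof (rule Bochner_Integration.integrable_bound[of _ "\<lambda>s. C * c s"])
    show "integrable lborel (\<lambda>s. C * c s)" using c by auto
    show "(\<lambda>s. c s * a s e) \<in> borel_measurable lborel" using am[OF e] by measurable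
    show "AE s in lborel. norm (c s * a s e) \<le> norm (C * c s)"
    proof (rule AE_I2)
      fix s
      have "cmod (a s e) \<le> \<bar>C\<bar>" using sC[of "{e}" s] e by auto
      then show "norm (c s * a s e) \<le> norm (C * c s)"
        by (simp add: norm_mult mult.commute[of "cmod (c s)"] mult_right_mono)
    qed
  qed
  have fin: "(\<Sum>e\<in>F. cmod (\<integral>s. c s * a s e \<partial>lborel)) \<le> C * (\<integral>s. cmod (c s) \<partial>lborel)"
    if F: "finite F" "F \<subseteq> B" for F
  proof -
    have ni: "integrable lborel (\<lambda>s. cmod (c s * a s e))" if "e \<in> F" for e
      using ci[of e] that F by (intro integrable_norm) auto
    have "(\<Sum>e\<in>F. cmod (\<integral>s. c s * a s e \<partial>lborel)) \<le> (\<Sum>e\<in>F. \<integral>s. cmod (c s * a s e) \<partial>lborel)"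
      by (intro sum_mono integral_norm_bound)
    also have "\<dots> = (\<integral>s. (\<Sum>e\<in>F. cmod (c s * a s e)) \<partial>lborel)"
      using ni by (simp add: Bochner_Integration.integral_sum)
    also have "\<dots> \<le> (\<integral>s. C * cmod (c s) \<partial>lborel)"
    proof (rule integral_mono)
      show "(\<Sum>e\<in>F. cmod (c s * a s e)) \<le> C * cmod (c s)" for s
        unfolding norm_mult sum_distrib_left[symmetric]
        using mult_left_mono[OF bound[OF F, of s], of "cmod (c s)"] by (simp add: mult.commute)
    qed (use c ni in auto)
    finally show ?thesis by simp
  qed
  then show "finite F \<Longrightarrow> F \<subseteq> B \<Longrightarrow> (\<Sum>e\<in>F. cmod (\<integral>s. c s * a s e \<partial>lborel)) \<le> C * (\<integral>s. cmod (c s) \<partial>lborel)"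
    by blast
  define D where "D = {e\<in>B. \<exists>s. a s e \<noteq> 0}"
  have DB: "D \<subseteq> B" by (auto simp: D_def)
  have cD: "countable D"
    unfolding D_def by (intro countable_support_continuous cont has_sum_imp_summable[OF hs])
  have hsD: "(a s has_sum \<tau>) D" for s
    using hs[of s] by (subst has_sum_cong_neutral[where T = B and g = "a s"]) (auto simp: D_def)
  have "((\<lambda>e. \<integral>s. c s * a s e \<partial>lborel) has_sum (\<integral>s. c s \<partial>lborel) * \<tau>) D"
  proof (cases "finite D")
    case True
    have "\<tau> = (\<Sum>e\<in>D. a s e)" for s using hsD[of s] True by (simp add: has_sum_finite_iff)
    then have "(\<integral>s. c s \<partial>lborel) * \<tau> = (\<integral>s. (\<Sum>e\<in>D. c s * a s e) \<partial>lborel)"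
      using c by (simp add: sum_distrib_left[symmetric])
    also have "\<dots> = (\<Sum>e\<in>D. \<integral>s. c s * a s e \<partial>lborel)"
      using DB by (intro Bochner_Integration.integral_sum ci) auto
    finally show ?thesis using True by (simp add: has_sum_finite_iff)
  next
    case False
    define g where "g = from_nat_into D"
    have g: "bij_betw g UNIV D" unfolding g_def by (rule bij_betw_from_nat_into[OF cD False])
    have inj: "inj g" and ran: "g ` UNIV = D" using g by (auto simp: bij_betw_def)
    have gB: "g n \<in> B" for n using ran DB by auto
    have sumg: "(\<Sum>n<N. f (g n)) = (\<Sum>e\<in>g ` {..<N}. f e)" for f :: "'e \<Rightarrow> 'z::comm_monoid_add" and N
      using inj by (subst sum.reindex) (auto simp: inj_on_def)
    have "(\<lambda>N. \<integral>s. (\<Sum>n<N. c s * a s (g n)) \<partial>lborel) \<longlonglongrightarrow> (\<integral>s. c s * \<tau> \<partial>lborel)"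
    proof (rule integral_dominated_convergence[where w = "\<lambda>s. C * cmod (c s)"])
      show "(\<lambda>s. \<Sum>n<N. c s * a s (g n)) \<in> borel_measurable lborel" for N
        using ci[OF gB] by (intro borel_measurable_sum borel_measurable_integrable) auto
      show "AE s in lborel. (\<lambda>N. \<Sum>n<N. c s * a s (g n)) \<longlonglongrightarrow> c s * \<tau>"
      proof (rule AE_I2)
        fix s
        have "((a s \<circ> g) has_sum \<tau>) UNIV"
          using hsD[of s] has_sum_reindex[OF inj, of "a s" \<tau>] ran by simp
        then have "(a s \<circ> g) sums \<tau>" by (rule has_sum_imp_sums)
        then have "(\<lambda>n. c s * a s (g n)) sums (c s * \<tau>)" by (intro sums_mult) (simp add: o_def)
        then show "(\<lambda>N. \<Sum>n<N. c s * a s (g n)) \<longlonglongrightarrow> c s * \<tau>" by (simp add: sums_def)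
      qed
      show "AE s in lborel. norm (\<Sum>n<N. c s * a s (g n)) \<le> C * cmod (c s)" for N
      proof (rule AE_I2)
        fix s
        have "cmod (\<Sum>n<N. a s (g n)) \<le> C"
          unfolding sumg by (rule sC) (use gB in auto)
        then show "norm (\<Sum>n<N. c s * a s (g n)) \<le> C * cmod (c s)"
          unfolding sum_distrib_left[symmetric] norm_mult mult.commute[of C] by (intro mult_left_mono) auto
      qed
    qed (use c in auto)
    moreover have "(\<integral>s. (\<Sum>n<N. c s * a s (g n)) \<partial>lborel) = (\<Sum>n<N. \<integral>s. c s * a s (g n) \<partial>lborel)" for N
      by (intro Bochner_Integration.integral_sum ci gB)
    ultimately have "(\<lambda>n. \<integral>s. c s * a s (g n) \<partial>lborel) sums ((\<integral>s. c s \<partial>lborel) * \<tau>)"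
      by (simp add: sums_def)
    \<comment> \<open>Absolute summability is what turns the series in the chosen enumeration back
      into an unordered sum.\<close>
    moreover have "summable (\<lambda>n. cmod (\<integral>s. c s * a s (g n) \<partial>lborel))"
    proof (rule bounded_imp_summable)
      show "(\<Sum>n\<le>N. cmod (\<integral>s. c s * a s (g n) \<partial>lborel)) \<le> C * (\<integral>s. cmod (c s) \<partial>lborel)" for N
        unfolding lessThan_Suc_atMost[symmetric]
        unfolding sumg[of "\<lambda>e. cmod (\<integral>s. c s * a s e \<partial>lborel)"]
        by (rule fin) (use gB in auto)
    qed simp
    ultimately have "((\<lambda>n. \<integral>s. c s * a s (g n) \<partial>lborel) has_sum (\<integral>s. c s \<partial>lborel) * \<tau>) UNIV"
      by (intro norm_summable_imp_has_sum)
    then show ?thesis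
      using has_sum_reindex[OF inj, of "\<lambda>e. \<integral>s. c s * a s e \<partial>lborel"] ran by (simp add: o_def)
  qed
  then show "((\<lambda>e. \<integral>s. c s * a s e \<partial>lborel) has_sum (\<integral>s. c s \<partial>lborel) * \<tau>) B"
    by (subst has_sum_cong_neutral[where T = D and g = "\<lambda>e. \<integral>s. c s * a s e \<partial>lborel"]) (auto simp: D_def)
qed

section \<open>Weyl operators as unitaries\<close>

lemma lborel_integral_translate:
  fixes f :: "'a::euclidean_space \<Rightarrow> 'b::{banach, second_countable_topology}"
  assumes [measurable]: "f \<in> borel_measurable borel"
  shows "integrable lborel (\<lambda>x. f (x - h)) \<longleftrightarrow> integrable lborel f"
    and "(\<integral>x. f (x - h) \<partial>lborel) = (\<integral>x. f x \<partial>lborel)"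
proof -
  have "integrable lborel f \<longleftrightarrow> integrable (distr lborel borel ((+) (- h))) f"
    by (simp add: lborel_distr_plus)
  also have "\<dots> \<longleftrightarrow> integrable lborel (\<lambda>x. f (x - h))"
    by (subst integrable_distr_eq) auto
  finally show "integrable lborel (\<lambda>x. f (x - h)) \<longleftrightarrow> integrable lborel f" ..
  have "(\<integral>x. f x \<partial>lborel) = (\<integral>x. f x \<partial>distr lborel borel ((+) (- h)))"
    by (simp add: lborel_distr_plus)
  also have "\<dots> = (\<integral>x. f (x - h) \<partial>lborel)"
    by (subst integral_distr) auto
  finally show "(\<integral>x. f (x - h) \<partial>lborel) = (\<integral>x. f x \<partial>lborel)" ..
qed

lemma weyl_abs_l2:
  assumes "square_integrable F"
  shows "weyl k h (abs_l2 F) = abs_l2 (\<lambda>x. exp (\<i> * of_real (k \<bullet> x)) * F (x - h))"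
  using assms
  by (simp add: weyl_def U_op.abs_eq V_op.abs_eq l2_rel_refl square_integrable_translate)

lemma square_integrable_weyl:
  assumes "square_integrable F"
  shows "square_integrable (\<lambda>x. exp (\<i> * of_real (k \<bullet> x)) * F (x - h))"
  by (rule square_integrable_mult[where B = 1]) (use assms in \<open>auto intro: square_integrable_translate\<close>)

lemma cinner_weyl_weyl: "cinner (weyl k h f) (weyl k h g) = cinner f g"
proof -
  obtain F G where F: "square_integrable F" "f = abs_l2 F" and G: "square_integrable G" "g = abs_l2 G"
    by (metis l2_cases)
  have [measurable]: "F \<in> borel_measurable borel" "G \<in> borel_measurable borel"
    using F(1) G(1) by (auto simp: square_integrable_def)
  have "cinner (weyl k h f) (weyl k h g) =
      (\<integral>x. cnj (exp (\<i> * of_real (k \<bullet> x)) * F (x - h)) * (exp (\<i> * of_real (k \<bullet> x)) * G (x - h)) \<partial>lborel)"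
    using F G by (simp add: weyl_abs_l2 cinner.abs_eq l2_rel_refl square_integrable_weyl)
  also have "\<dots> = (\<integral>x. cnj (F (x - h)) * G (x - h) \<partial>lborel)"
  proof (rule Bochner_Integration.integral_cong)
    fix x
    have "cnj (exp (\<i> * of_real (k \<bullet> x))) * exp (\<i> * of_real (k \<bullet> x)) = 1"
      by (simp add: exp_cnj mult_exp_exp)
    then show "cnj (exp (\<i> * of_real (k \<bullet> x)) * F (x - h)) * (exp (\<i> * of_real (k \<bullet> x)) * G (x - h)) = cnj (F (x - h)) * G (x - h)"
      by (metis complex_cnj_mult mult.assoc mult.left_commute mult_1)
  qed simp
  also have "\<dots> = (\<integral>x. cnj (F x) * G x \<partial>lborel)"
    using lborel_integral_translate(2)[of "\<lambda>x. cnj (F x) * G x" h] by simp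
  finally show ?thesis using F G by (simp add: cinner.abs_eq l2_rel_refl)
qed

lemma weyl_weyl: "weyl k h (weyl k' h' f) = exp (- \<i> * of_real (k' \<bullet> h)) *\<^sub>C weyl (k + k') (h + h') f"
proof -
  obtain F where F: "square_integrable F" "f = abs_l2 F" by (rule l2_cases)
  have "exp (\<i> * of_real (k \<bullet> x)) * (exp (\<i> * of_real (k' \<bullet> (x - h))) * F (x - h - h'))
      = exp (- \<i> * of_real (k' \<bullet> h)) * (exp (\<i> * of_real ((k + k') \<bullet> x)) * F (x - (h + h')))" for x
    by (simp add: inner_diff_right inner_add_left mult_exp_exp algebra_simps flip: mult.assoc)
  then show ?thesis
    using F by (simp add: weyl_abs_l2 square_integrable_weyl scaleC.abs_eq l2_rel_refl del: minus_diff_eq)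
qed

lemma weyl_0: "weyl 0 0 f = f"
proof -
  obtain F where F: "square_integrable F" "f = abs_l2 F" by (rule l2_cases)
  then show ?thesis by (simp add: weyl_abs_l2)
qed

lemma weyl_scaleC: "weyl k h (c *\<^sub>C f) = c *\<^sub>C weyl k h f"
proof -
  obtain F where F: "square_integrable F" "f = abs_l2 F" by (rule l2_cases)
  then show ?thesis
    by (simp add: weyl_abs_l2 scaleC.abs_eq l2_rel_refl square_integrable_scale square_integrable_weyl mult.left_commute)
qed

lemma scaleC_scaleC: "a *\<^sub>C b *\<^sub>C f = (a * b) *\<^sub>C f"
proof -
  obtain F where F: "square_integrable F" "f = abs_l2 F" by (rule l2_cases)
  then show ?thesis
    by (simp add: scaleC.abs_eq l2_rel_refl square_integrable_scale mult.assoc)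
qed

lemma scaleC_one: "1 *\<^sub>C f = f"
  using scaleR_one[of f] by (simp add: scaleR_l2_def)

lemma norm_weyl: "norm (weyl k h f) = norm f"
proof -
  have "complex_of_real ((norm (weyl k h f))\<^sup>2) = of_real ((norm f)\<^sup>2)"
    unfolding cinner_self[symmetric] by (rule cinner_weyl_weyl)
  then show ?thesis by (simp only: of_real_eq_iff power2_eq_iff_nonneg[OF norm_ge_zero norm_ge_zero])
qed

lemma surj_weyl: "surj (weyl k h)"
proof (rule surjI)
  fix f
  show "weyl k h (exp (- \<i> * of_real (k \<bullet> h)) *\<^sub>C weyl (- k) (- h) f) = f"
    by (simp add: weyl_scaleC weyl_weyl weyl_0 scaleC_scaleC mult_exp_exp scaleC_one)
qed

text \<open>The exponent is the symplectic form of the two phase space points. Conjugation by a Weyl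
  operator thus multiplies a Weyl symbol by a character, and every character arises in this
  way.\<close>

lemma weyl_commute:
  "cinner (weyl k' h' f) (weyl k h (weyl k' h' g)) = exp (\<i> * of_real (k \<bullet> h' - k' \<bullet> h)) * cinner f (weyl k h g)"
proof -
  have "weyl k h (weyl k' h' g) = exp (\<i> * of_real (k \<bullet> h' - k' \<bullet> h)) *\<^sub>C weyl k' h' (weyl k h g)"
    by (simp add: weyl_weyl scaleC_scaleC mult_exp_exp algebra_simps)
  then show ?thesis by (simp add: cinner_scaleC_right cinner_weyl_weyl)
qed

lemma orthonormal_basis_weyl:
  assumes "orthonormal_basis B"
  shows "orthonormal_basis (weyl k h ` B)" "inj_on (weyl k h) B"
proof -
  have B: "orthonormal B" "\<And>f. (\<And>e. e \<in> B \<Longrightarrow> cinner e f = 0) \<Longrightarrow> f = 0"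
    using assms by (auto simp: orthonormal_basis_iff)
  show inj: "inj_on (weyl k h) B"
  proof (rule inj_onI)
    fix e e' assume e: "e \<in> B" "e' \<in> B" and eq: "weyl k h e = weyl k h e'"
    have "cinner e e' = cinner e e" using eq by (metis cinner_weyl_weyl)
    then show "e = e'" using B(1) e by (auto simp: orthonormal_def split: if_splits)
  qed
  have "orthonormal (weyl k h ` B)"
    using B(1) inj by (auto simp: orthonormal_def cinner_weyl_weyl inj_on_eq_iff)
  moreover have "f = 0" if f: "\<forall>e\<in>weyl k h ` B. cinner e f = 0" for f
  proof -
    obtain g where g: "f = weyl k h g" using surj_weyl by (metis surjD)
    have "g = 0" using f by (intro B(2)) (auto simp: g cinner_weyl_weyl)
    then have "norm f = 0" by (simp add: g norm_weyl)
    then show "f = 0" by simp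
  qed
  ultimately show "orthonormal_basis (weyl k h ` B)" by (auto simp: orthonormal_basis_iff)
qed

definition mom :: "real^('n::finite + 'n) \<Rightarrow> real^'n" where "mom z = (\<chi> a. z $ Inl a)"
definition pos :: "real^('n::finite + 'n) \<Rightarrow> real^'n" where "pos z = (\<chi> a. z $ Inr a)"

lemma weyl_vec_eq: "weyl_vec z = weyl (mom z) (pos z)"
  by (simp add: weyl_vec_def mom_def pos_def)

lemma mom_stack [simp]: "mom (stack k h) = k" and pos_stack [simp]: "pos (stack k h) = h"
  by (simp_all add: mom_def pos_def stack_def vec_eq_iff)

lemma weyl_vec_stack: "weyl_vec (stack k h) = weyl k h"
  by (simp add: weyl_vec_eq)

lemma continuous_mom: "continuous_on UNIV mom" and continuous_pos: "continuous_on UNIV pos"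
  unfolding mom_def[abs_def] pos_def[abs_def] by (intro continuous_intros)+

lemma borel_measurable_mom [measurable]: "mom \<in> borel_measurable borel"
  and borel_measurable_pos [measurable]: "pos \<in> borel_measurable borel"
  using continuous_mom continuous_pos by (auto intro: borel_measurable_continuous_onI)

lemma inner_mom_pos: "z \<bullet> w = mom z \<bullet> mom w + pos z \<bullet> pos w"
  unfolding inner_vec_def mom_def pos_def UNIV_Plus_UNIV[symmetric] by (subst sum.Plus) auto

lemma borel_measurable_weyl_coefficient [measurable]:
  "(\<lambda>z. cinner f (weyl_vec z g)) \<in> borel_measurable borel"
proof -
  obtain F G where F: "square_integrable F" "f = abs_l2 F" and G: "square_integrable G" "g = abs_l2 G"
    by (metis l2_cases)
  have [measurable]: "F \<in> borel_measurable borel" "G \<in> borel_measurable borel"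
    using F(1) G(1) by (auto simp: square_integrable_def)
  have "cinner f (weyl_vec z g) = (\<integral>x. cnj (F x) * (exp (\<i> * of_real (mom z \<bullet> x)) * G (x - pos z)) \<partial>lborel)" for z
    using F G by (simp add: weyl_vec_eq weyl_abs_l2 cinner.abs_eq l2_rel_refl square_integrable_weyl)
  moreover have "(\<lambda>z. \<integral>x. cnj (F x) * (exp (\<i> * of_real (mom z \<bullet> x)) * G (x - pos z)) \<partial>lborel) \<in> borel_measurable borel"
    by (rule lborel.borel_measurable_lebesgue_integral) measurable
  ultimately show ?thesis by simp
qed

lemma weyl_coefficient_bound: "cmod (cinner f (weyl_vec z g)) \<le> norm f * norm g"
  using cinner_Cauchy_Schwarz[of f "weyl_vec z g"] by (simp add: weyl_vec_eq norm_weyl)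

section \<open>Traces of Weyl integrals\<close>

text \<open>The operator obtained by placing weight \<open>\<rho> z\<close> on the Weyl operator at
  \<open>X z\<close>, which is the form in which a channel with matrix \<open>X\<close> returns its
  output. Keeping \<open>X\<close> inside postpones the substitution, and with it the determinant,
  to the one operator whose trace is computed explicitly.\<close>

definition weyl_form :: "real^('n::finite + 'n)^('n + 'n) \<Rightarrow> (real^('n + 'n) \<Rightarrow> complex) \<Rightarrow>
    (real^'n) l2 \<Rightarrow> (real^'n) l2 \<Rightarrow> complex" where
  "weyl_form X \<rho> f g = (\<integral>z. \<rho> z * cinner f (weyl_vec (X *v z) g) \<partial>lborel)"

lemma integrable_weyl_form:
  assumes \<rho>: "integrable lborel \<rho>"
  shows "integrable lborel (\<lambda>z. \<rho> z * cinner f (weyl_vec (X *v z) g))"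
proof (rule Bochner_Integration.integrable_bound[of _ "\<lambda>z. of_real (norm f * norm g) * \<rho> z"])
  have [measurable]: "\<rho> \<in> borel_measurable borel" using borel_measurable_integrable[OF \<rho>] by simp
  show "(\<lambda>z. \<rho> z * cinner f (weyl_vec (X *v z) g)) \<in> borel_measurable lborel"
    by measurable
  show "AE z in lborel. norm (\<rho> z * cinner f (weyl_vec (X *v z) g)) \<le> norm (of_real (norm f * norm g) * \<rho> z)"
    by (auto simp: norm_mult mult.commute[of _ "cmod (\<rho> _)"] intro!: AE_I2 mult_left_mono weyl_coefficient_bound)
qed (use \<rho> in auto)

lemma integrable_lborel_product:
  fixes f :: "'a::euclidean_space \<Rightarrow> complex" and g :: "'b::euclidean_space \<Rightarrow> complex"
  assumes f: "integrable lborel f" and g: "integrable lborel g"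
  shows "integrable (lborel \<Otimes>\<^sub>M lborel) (\<lambda>p. f (fst p) * g (snd p))"
proof (rule lborel_pair.Fubini_integrable)
  have [measurable]: "f \<in> borel_measurable borel" "g \<in> borel_measurable borel"
    using borel_measurable_integrable[OF f] borel_measurable_integrable[OF g] by auto
  show "(\<lambda>p. f (fst p) * g (snd p)) \<in> borel_measurable (lborel \<Otimes>\<^sub>M lborel)"
    by measurable
qed (use f g in \<open>auto simp: norm_mult\<close>)

text \<open>Supplies the continuity in the parameter that \<open>has_sum_lebesgue_integral\<close>
  asks for.\<close>

lemma continuous_on_fourier_integral:
  fixes q :: "'a::euclidean_space \<Rightarrow> complex"
  assumes q: "integrable lborel q" and [measurable]: "l \<in> borel_measurable borel"
  shows "continuous_on UNIV (\<lambda>s. \<integral>z. q z * exp (\<i> * of_real (s * l z)) \<partial>lborel)"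
proof (rule continuous_on_sequentiallyI)
  fix u :: "nat \<Rightarrow> real" and a assume "u \<longlonglongrightarrow> a"
  have [measurable]: "q \<in> borel_measurable borel" using borel_measurable_integrable[OF q] by simp
  show "(\<lambda>n. \<integral>z. q z * exp (\<i> * of_real (u n * l z)) \<partial>lborel) \<longlonglongrightarrow> (\<integral>z. q z * exp (\<i> * of_real (a * l z)) \<partial>lborel)"
  proof (rule integral_dominated_convergence[where w = "\<lambda>z. cmod (q z)"])
    show "AE z in lborel. (\<lambda>n. q z * exp (\<i> * of_real (u n * l z))) \<longlonglongrightarrow> q z * exp (\<i> * of_real (a * l z))"
      using \<open>u \<longlonglongrightarrow> a\<close> by (intro AE_I2 tendsto_intros)
    show "AE z in lborel. norm (q z * exp (\<i> * of_real (u n * l z))) \<le> cmod (q z)" for n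
      by (simp add: norm_mult)
  qed (use q in auto)
qed

text \<open>Quantifying over all bases makes the notion stable under conjugation by Weyl operators.\<close>

definition has_weyl_trace :: "real^('n::finite + 'n)^('n + 'n) \<Rightarrow> (real^('n + 'n) \<Rightarrow> complex) \<Rightarrow> complex \<Rightarrow> bool" where
  "has_weyl_trace X \<rho> \<tau> \<longleftrightarrow> integrable lborel \<rho> \<and>
     (\<exists>C. \<forall>B F. orthonormal_basis B \<longrightarrow> finite F \<longrightarrow> F \<subseteq> B \<longrightarrow> (\<Sum>e\<in>F. cmod (weyl_form X \<rho> e e)) \<le> C) \<and>
     (\<forall>B. orthonormal_basis B \<longrightarrow> ((\<lambda>e. weyl_form X \<rho> e e) has_sum \<tau>) B)"

lemma has_weyl_trace_scale:
  assumes "has_weyl_trace X \<rho> \<tau>"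
  shows "has_weyl_trace X (\<lambda>z. c * \<rho> z) (c * \<tau>)"
proof -
  obtain C where \<rho>: "integrable lborel \<rho>"
    and C: "\<And>B F. orthonormal_basis B \<Longrightarrow> finite F \<Longrightarrow> F \<subseteq> B \<Longrightarrow> (\<Sum>e\<in>F. cmod (weyl_form X \<rho> e e)) \<le> C"
    and hs: "\<And>B. orthonormal_basis B \<Longrightarrow> ((\<lambda>e. weyl_form X \<rho> e e) has_sum \<tau>) B"
    using assms unfolding has_weyl_trace_def by blast
  have eq: "weyl_form X (\<lambda>z. c * \<rho> z) f g = c * weyl_form X \<rho> f g" for f g
    by (simp add: weyl_form_def mult.assoc)
  have "(\<Sum>e\<in>F. cmod (weyl_form X (\<lambda>z. c * \<rho> z) e e)) \<le> cmod c * C"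
    if "orthonormal_basis B" "finite F" "F \<subseteq> B" for B F
    unfolding eq norm_mult sum_distrib_left[symmetric] by (intro mult_left_mono C[OF that]) auto
  moreover have "((\<lambda>e. weyl_form X (\<lambda>z. c * \<rho> z) e e) has_sum c * \<tau>) B" if "orthonormal_basis B" for B
    unfolding eq by (rule has_sum_cmult_right[OF hs[OF that]])
  ultimately show ?thesis
    unfolding has_weyl_trace_def using \<rho> by auto
qed

text \<open>A Gaussian factor \<open>exp (- \<alpha> (l \<bullet> z)\<^sup>2)\<close> is a superposition of characters, and multiplying the
  symbol by a character conjugates the operator by a Weyl operator.\<close>

lemma has_weyl_trace_gaussian_factor:
  fixes X :: "real^('n::finite + 'n)^('n + 'n)"
  assumes tr: "has_weyl_trace X \<rho> \<tau>" and X: "invertible X" and \<alpha>: "Re \<alpha> > 0"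
  shows "has_weyl_trace X (\<lambda>z. \<rho> z * exp (- \<alpha> * of_real (l \<bullet> z) ^ 2)) \<tau>"
proof -
  obtain C where \<rho>: "integrable lborel \<rho>"
    and C: "\<And>B F. orthonormal_basis B \<Longrightarrow> finite F \<Longrightarrow> F \<subseteq> B \<Longrightarrow> (\<Sum>e\<in>F. cmod (weyl_form X \<rho> e e)) \<le> C"
    and hs: "\<And>B. orthonormal_basis B \<Longrightarrow> ((\<lambda>e. weyl_form X \<rho> e e) has_sum \<tau>) B"
    using tr unfolding has_weyl_trace_def by blast
  have [measurable]: "\<rho> \<in> borel_measurable borel" using borel_measurable_integrable[OF \<rho>] by simp
  obtain c where c: "integrable lborel c"
    and ft: "\<And>x. (\<integral>s. c s * exp (\<i> * of_real (s * x)) \<partial>lborel) = exp (- \<alpha> * of_real x ^ 2)"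
    using cgauss_is_fourier_transform[OF \<alpha>] by blast
  have [measurable]: "c \<in> borel_measurable borel" using borel_measurable_integrable[OF c] by simp
  have c1: "(\<integral>s. c s \<partial>lborel) = 1" using ft[of 0] by simp
  \<comment> \<open>The functional \<open>l \<bullet> z\<close> has to be rewritten as a functional
    of the point \<open>X z\<close>, where the Weyl operator sits; invertibility of \<open>X\<close>
    makes this possible.\<close>
  obtain w where w: "transpose X *v w = l"
  proof -
    obtain X' where "X' ** X = mat 1" using X by (auto simp: invertible_def)
    then have "transpose X ** transpose X' = mat 1" by (metis matrix_transpose_mul transpose_mat)
    then have "transpose X *v (transpose X' *v l) = l"
      by (simp only: matrix_vector_mul_assoc matrix_vector_mul_lid)
    then show ?thesis by (rule that)
  qed
  \<comment> \<open>The swapped halves with one sign changed are \<open>w\<close> rotated by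
    \<open>sympl_J\<close>, up to sign, so that the symplectic form in \<open>weyl_commute\<close>
    becomes the inner product with \<open>w\<close>.\<close>
  define M where "M s = weyl (- (s *\<^sub>R pos w)) (s *\<^sub>R mom w)" for s
  have conj: "cinner (M s f) (weyl_vec (X *v z) (M s g)) = exp (\<i> * of_real (s * (l \<bullet> z))) * cinner f (weyl_vec (X *v z) g)"
    for s z f g
  proof -
    have "l \<bullet> z = w \<bullet> (X *v z)"
      unfolding w[symmetric] by (metis dot_lmul_matrix inner_commute transpose_matrix_vector vector_transpose_matrix transpose_transpose)
    then show ?thesis
      unfolding M_def weyl_vec_eq weyl_commute inner_mom_pos
      by (simp add: inner_commute algebra_simps)
  qed
  have form: "weyl_form X \<rho> (M s f) (M s g) = (\<integral>z. (\<rho> z * cinner f (weyl_vec (X *v z) g)) * exp (\<i> * of_real (s * (l \<bullet> z))) \<partial>lborel)" for s f g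
    unfolding weyl_form_def conj by (simp add: mult_ac)
  have form': "weyl_form X (\<lambda>z. \<rho> z * exp (- \<alpha> * of_real (l \<bullet> z) ^ 2)) f g = (\<integral>s. c s * weyl_form X \<rho> (M s f) (M s g) \<partial>lborel)" for f g
  proof -
    define q where "q z = \<rho> z * cinner f (weyl_vec (X *v z) g)" for z
    have q: "integrable lborel q" unfolding q_def by (rule integrable_weyl_form[OF \<rho>])
    have [measurable]: "q \<in> borel_measurable borel" using borel_measurable_integrable[OF q] by simp
    have int: "integrable (lborel \<Otimes>\<^sub>M lborel) (\<lambda>(s, z). c s * (q z * exp (\<i> * of_real (s * (l \<bullet> z)))))"
      by (rule Bochner_Integration.integrable_bound[OF integrable_lborel_product[OF c q]])
        (auto simp: norm_mult split_beta)
    have "weyl_form X (\<lambda>z. \<rho> z * exp (- \<alpha> * of_real (l \<bullet> z) ^ 2)) f g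
        = (\<integral>z. (\<integral>s. c s * (q z * exp (\<i> * of_real (s * (l \<bullet> z)))) \<partial>lborel) \<partial>lborel)"
      unfolding weyl_form_def
    proof (rule Bochner_Integration.integral_cong)
      fix z
      have "(\<integral>s. c s * (q z * exp (\<i> * of_real (s * (l \<bullet> z)))) \<partial>lborel) = q z * exp (- \<alpha> * of_real (l \<bullet> z) ^ 2)"
        unfolding ft[symmetric] by (subst integral_mult_right_zero[symmetric]) (simp add: mult_ac)
      then show "\<rho> z * exp (- \<alpha> * of_real (l \<bullet> z) ^ 2) * cinner f (weyl_vec (X *v z) g)
          = (\<integral>s. c s * (q z * exp (\<i> * of_real (s * (l \<bullet> z)))) \<partial>lborel)"
        by (simp only: q_def mult_ac)
    qed simp
    also have "\<dots> = (\<integral>s. (\<integral>z. c s * (q z * exp (\<i> * of_real (s * (l \<bullet> z)))) \<partial>lborel) \<partial>lborel)"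
      by (rule lborel_pair.Fubini_integral[OF int])
    finally show ?thesis
      unfolding form q_def by simp
  qed
  have hsM: "((\<lambda>e. weyl_form X \<rho> (M s e) (M s e)) has_sum \<tau>) B" if B: "orthonormal_basis B" for s B
    using hs[OF orthonormal_basis_weyl(1)[OF B]] has_sum_reindex[OF orthonormal_basis_weyl(2)[OF B], where g = "\<lambda>e. weyl_form X \<rho> e e" and x = \<tau>]
    by (simp add: M_def o_def)
  have boundM: "(\<Sum>e\<in>F. cmod (weyl_form X \<rho> (M s e) (M s e))) \<le> C"
    if B: "orthonormal_basis B" and F: "finite F" "F \<subseteq> B" for s B F
  proof -
    have "(\<Sum>e\<in>F. cmod (weyl_form X \<rho> (M s e) (M s e))) = (\<Sum>e\<in>M s ` F. cmod (weyl_form X \<rho> e e))"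
      unfolding M_def using inj_on_subset[OF orthonormal_basis_weyl(2)[OF B] F(2)] by (subst sum.reindex) auto
    also have "\<dots> \<le> C"
      using F by (intro C[OF orthonormal_basis_weyl(1)[OF B]]) (auto simp: M_def)
    finally show ?thesis .
  qed
  have contM: "continuous_on UNIV (\<lambda>s. weyl_form X \<rho> (M s e) (M s e))" for e
    unfolding form by (rule continuous_on_fourier_integral[OF integrable_weyl_form[OF \<rho>]]) measurable
  have "integrable lborel (\<lambda>z. \<rho> z * exp (- \<alpha> * of_real (l \<bullet> z) ^ 2))"
    by (rule Bochner_Integration.integrable_bound[OF \<rho>])
      (use \<alpha> in \<open>auto simp: norm_mult intro!: mult_left_le simp flip: of_real_power\<close>)
  moreover have "(\<Sum>e\<in>F. cmod (weyl_form X (\<lambda>z. \<rho> z * exp (- \<alpha> * of_real (l \<bullet> z) ^ 2)) e e)) \<le> C * (\<integral>s. cmod (c s) \<partial>lborel)"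
    if "orthonormal_basis B" "finite F" "F \<subseteq> B" for B F
    unfolding form'
    by (rule has_sum_lebesgue_integral(1)[OF c hsM[OF that(1)] boundM[OF that(1)] contM that(2,3)])
  moreover have "((\<lambda>e. weyl_form X (\<lambda>z. \<rho> z * exp (- \<alpha> * of_real (l \<bullet> z) ^ 2)) e e) has_sum \<tau>) B"
    if "orthonormal_basis B" for B
    using has_sum_lebesgue_integral(2)[OF c hsM[OF that] boundM[OF that] contM] unfolding form' c1 by simp
  ultimately show ?thesis
    unfolding has_weyl_trace_def by blast
qed

section \<open>Gaussian symbols\<close>

lemma lborel_integral_prod_Basis:
  fixes f :: "'a::euclidean_space \<Rightarrow> real \<Rightarrow> complex"
  assumes f: "\<And>b. b \<in> Basis \<Longrightarrow> integrable lborel (f b)"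
  shows "integrable lborel (\<lambda>x. \<Prod>b\<in>Basis. f b (x \<bullet> b))"
    and "(\<integral>x. (\<Prod>b\<in>Basis. f b (x \<bullet> b)) \<partial>lborel) = (\<Prod>b\<in>Basis. \<integral>s. f b s \<partial>lborel)"
proof -
  interpret product_sigma_finite "\<lambda>_::'a. lborel :: real measure" by standard
  let ?P = "Pi\<^sub>M (Basis :: 'a set) (\<lambda>_. lborel :: real measure)"
  let ?T = "\<lambda>x. \<Sum>b\<in>(Basis :: 'a set). x b *\<^sub>R b"
  have [measurable]: "f b \<in> borel_measurable borel" if "b \<in> Basis" for b
    using borel_measurable_integrable[OF f[OF that]] by simp
  have T [measurable]: "?T \<in> ?P \<rightarrow>\<^sub>M borel" by measurable
  have m: "(\<lambda>x. \<Prod>b\<in>Basis. f b (x \<bullet> b)) \<in> borel_measurable borel" by measurable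
  have eq: "(\<Prod>b\<in>Basis. f b (?T x \<bullet> b)) = (\<Prod>b\<in>Basis. f b (x b))" for x
    by (intro prod.cong) (auto simp: inner_sum_left_Basis)
  have "integrable (distr ?P borel ?T) (\<lambda>x. \<Prod>b\<in>Basis. f b (x \<bullet> b))"
    unfolding integrable_distr_eq[OF T m] eq by (rule product_integrable_prod) (auto intro: f)
  then show "integrable lborel (\<lambda>x. \<Prod>b\<in>Basis. f b (x \<bullet> b))"
    by (simp only: lborel_eq[symmetric])
  have "(\<integral>x. (\<Prod>b\<in>Basis. f b (x \<bullet> b)) \<partial>distr ?P borel ?T) = (\<Prod>b\<in>Basis. \<integral>s. f b s \<partial>lborel)"
    unfolding integral_distr[OF T m] eq by (rule product_integral_prod) (auto intro: f)
  then show "(\<integral>x. (\<Prod>b\<in>Basis. f b (x \<bullet> b)) \<partial>lborel) = (\<Prod>b\<in>Basis. \<integral>s. f b s \<partial>lborel)"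
    by (simp only: lborel_eq[symmetric])
qed

text \<open>Equal to pi / \<kappa> raised to half the dimension, the dimension being supplied by the
  type argument. It is kept as a product because its nonvanishing then follows factor by
  factor.\<close>

definition gaussian_mass :: "'a::euclidean_space itself \<Rightarrow> real \<Rightarrow> complex" where
  "gaussian_mass _ \<kappa> = (\<Prod>b\<in>(Basis :: 'a set). \<integral>s. cgauss (of_real \<kappa>) 0 s \<partial>lborel)"

lemma gaussian_mass_nonzero: "\<kappa> > 0 \<Longrightarrow> gaussian_mass TYPE('a::euclidean_space) \<kappa> \<noteq> 0"
  by (simp add: gaussian_mass_def cgauss_integral_nonzero)

lemma gaussian_fourier_euclidean:
  fixes y :: "'a::euclidean_space"
  assumes \<kappa>: "\<kappa> > 0"
  shows "integrable lborel (\<lambda>k::'a. exp (- of_real (\<kappa> * (k \<bullet> k)) + \<i> * of_real (k \<bullet> y)))"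
    and "(\<integral>k. exp (- of_real (\<kappa> * (k \<bullet> k)) + \<i> * of_real (k \<bullet> y)) \<partial>lborel)
      = gaussian_mass TYPE('a) \<kappa> * exp (- of_real ((y \<bullet> y) / (4 * \<kappa>)))"
proof -
  have eq: "exp (- of_real (\<kappa> * (k \<bullet> k)) + \<i> * of_real (k \<bullet> y))
      = (\<Prod>b\<in>Basis. cgauss (of_real \<kappa>) (y \<bullet> b) (k \<bullet> b))" for k :: 'a
    unfolding cgauss_def euclidean_inner[of k k] euclidean_inner[of k y]
    by (simp add: exp_sum[symmetric] sum.distrib sum_distrib_left sum_negf sum_subtractf power2_eq_square mult_ac)
  have i: "integrable lborel (cgauss (of_real \<kappa>) x)" for x
    using integrable_cgauss[of "of_real \<kappa>" 0 x] \<kappa> by simp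
  show "integrable lborel (\<lambda>k::'a. exp (- of_real (\<kappa> * (k \<bullet> k)) + \<i> * of_real (k \<bullet> y)))"
    unfolding eq by (rule lborel_integral_prod_Basis(1)) (rule i)
  have "(\<integral>k. exp (- of_real (\<kappa> * ((k::'a) \<bullet> k)) + \<i> * of_real (k \<bullet> y)) \<partial>lborel)
      = (\<Prod>b\<in>Basis. (\<integral>s. cgauss (of_real \<kappa>) 0 s \<partial>lborel) * exp (- (of_real (y \<bullet> b) ^ 2) / (4 * of_real \<kappa>)))"
    unfolding eq lborel_integral_prod_Basis(2)[OF i]
    by (intro prod.cong refl cgauss_fourier) (use \<kappa> in simp)
  also have "\<dots> = gaussian_mass TYPE('a) \<kappa> * (\<Prod>b\<in>Basis. exp (- (of_real (y \<bullet> b) ^ 2) / (4 * of_real \<kappa>)))"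
    by (simp only: prod.distrib gaussian_mass_def)
  also have "(\<Prod>b\<in>Basis. exp (- (complex_of_real (y \<bullet> b) ^ 2) / (4 * of_real \<kappa>))) = exp (- of_real ((y \<bullet> y) / (4 * \<kappa>)))"
    unfolding euclidean_inner[of y y] exp_sum[OF finite_Basis, symmetric]
    by (simp add: sum_divide_distrib sum_negf power2_eq_square)
  finally show "(\<integral>k. exp (- of_real (\<kappa> * (k \<bullet> k)) + \<i> * of_real (k \<bullet> y)) \<partial>lborel)
      = gaussian_mass TYPE('a) \<kappa> * exp (- of_real ((y \<bullet> y) / (4 * \<kappa>)))" .
qed

section \<open>Gaussian vectors and the symbol of their rank one operators\<close>

definition gauss_fun :: "real \<Rightarrow> 'a::euclidean_space \<Rightarrow> complex" where
  "gauss_fun a x = exp (- of_real (a / 2 * (x \<bullet> x)))"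

definition gauss_l2 :: "real \<Rightarrow> 'a::euclidean_space l2" where
  "gauss_l2 a = abs_l2 (gauss_fun a)"

lemma borel_measurable_gauss_fun [measurable]: "gauss_fun a \<in> borel_measurable borel"
  unfolding gauss_fun_def by (intro borel_measurable_continuous_onI continuous_intros)

lemma cnj_gauss_fun [simp]: "cnj (gauss_fun a x) = gauss_fun a x"
  by (simp add: gauss_fun_def exp_cnj)

lemma square_integrable_gauss:
  assumes "a > 0"
  shows "square_integrable (gauss_fun a :: 'a::euclidean_space \<Rightarrow> complex)"
proof -
  have "(cmod (gauss_fun a x))\<^sup>2 = cmod (exp (- of_real (a * (x \<bullet> x)) + \<i> * of_real (x \<bullet> 0)))" for x :: 'a
    by (simp add: gauss_fun_def power2_eq_square flip: exp_add)
  then show ?thesis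
    unfolding square_integrable_def using integrable_norm[OF gaussian_fourier_euclidean(1)[OF assms, of "0::'a"]] by simp
qed

lemma cinner_gauss_nonzero:
  assumes "a > 0" "b > 0"
  shows "cinner (gauss_l2 a :: 'a::euclidean_space l2) (gauss_l2 b) \<noteq> 0"
proof -
  have "cinner (gauss_l2 a :: 'a l2) (gauss_l2 b) = (\<integral>x. gauss_fun a (x::'a) * gauss_fun b x \<partial>lborel)"
    unfolding gauss_l2_def using assms by (simp add: cinner.abs_eq l2_rel_refl square_integrable_gauss)
  also have "\<dots> = (\<integral>x. exp (- of_real ((a + b) / 2 * ((x::'a) \<bullet> x)) + \<i> * of_real (x \<bullet> 0)) \<partial>lborel)"
    by (intro Bochner_Integration.integral_cong refl, unfold gauss_fun_def mult_exp_exp, intro arg_cong[where f = exp])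
      (simp add: field_simps)
  also have "\<dots> \<noteq> 0"
    using assms by (subst gaussian_fourier_euclidean(2)) (auto simp: gaussian_mass_nonzero)
  finally show ?thesis .
qed

lemma integrable_product_l2:
  assumes "square_integrable F" "square_integrable G"
  shows "integrable lborel (\<lambda>x. F x * G x)"
proof -
  have "square_integrable (\<lambda>x. cnj (F x))"
    using assms(1) by (auto simp: square_integrable_def)
  from integrable_cinner[OF this assms(2)] show ?thesis by simp
qed

text \<open>Weyl symbol, up to a constant, of the rank one operator built from the Gaussians with
  parameters \<open>a\<close> and \<open>1 / a\<close>. Its decay rate \<open>gauss_decay a\<close> tends to zero with \<open>a\<close>.\<close>

definition gauss_decay :: "real \<Rightarrow> real" where "gauss_decay a = 1 / (2 * (a + 1 / a))"
definition gauss_phase :: "real \<Rightarrow> real" where "gauss_phase a = (1 / a) / (a + 1 / a)"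
definition gauss_symbol :: "real \<Rightarrow> real^('n::finite + 'n) \<Rightarrow> complex" where
  "gauss_symbol a z = exp (- of_real (gauss_decay a * (z \<bullet> z)) - \<i> * of_real (gauss_phase a * (mom z \<bullet> pos z)))"

lemma gauss_decay_pos: "a > 0 \<Longrightarrow> gauss_decay a > 0"
  using add_pos_pos[of a "1 / a"] by (simp add: gauss_decay_def)

text \<open>Completing the square in \<open>x\<close>: the centre is
  \<open>gauss_phase a *\<^sub>R h\<close>, and the remainder decays in \<open>h\<close> at rate a b
  / (2 (a + b)). Since a b = 1 this equals the rate 1 / (2 (a + b)) of the transform variable
  \<open>k\<close>, so one isotropic rate describes the symbol.\<close>

lemma gauss_symbol_exponent:
  fixes x h :: "'a::euclidean_space"
  assumes a: "a > 0"
  defines "b \<equiv> 1 / a"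
  shows "gauss_decay a * (h \<bullet> h) + ((x - gauss_phase a *\<^sub>R h) \<bullet> (x - gauss_phase a *\<^sub>R h)) / (4 * gauss_decay a)
    = a / 2 * (x \<bullet> x) + b / 2 * ((x - h) \<bullet> (x - h))"
proof -
  define s where "s = a + b"
  have s: "s > 0" "s \<noteq> 0" using a add_pos_pos[of a "1 / a"] by (auto simp: s_def b_def)
  have ab: "a * b = 1" using a by (simp add: b_def)
  have d: "gauss_decay a = 1 / (2 * s)" "gauss_phase a = b / s"
    by (simp_all add: gauss_decay_def gauss_phase_def s_def b_def)
  have bs: "1 + b\<^sup>2 = b * s" using ab by (simp add: s_def power2_eq_square algebra_simps)
  have "1 / (2 * s) + b\<^sup>2 / (2 * s) = b / 2"
    unfolding add_divide_distrib[symmetric] bs using s by simp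
  then have hh: "1 / (2 * s) * H + b\<^sup>2 / (2 * s) * H = b / 2 * H" for H
    by (metis distrib_right)
  have "gauss_decay a * (h \<bullet> h) + ((x - gauss_phase a *\<^sub>R h) \<bullet> (x - gauss_phase a *\<^sub>R h)) / (4 * gauss_decay a)
      = s / 2 * (x \<bullet> x) - b * (x \<bullet> h) + (1 / (2 * s) * (h \<bullet> h) + b\<^sup>2 / (2 * s) * (h \<bullet> h))"
    unfolding d using s by (simp add: inner_diff_left inner_diff_right inner_commute field_simps power2_eq_square)
  also have "\<dots> = a / 2 * (x \<bullet> x) + b / 2 * ((x - h) \<bullet> (x - h))"
    unfolding hh unfolding s_def by (simp add: inner_diff_left inner_diff_right inner_commute field_simps)
  finally show ?thesis .
qed

lemma borel_measurable_gauss_symbol [measurable]: "gauss_symbol a \<in> borel_measurable borel"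
  unfolding gauss_symbol_def[abs_def] by measurable

lemma integrable_gauss_symbol:
  assumes a: "a > 0"
  shows "integrable lborel (gauss_symbol a :: real^('n::finite + 'n) \<Rightarrow> complex)"
  by (rule Bochner_Integration.integrable_bound[OF gaussian_fourier_euclidean(1)[OF gauss_decay_pos[OF a], of 0]])
    (auto simp: gauss_symbol_def)

text \<open>Integrating over \<open>k\<close> first is a Gaussian Fourier transform. By
  \<open>gauss_symbol_exponent\<close> its value is a function of \<open>x\<close> times a function
  of \<open>x - h\<close>, and integrating over \<open>h\<close> then separates the two inner
  products.\<close>

lemma gauss_symbol_rank_one:
  fixes f g :: "(real^'n::finite) l2"
  assumes a: "a > 0"
  shows "(\<integral>z. gauss_symbol a z * cinner f (weyl_vec z g) \<partial>lborel)
    = gaussian_mass TYPE(real^'n) (gauss_decay a) * (cinner f (gauss_l2 a) * cinner (gauss_l2 (1 / a)) g)"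
proof -
  define b where "b = 1 / a"
  have b: "b > 0" using a by (simp add: b_def)
  define \<kappa> where "\<kappa> = gauss_decay a"
  define \<beta> where "\<beta> = gauss_phase a"
  define K where "K = gaussian_mass TYPE(real^'n) \<kappa>"
  have \<kappa>: "\<kappa> > 0" unfolding \<kappa>_def by (rule gauss_decay_pos[OF a])
  obtain F G where F: "square_integrable F" "f = abs_l2 F" and G: "square_integrable G" "g = abs_l2 G"
    by (metis l2_cases)
  have [measurable]: "F \<in> borel_measurable borel" "G \<in> borel_measurable borel"
    using F(1) G(1) by (auto simp: square_integrable_def)
  define q where "q k h = exp (- of_real (\<kappa> * (k \<bullet> k)) - of_real (\<kappa> * (h \<bullet> h)) - \<i> * of_real (\<beta> * (k \<bullet> h)))" for k h :: "real^'n"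
  have q_stack: "gauss_symbol a (stack k h) = q k h" for k h :: "real^'n"
    unfolding gauss_symbol_def q_def \<kappa>_def \<beta>_def
    by (intro arg_cong[where f = exp]) (simp add: inner_mom_pos algebra_simps)
  have coef: "cinner f (weyl k h g) = (\<integral>x. cnj (F x) * (exp (\<i> * of_real (k \<bullet> x)) * G (x - h)) \<partial>lborel)" for k h
    using F G by (simp add: weyl_abs_l2 cinner.abs_eq l2_rel_refl square_integrable_weyl)
  have FG: "integrable lborel (\<lambda>x. cnj (F x) * G (x - h))" for h
    by (rule integrable_cinner[OF F(1) square_integrable_translate[OF G(1)]])
  have inner_k: "(\<integral>k. q k h * cinner f (weyl k h g) \<partial>lborel)
      = K * (\<integral>x. (cnj (F x) * gauss_fun a x) * (gauss_fun b (x - h) * G (x - h)) \<partial>lborel)" for h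
  proof -
    have qi: "integrable lborel (\<lambda>k. q k h)"
      by (rule Bochner_Integration.integrable_bound[OF gaussian_fourier_euclidean(1)[OF \<kappa>, of 0]])
        (use \<kappa> in \<open>auto simp: q_def\<close>)
    have int: "integrable (lborel \<Otimes>\<^sub>M lborel) (\<lambda>(x, k). q k h * (cnj (F x) * (exp (\<i> * of_real (k \<bullet> x)) * G (x - h))))"
      by (rule Bochner_Integration.integrable_bound[OF integrable_lborel_product[OF FG[of h] qi]])
        (auto simp: norm_mult split_beta q_def)
    have "(\<integral>k. q k h * cinner f (weyl k h g) \<partial>lborel)
        = (\<integral>k. (\<integral>x. q k h * (cnj (F x) * (exp (\<i> * of_real (k \<bullet> x)) * G (x - h))) \<partial>lborel) \<partial>lborel)"
      unfolding coef by simp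
    also have "\<dots> = (\<integral>x. (\<integral>k. q k h * (cnj (F x) * (exp (\<i> * of_real (k \<bullet> x)) * G (x - h))) \<partial>lborel) \<partial>lborel)"
      by (rule lborel_pair.Fubini_integral[OF int])
    also have "\<dots> = (\<integral>x. K * ((cnj (F x) * gauss_fun a x) * (gauss_fun b (x - h) * G (x - h))) \<partial>lborel)"
    proof (rule Bochner_Integration.integral_cong)
      fix x
      have e: "q k h * (cnj (F x) * (exp (\<i> * of_real (k \<bullet> x)) * G (x - h)))
          = (cnj (F x) * G (x - h) * exp (- of_real (\<kappa> * (h \<bullet> h))))
            * exp (- of_real (\<kappa> * (k \<bullet> k)) + \<i> * of_real (k \<bullet> (x - \<beta> *\<^sub>R h)))" for k
      proof -
        have qe: "q k h * exp (\<i> * of_real (k \<bullet> x)) = exp (- of_real (\<kappa> * (h \<bullet> h)))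
            * exp (- of_real (\<kappa> * (k \<bullet> k)) + \<i> * of_real (k \<bullet> (x - \<beta> *\<^sub>R h)))"
          unfolding q_def by (simp add: mult_exp_exp inner_diff_right algebra_simps)
        have "q k h * (cnj (F x) * (exp (\<i> * of_real (k \<bullet> x)) * G (x - h)))
            = (q k h * exp (\<i> * of_real (k \<bullet> x))) * (cnj (F x) * G (x - h))"
          by (simp only: mult_ac)
        then show ?thesis unfolding qe by (simp only: mult_ac)
      qed
      have "exp (- of_real (\<kappa> * (h \<bullet> h))) * exp (- of_real (((x - \<beta> *\<^sub>R h) \<bullet> (x - \<beta> *\<^sub>R h)) / (4 * \<kappa>)))
          = exp (- complex_of_real (\<kappa> * (h \<bullet> h) + ((x - \<beta> *\<^sub>R h) \<bullet> (x - \<beta> *\<^sub>R h)) / (4 * \<kappa>)))"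
        by (simp add: mult_exp_exp)
      also have "\<dots> = exp (- complex_of_real (a / 2 * (x \<bullet> x) + b / 2 * ((x - h) \<bullet> (x - h))))"
        unfolding \<kappa>_def \<beta>_def b_def by (simp only: gauss_symbol_exponent[OF a])
      also have "\<dots> = gauss_fun a x * gauss_fun b (x - h)"
        by (simp add: gauss_fun_def mult_exp_exp)
      finally have ge: "exp (- of_real (\<kappa> * (h \<bullet> h))) * exp (- of_real (((x - \<beta> *\<^sub>R h) \<bullet> (x - \<beta> *\<^sub>R h)) / (4 * \<kappa>)))
          = gauss_fun a x * gauss_fun b (x - h)" .
      show "(\<integral>k. q k h * (cnj (F x) * (exp (\<i> * of_real (k \<bullet> x)) * G (x - h))) \<partial>lborel)
          = K * ((cnj (F x) * gauss_fun a x) * (gauss_fun b (x - h) * G (x - h)))"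
      proof -
        have "(cnj (F x) * G (x - h) * H) * (K * E) = K * (cnj (F x) * G (x - h)) * (H * E)" for H E
          by (simp only: mult_ac)
        then show ?thesis
          unfolding e integral_mult_right_zero gaussian_fourier_euclidean(2)[OF \<kappa>] K_def[symmetric]
          by (simp only: ge) (simp only: mult_ac)
      qed
    qed simp
    finally show ?thesis by simp
  qed
  have Fa: "integrable lborel (\<lambda>x. cnj (F x) * gauss_fun a x)"
    by (rule integrable_cinner[OF F(1) square_integrable_gauss[OF a]])
  have Gb: "integrable lborel (\<lambda>x. gauss_fun b x * G x)"
    by (rule integrable_product_l2[OF square_integrable_gauss[OF b] G(1)])
  \<comment> \<open>Reflection through \<open>x\<close> preserves Lebesgue measure, so the factor in
    \<open>x - h\<close> integrates to a constant independent of \<open>x\<close>.\<close>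
  have refl: "(\<integral>h. r (x - h) \<partial>lborel) = (\<integral>y. r y \<partial>lborel)" "integrable lborel (\<lambda>h. r (x - h)) \<longleftrightarrow> integrable lborel r"
    if [measurable]: "r \<in> borel_measurable borel"
    for r :: "real^'n \<Rightarrow> 'z::{banach, second_countable_topology}" and x
  proof -
    have d: "distr lborel borel (\<lambda>h. x - h) = (lborel :: (real^'n) measure)"
      using lborel_affine[of "-1" x] by (simp add: density_1)
    show "(\<integral>h. r (x - h) \<partial>lborel) = (\<integral>y. r y \<partial>lborel)"
      by (subst (2) d[symmetric, of]) (simp add: integral_distr)
    show "integrable lborel (\<lambda>h. r (x - h)) \<longleftrightarrow> integrable lborel r"
      by (subst (2) d[symmetric, of]) (simp add: integrable_distr_eq)
  qed
  have int2: "integrable (lborel \<Otimes>\<^sub>M lborel)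
      (\<lambda>p. (cnj (F (fst p)) * gauss_fun a (fst p)) * (gauss_fun b (fst p - snd p) * G (fst p - snd p)))"
  proof (rule lborel_pair.Fubini_integrable)
    show "integrable lborel (\<lambda>x. \<integral>h. norm ((cnj (F (fst (x, h))) * gauss_fun a (fst (x, h))) * (gauss_fun b (fst (x, h) - snd (x, h)) * G (fst (x, h) - snd (x, h)))) \<partial>lborel)"
      using integrable_norm[OF Fa] refl(1)[of "\<lambda>y. norm (gauss_fun b y * G y)"]
      by (simp add: norm_mult)
    show "AE x in lborel. integrable lborel (\<lambda>h. (cnj (F (fst (x, h))) * gauss_fun a (fst (x, h))) * (gauss_fun b (fst (x, h) - snd (x, h)) * G (fst (x, h) - snd (x, h))))"
      using refl(2)[of "\<lambda>y. gauss_fun b y * G y"] Gb by simp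
  qed measurable
  then have int2': "integrable (lborel \<Otimes>\<^sub>M lborel)
      (\<lambda>(x, h). (cnj (F x) * gauss_fun a x) * (gauss_fun b (x - h) * G (x - h)))"
    by (simp add: case_prod_beta')
  have "(\<integral>z. gauss_symbol a z * cinner f (weyl_vec z g) \<partial>lborel)
      = (\<integral>p. gauss_symbol a (stack (fst p) (snd p)) * cinner f (weyl_vec (stack (fst p) (snd p)) g) \<partial>lborel)"
    by (rule lborel_integral_stack(2)[symmetric]) measurable
  also have "\<dots> = (\<integral>p. q (fst p) (snd p) * cinner f (weyl (fst p) (snd p) g) \<partial>(lborel \<Otimes>\<^sub>M lborel))"
    by (simp add: q_stack weyl_vec_stack lborel_prod)
  also have "\<dots> = (\<integral>h. (\<integral>k. q k h * cinner f (weyl k h g) \<partial>lborel) \<partial>lborel)"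
  proof (rule lborel_pair.integral_snd[symmetric, where f = "\<lambda>k h. q k h * cinner f (weyl k h g)", unfolded split_beta])
    have "integrable lborel (\<lambda>z. gauss_symbol a z * cinner f (weyl_vec z g))"
      using integrable_weyl_form[OF integrable_gauss_symbol[OF a], of f "mat 1" g] by simp
    then have "integrable lborel (\<lambda>p. gauss_symbol a (stack (fst p) (snd p)) * cinner f (weyl_vec (stack (fst p) (snd p)) g))"
      by (subst lborel_integral_stack(1)) measurable
    then show "integrable (lborel \<Otimes>\<^sub>M lborel) (\<lambda>p. q (fst p) (snd p) * cinner f (weyl (fst p) (snd p) g))"
      by (simp add: q_stack weyl_vec_stack lborel_prod)
  qed
  also have "\<dots> = K * (\<integral>h. (\<integral>x. (cnj (F x) * gauss_fun a x) * (gauss_fun b (x - h) * G (x - h)) \<partial>lborel) \<partial>lborel)"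
    unfolding inner_k by simp
  also have "\<dots> = K * (\<integral>x. (\<integral>h. (cnj (F x) * gauss_fun a x) * (gauss_fun b (x - h) * G (x - h)) \<partial>lborel) \<partial>lborel)"
    by (simp only: lborel_pair.Fubini_integral[OF int2'])
  also have "\<dots> = K * ((\<integral>x. cnj (F x) * gauss_fun a x \<partial>lborel) * (\<integral>y. gauss_fun b y * G y \<partial>lborel))"
    using refl(1)[of "\<lambda>y. gauss_fun b y * G y"] by simp
  also have "\<dots> = K * (cinner f (gauss_l2 a) * cinner (gauss_l2 b) g)"
    using F G a b by (simp add: gauss_l2_def cinner.abs_eq l2_rel_refl square_integrable_gauss)
  finally show ?thesis by (simp add: K_def \<kappa>_def b_def)
qed

text \<open>The substitution by \<open>X\<close> leaves the form of a rank one operator divided by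
  the absolute determinant. Bessel bounds its diagonal sums uniformly over all bases and Parseval
  evaluates them.\<close>

lemma has_weyl_trace_gauss_symbol:
  fixes X :: "real^('n::finite + 'n)^('n + 'n)"
  assumes X: "invertible X" and a: "a > 0"
  shows "has_weyl_trace X (\<lambda>z. gauss_symbol a (X *v z))
    (gaussian_mass TYPE(real^'n) (gauss_decay a) * cinner (gauss_l2 (1 / a) :: (real^'n) l2) (gauss_l2 a) / of_real \<bar>det X\<bar>)"
proof -
  have det: "det X \<noteq> 0" using X by (simp add: invertible_det_nz)
  define m where "m = gaussian_mass TYPE(real^'n) (gauss_decay a) / of_real \<bar>det X\<bar>"
  let ?A = "gauss_l2 a :: (real^'n) l2" and ?B = "gauss_l2 (1 / a) :: (real^'n) l2"
  have form: "weyl_form X (\<lambda>z. gauss_symbol a (X *v z)) f g = m * (cinner ?B g * cinner f ?A)" for f g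
    unfolding weyl_form_def
    by (subst lborel_integral_matrix_vector_mult(2)[OF det, where F = "\<lambda>z. gauss_symbol a z * cinner f (weyl_vec z g)"])
      (simp_all add: gauss_symbol_rank_one[OF a] m_def scaleR_conv_of_real field_simps)
  have "integrable lborel (\<lambda>z. gauss_symbol a (X *v z))"
    by (subst lborel_integral_matrix_vector_mult(1)[OF det]) (simp_all add: integrable_gauss_symbol[OF a])
  moreover have "(\<Sum>e\<in>F. cmod (weyl_form X (\<lambda>z. gauss_symbol a (X *v z)) e e)) \<le> cmod m * ((norm ?B)\<^sup>2 + (norm ?A)\<^sup>2)"
    if "orthonormal_basis B" "finite F" "F \<subseteq> B" for B F
    unfolding form norm_mult[of m] sum_distrib_left[symmetric]
    by (intro mult_left_mono bessel_product) (use that in \<open>auto simp: orthonormal_basis_iff\<close>)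
  moreover have "((\<lambda>e. weyl_form X (\<lambda>z. gauss_symbol a (X *v z)) e e) has_sum m * cinner ?B ?A) B"
    if "orthonormal_basis B" for B
    unfolding form by (rule has_sum_cmult_right[OF parseval[OF that]])
  ultimately show ?thesis
    unfolding has_weyl_trace_def m_def by (auto simp: mult.commute)
qed

section \<open>Gaussian channels\<close>

lemma has_weyl_trace_gaussian_factors:
  fixes X :: "real^('n::finite + 'n)^('n + 'n)"
  assumes tr: "has_weyl_trace X \<rho> \<tau>" and X: "invertible X"
    and S: "finite S" and \<alpha>: "\<And>p. p \<in> S \<Longrightarrow> Re (\<alpha> p) > 0"
  shows "has_weyl_trace X (\<lambda>z. \<rho> z * (\<Prod>p\<in>S. exp (- \<alpha> p * of_real (l p \<bullet> z) ^ 2))) \<tau>"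
  using S \<alpha>
proof (induction S)
  case (insert p S)
  then have "has_weyl_trace X (\<lambda>z. \<rho> z * (\<Prod>p\<in>S. exp (- \<alpha> p * of_real (l p \<bullet> z) ^ 2)) * exp (- \<alpha> p * of_real (l p \<bullet> z) ^ 2)) \<tau>"
    by (intro has_weyl_trace_gaussian_factor X) auto
  then show ?case using insert by (simp add: mult_ac)
qed (use tr in simp)

text \<open>Polarisation writes each product of coordinates as a quarter of a difference of squares.
  The definite part is spread evenly over all pairs: the squares of the sum and the difference of
  two coordinates add up to twice the sum of their squares, and over all pairs this totals 4
  CARD('m) times \<open>z \<bullet> z\<close>, whence the denominator in \<open>c\<close>.\<close>

lemma quadratic_form_squares:
  fixes z :: "real^'m" and R I :: "real^'m^'m" and \<mu> :: real
  defines "q \<equiv> \<lambda>i j. complex_of_real (R $ i $ j) + \<i> * of_real (I $ i $ j)"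
    and "c \<equiv> complex_of_real (\<mu> / (4 * real CARD('m)))"
  shows "of_real (\<mu> * (z \<bullet> z) + z \<bullet> (R *v z)) + \<i> * of_real (z \<bullet> (I *v z))
    = (\<Sum>(i, j)\<in>UNIV. (c + q i j / 4) * of_real ((axis i 1 + axis j 1) \<bullet> z) ^ 2)
      + (\<Sum>(i, j)\<in>UNIV. (c - q i j / 4) * of_real ((axis i 1 - axis j 1) \<bullet> z) ^ 2)"
proof -
  have "(\<Sum>(i, j)\<in>UNIV. (c + q i j / 4) * of_real ((axis i 1 + axis j 1) \<bullet> z) ^ 2)
      + (\<Sum>(i, j)\<in>UNIV. (c - q i j / 4) * of_real ((axis i 1 - axis j 1) \<bullet> z) ^ 2)
      = (\<Sum>(i, j)\<in>UNIV. 2 * c * of_real (z $ i ^ 2) + (2 * c * of_real (z $ j ^ 2) + q i j * of_real (z $ i * z $ j)))"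
    unfolding sum.distrib[symmetric]
    by (intro sum.cong) (auto simp: inner_add_left inner_diff_left inner_axis' power2_eq_square field_simps)
  also have "\<dots> = (\<Sum>i\<in>(UNIV :: 'm set). \<Sum>j\<in>(UNIV :: 'm set). 2 * c * of_real (z $ i ^ 2))
      + ((\<Sum>i\<in>(UNIV :: 'm set). \<Sum>j\<in>(UNIV :: 'm set). 2 * c * of_real (z $ j ^ 2)) + (\<Sum>i\<in>(UNIV :: 'm set). \<Sum>j\<in>(UNIV :: 'm set). q i j * of_real (z $ i * z $ j)))"
    unfolding UNIV_Times_UNIV[symmetric] sum.cartesian_product[symmetric] sum.distrib by (rule refl)
  also have "(\<Sum>i\<in>(UNIV :: 'm set). \<Sum>j\<in>(UNIV :: 'm set). 2 * c * of_real (z $ i ^ 2)) = of_real (\<mu> / 2 * (z \<bullet> z))"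
    by (simp add: c_def inner_vec_def sum_distrib_left power2_eq_square field_simps)
  also have "(\<Sum>i\<in>(UNIV :: 'm set). \<Sum>j\<in>(UNIV :: 'm set). 2 * c * of_real (z $ j ^ 2)) = of_real (\<mu> / 2 * (z \<bullet> z))"
    by (simp add: c_def inner_vec_def sum_distrib_left power2_eq_square field_simps)
  also have "(\<Sum>i\<in>UNIV. \<Sum>j\<in>UNIV. q i j * of_real (z $ i * z $ j))
      = of_real (z \<bullet> (R *v z)) + \<i> * of_real (z \<bullet> (I *v z))"
    by (simp add: q_def inner_vec_def matrix_vector_mult_def sum_distrib_left sum.distrib algebra_simps)
  finally show ?thesis by simp
qed

text \<open>The bound on the entries of \<open>R\<close> is exactly positivity of the real parts of
  all coefficients of squares; \<open>I\<close> contributes to imaginary parts only.\<close>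

lemma has_weyl_trace_quadratic:
  fixes X R I :: "real^('n::finite + 'n)^('n + 'n)" and \<mu> :: real
  assumes tr: "has_weyl_trace X \<rho> \<tau>" and X: "invertible X"
    and R: "\<And>i j. \<bar>R $ i $ j\<bar> < \<mu> / real CARD('n + 'n)"
  shows "has_weyl_trace X (\<lambda>z. \<rho> z * exp (- (of_real (\<mu> * (z \<bullet> z) + z \<bullet> (R *v z)) + \<i> * of_real (z \<bullet> (I *v z))))) \<tau>"
proof -
  define q where "q i j = complex_of_real (R $ i $ j) + \<i> * of_real (I $ i $ j)" for i j
  define c where "c = complex_of_real (\<mu> / (4 * real CARD('n + 'n)))"
  have pos: "Re (c + q i j / 4) > 0" "Re (c - q i j / 4) > 0" for i j
    using R[of i j] by (auto simp: c_def q_def abs_less_iff field_simps)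
  have pe: "(\<Prod>p\<in>S. exp (- \<alpha> p * w p)) = exp (- (\<Sum>p\<in>S. \<alpha> p * w p))"
    if "finite S" for S :: "(('n + 'n) \<times> ('n + 'n)) set" and \<alpha> w :: "_ \<Rightarrow> complex"
    using that by (simp add: exp_sum[symmetric] sum_negf)
  have "has_weyl_trace X (\<lambda>z. \<rho> z
      * (\<Prod>p\<in>UNIV. exp (- (case p of (i, j) \<Rightarrow> c + q i j / 4) * of_real ((case p of (i, j) \<Rightarrow> axis i 1 + axis j 1) \<bullet> z) ^ 2))
      * (\<Prod>p\<in>UNIV. exp (- (case p of (i, j) \<Rightarrow> c - q i j / 4) * of_real ((case p of (i, j) \<Rightarrow> axis i 1 - axis j 1) \<bullet> z) ^ 2))) \<tau>"
    by (intro has_weyl_trace_gaussian_factors tr X) (use pos in auto)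
  moreover have "\<rho> z
      * (\<Prod>p\<in>UNIV. exp (- (case p of (i, j) \<Rightarrow> c + q i j / 4) * of_real ((case p of (i, j) \<Rightarrow> axis i 1 + axis j 1) \<bullet> z) ^ 2))
      * (\<Prod>p\<in>UNIV. exp (- (case p of (i, j) \<Rightarrow> c - q i j / 4) * of_real ((case p of (i, j) \<Rightarrow> axis i 1 - axis j 1) \<bullet> z) ^ 2))
      = \<rho> z * exp (- (of_real (\<mu> * (z \<bullet> z) + z \<bullet> (R *v z)) + \<i> * of_real (z \<bullet> (I *v z))))" for z
    unfolding quadratic_form_squares[of \<mu> z R I, folded q_def c_def] pe[OF finite]
    by (simp only: mult.assoc mult_exp_exp minus_add_distrib case_prod_beta')
  ultimately show ?thesis by (simp only:)
qed

lemma inner_congruence: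
  "z \<bullet> ((transpose X ** M ** X) *v z) = (X *v z) \<bullet> (M *v ((X :: real^'m^'m) *v z))"
  by (metis dot_lmul_matrix matrix_vector_mul_assoc transpose_matrix_vector vector_transpose_matrix)

text \<open>Expresses the phase of \<open>gauss_symbol\<close> by a matrix, so that it can be
  carried along \<open>X\<close> by congruence.\<close>

lemma mom_pos_quadratic_form:
  obtains P :: "real^('n::finite + 'n)^('n + 'n)" where "\<And>z. z \<bullet> (P *v z) = mom z \<bullet> pos z"
proof -
  define P :: "real^('n + 'n)^('n + 'n)" where
    "P = (\<chi> i j. case (i, j) of (Inl a, Inr b) \<Rightarrow> if a = b then 1 else 0 | _ \<Rightarrow> 0)"
  have "mom (P *v z) = pos z" "pos (P *v z) = 0" for z
    unfolding mom_def pos_def matrix_vector_mult_def P_def UNIV_Plus_UNIV[symmetric]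
    by (subst sum.Plus, auto simp: vec_eq_iff if_distrib[where f = "\<lambda>u. u * _"] cong: if_cong)+
  then have "z \<bullet> (P *v z) = mom z \<bullet> pos z" for z
    by (simp add: inner_mom_pos[of z])
  then show ?thesis by (rule that)
qed

text \<open>The symbol of the image of \<open>|gauss_l2 1\<rangle>\<langle>gauss_l2 1|\<close> under the channel decays at a fixed
  Gaussian rate, so it absorbs \<open>gauss_symbol a (X *v z)\<close> as soon as \<open>a\<close> is small.\<close>

lemma has_weyl_trace_channel_symbol:
  fixes X Y :: "real^('n::finite + 'n)^('n + 'n)"
  assumes X: "invertible X"
  obtains \<epsilon> where "\<epsilon> > 0" "\<And>a. 0 < a \<Longrightarrow> a < \<epsilon> \<Longrightarrow>
    has_weyl_trace X (\<lambda>z. gauss_symbol 1 z * exp (\<i> / 2 * of_real (z \<bullet> (Y *v z))))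
      (gaussian_mass TYPE(real^'n) (gauss_decay a) * cinner (gauss_l2 (1 / a) :: (real^'n) l2) (gauss_l2 a) / of_real \<bar>det X\<bar>)"
proof -
  obtain P :: "real^('n + 'n)^('n + 'n)" where P: "\<And>z. z \<bullet> (P *v z) = mom z \<bullet> pos z"
    by (rule mom_pos_quadratic_form) blast
  define \<mu> where "\<mu> = gauss_decay 1"
  define N where "N = real CARD('n + 'n)"
  \<comment> \<open>The factor \<open>mat 1\<close> puts the Gram matrix of \<open>X\<close> into
    the shape of \<open>inner_congruence\<close>.\<close>
  define G where "G = transpose X ** mat 1 ** X"
  define m where "m = 1 + (\<Sum>i\<in>UNIV. \<Sum>j\<in>UNIV. \<bar>G $ i $ j\<bar>)"
  have m: "\<bar>G $ i $ j\<bar> < m" "m > 0" for i j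
  proof -
    have "\<bar>G $ i $ j\<bar> \<le> (\<Sum>j\<in>UNIV. \<bar>G $ i $ j\<bar>)" by (rule member_le_sum) auto
    also have "\<dots> \<le> (\<Sum>i\<in>UNIV. \<Sum>j\<in>UNIV. \<bar>G $ i $ j\<bar>)"
      by (rule member_le_sum[where f = "\<lambda>i. \<Sum>j\<in>UNIV. \<bar>G $ i $ j\<bar>"]) (auto intro: sum_nonneg)
    finally show "\<bar>G $ i $ j\<bar> < m" by (simp add: m_def)
    then show "m > 0" by linarith
  qed
  have N: "N > 0" by (simp add: N_def)
  have \<mu>: "\<mu> > 0" by (simp add: \<mu>_def gauss_decay_pos)
  show ?thesis
  \<comment> \<open>The decay rate at \<open>a\<close> is at most \<open>a\<close>, and
    \<open>m\<close> exceeds all entries of \<open>G\<close>; below this threshold the entries of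
    \<open>R\<close> stay under \<open>\<mu> / N\<close>, as \<open>has_weyl_trace_quadratic\<close>
    requires.\<close>
  proof (rule that[of "\<mu> / (N * m)"])
    show "\<mu> / (N * m) > 0" using \<mu> N m by simp
    fix a assume a: "0 < a" "a < \<mu> / (N * m)"
    have "gauss_decay a \<le> a"
    proof -
      have "a * (2 * (a + 1 / a)) = 2 * a * a + 2" "0 < 2 * (a + 1 / a)"
        using a(1) by (simp_all add: field_simps add_pos_pos)
      then show ?thesis
        unfolding gauss_decay_def using a(1) by (subst pos_divide_le_eq) auto
    qed
    then have dm: "gauss_decay a * m < \<mu> / N"
    proof -
      assume "gauss_decay a \<le> a"
      then have "gauss_decay a * m \<le> a * m" using m(2) by (intro mult_right_mono) auto
      also have "\<dots> < \<mu> / N"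
        using a(2) m(2) N by (simp add: pos_less_divide_eq mult.assoc mult.commute[of N])
      finally show ?thesis .
    qed
    \<comment> \<open>\<open>R\<close> compensates the decay of the slow symbol at
      \<open>X z\<close>. \<open>I\<close> collects the phases: that of the input symbol, the factor
      of the channel, and the phase of the slow symbol with opposite sign.\<close>
    define R where "R = (- gauss_decay a) *\<^sub>R G"
    define I where "I = gauss_phase 1 *\<^sub>R P - (1 / 2) *\<^sub>R Y - gauss_phase a *\<^sub>R (transpose X ** P ** X)"
    have R: "\<bar>R $ i $ j\<bar> < \<mu> / real CARD('n + 'n)" for i j
    proof -
      have "\<bar>R $ i $ j\<bar> = gauss_decay a * \<bar>G $ i $ j\<bar>"
        using gauss_decay_pos[OF a(1)] by (simp add: R_def abs_mult)
      also have "\<dots> \<le> gauss_decay a * m"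
        using m(1)[of i j] gauss_decay_pos[OF a(1)] by (intro mult_left_mono) auto
      also have "\<dots> < \<mu> / N" by (rule dm)
      finally show ?thesis unfolding N_def .
    qed
    have sc: "(r *\<^sub>R M) *v z = r *\<^sub>R (M *v z)" for r and M :: "real^('n + 'n)^('n + 'n)" and z
      by (simp add: vec_eq_iff matrix_vector_mult_def sum_distrib_left mult.assoc)
    have Rz: "z \<bullet> (R *v z) = - gauss_decay a * ((X *v z) \<bullet> (X *v z))" for z
      unfolding R_def sc inner_scaleR_right G_def inner_congruence by simp
    have Iz: "z \<bullet> (I *v z) = gauss_phase 1 * (mom z \<bullet> pos z) - (1 / 2) * (z \<bullet> (Y *v z))
        - gauss_phase a * (mom (X *v z) \<bullet> pos (X *v z))" for z
      unfolding I_def matrix_vector_mult_diff_rdistrib inner_diff_right sc inner_scaleR_right inner_congruence P ..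
    have "gauss_symbol a (X *v z) * exp (- (of_real (\<mu> * (z \<bullet> z) + z \<bullet> (R *v z)) + \<i> * of_real (z \<bullet> (I *v z))))
        = gauss_symbol 1 z * exp (\<i> / 2 * of_real (z \<bullet> (Y *v z)))" for z
      unfolding gauss_symbol_def mult_exp_exp Rz Iz \<mu>_def
      by (intro arg_cong[where f = exp]) (simp add: algebra_simps)
    then show "has_weyl_trace X (\<lambda>z. gauss_symbol 1 z * exp (\<i> / 2 * of_real (z \<bullet> (Y *v z))))
      (gaussian_mass TYPE(real^'n) (gauss_decay a) * cinner (gauss_l2 (1 / a) :: (real^'n) l2) (gauss_l2 a) / of_real \<bar>det X\<bar>)"
      using has_weyl_trace_quadratic[OF has_weyl_trace_gauss_symbol[OF X a(1)] X R, of I] by simp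
  qed
qed

section \<open>The test operator and its image under a channel\<close>

definition rank_one :: "'a::euclidean_space l2 \<Rightarrow> 'a l2 \<Rightarrow> 'a l2" where
  "rank_one g f = cinner g f *\<^sub>C g"

lemma scaleC_add_left: "(a + b) *\<^sub>C f = a *\<^sub>C f + b *\<^sub>C f"
proof -
  obtain F where F: "square_integrable F" "f = abs_l2 F" by (rule l2_cases)
  then show ?thesis
    by (simp add: scaleC.abs_eq plus_l2.abs_eq l2_rel_refl square_integrable_scale distrib_right)
qed

lemma bounded_op_rank_one: "bounded_op (rank_one (g :: (real^'n::finite) l2))"
  unfolding bounded_op_def
proof (intro conjI allI)
  show "bounded_linear (rank_one g)"
  proof (rule bounded_linear_intro[where K = "norm g * norm g"])
    show "norm (rank_one g f) \<le> norm f * (norm g * norm g)" for f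
      using mult_right_mono[OF cinner_Cauchy_Schwarz[of g f], of "norm g"]
      by (simp add: rank_one_def norm_scaleC mult_ac)
  qed (simp_all add: rank_one_def cinner_add_right scaleC_add_left scaleR_l2_def cinner_scaleC_right scaleC_scaleC)
  show "rank_one g (c *\<^sub>C f) = c *\<^sub>C rank_one g f" for c f
    by (simp add: rank_one_def cinner_scaleC_right scaleC_scaleC)
qed

lemma cinner_rank_one: "cinner f (rank_one g h) = cinner f g * cinner g h"
  by (simp add: rank_one_def cinner_scaleC_right mult.commute)

text \<open>Being positive, the operator is its own absolute value, and Parseval sums its
  diagonal.\<close>

lemma trace_class_rank_one: "trace_class (rank_one (g :: (real^'n::finite) l2))"
proof -
  have "cinner f (rank_one g f) \<in> \<real>\<^sub>\<ge>\<^sub>0" for f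
  proof -
    have "cinner f (rank_one g f) = of_real ((cmod (cinner f g))\<^sup>2)"
      unfolding cinner_rank_one complex_norm_square by (simp add: cinner_commute[of f g])
    then show ?thesis by (simp del: of_real_power)
  qed
  then have "is_abs_op (rank_one g) (rank_one g)"
    by (simp add: is_abs_op_def positive_op_def bounded_op_rank_one)
  moreover obtain B :: "(real^'n) l2 set" where B: "orthonormal_basis B"
    using orthonormal_basis_exists by blast
  moreover have "(\<lambda>e. cinner e (rank_one g e)) summable_on B"
    using has_sum_imp_summable[OF parseval[OF B, of g g]] by (simp add: cinner_rank_one mult.commute)
  ultimately show ?thesis
    unfolding trace_class_def using bounded_op_rank_one by blast
qed

text \<open>The basis selected by \<open>SOME\<close> is unknown, but \<open>has_weyl_trace\<close>
  speaks about all bases.\<close>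

lemma op_trace_eqI:
  fixes X :: "real^('n::finite + 'n)^('n + 'n)"
  assumes "has_weyl_trace X \<rho> \<tau>" "\<And>f g. cinner f (K g) = weyl_form X \<rho> f g"
  shows "op_trace K = \<tau>"
proof -
  have "orthonormal_basis (SOME B :: (real^'n) l2 set. orthonormal_basis B)"
    using orthonormal_basis_exists by (rule someI_ex)
  then have "((\<lambda>e. cinner e (K e)) has_sum \<tau>) (SOME B. orthonormal_basis B)"
    using assms unfolding has_weyl_trace_def by simp
  then show ?thesis unfolding op_trace_def by (rule infsumI)
qed

text \<open>The case \<open>a = 1\<close> of \<open>gauss_symbol_rank_one\<close>, in which both
  Gaussians coincide.\<close>

lemma rank_one_weyl_integral:
  "is_weyl_integral (\<lambda>(k, h). gauss_symbol 1 (stack k h) / gaussian_mass TYPE(real^'n::finite) (gauss_decay 1))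
    (rank_one (gauss_l2 1 :: (real^'n) l2))"
  unfolding is_weyl_integral_def has_op_integral_def
proof (intro conjI allI bounded_op_rank_one)
  fix f g :: "(real^'n) l2"
  let ?m = "gaussian_mass TYPE(real^'n) (gauss_decay 1)"
  let ?F = "\<lambda>z. 1 / ?m * (gauss_symbol 1 z * cinner f (weyl_vec z g))"
  have F: "cinner f ((case p of (k, h) \<Rightarrow> \<lambda>f. (case (k, h) of (k, h) \<Rightarrow> gauss_symbol 1 (stack k h) / ?m) *\<^sub>C weyl k h f) g)
      = ?F (stack (fst p) (snd p))" for p
    by (simp add: split_beta cinner_scaleC_right weyl_vec_stack)
  have m: "?F \<in> borel_measurable borel" by measurable
  have "integrable lborel (\<lambda>z. gauss_symbol 1 z * cinner f (weyl_vec z g))"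
    using integrable_weyl_form[OF integrable_gauss_symbol[of 1], of f "mat 1" g] by simp
  then have "integrable lborel ?F" by (rule integrable_mult_right)
  then show "integrable lborel (\<lambda>p. cinner f ((case p of (k, h) \<Rightarrow> \<lambda>f. (case (k, h) of (k, h) \<Rightarrow> gauss_symbol 1 (stack k h) / ?m) *\<^sub>C weyl k h f) g))"
    unfolding F lborel_integral_stack(1)[OF m] .
  have "(\<integral>z. ?F z \<partial>lborel) = cinner f (rank_one (gauss_l2 1) g)"
    using gaussian_mass_nonzero[OF gauss_decay_pos[of 1], where 'a = "real^'n"]
    unfolding integral_mult_right_zero gauss_symbol_rank_one[OF zero_less_one]
    by (simp add: cinner_rank_one)
  then show "cinner f (rank_one (gauss_l2 1) g)
      = (\<integral>p. cinner f ((case p of (k, h) \<Rightarrow> \<lambda>f. (case (k, h) of (k, h) \<Rightarrow> gauss_symbol 1 (stack k h) / ?m) *\<^sub>C weyl k h f) g) \<partial>lborel)"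
    unfolding F lborel_integral_stack(2)[OF m] ..
qed

text \<open>Acting under the integral sign multiplies the symbol by the factor of the channel and
  moves each Weyl operator from \<open>z\<close> to \<open>X z\<close>, which is what
  \<open>weyl_form\<close> encodes.\<close>

lemma gaussian_channel_coefficients:
  fixes X Y :: "real^('n::finite + 'n)^('n + 'n)"
  assumes T: "gaussian_channel X Y T"
  shows "cinner f (T (rank_one (gauss_l2 1)) g) = weyl_form X (\<lambda>z. 1 / gaussian_mass TYPE(real^'n) (gauss_decay 1)
    * (gauss_symbol 1 z * exp (\<i> / 2 * of_real (z \<bullet> (Y *v z))))) f g"
proof -
  let ?m = "gaussian_mass TYPE(real^'n) (gauss_decay 1)"
  let ?\<phi> = "\<lambda>(k, h). gauss_symbol 1 (stack k h) / ?m"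
  have "integrable lborel (\<lambda>z. 1 / ?m * gauss_symbol 1 z)"
    by (rule integrable_mult_right) (simp add: integrable_gauss_symbol)
  then have "integrable lborel (\<lambda>p. 1 / ?m * gauss_symbol 1 (stack (fst p) (snd p)))"
    by (subst lborel_integral_stack(1)) measurable
  then have "integrable lborel ?\<phi>"
    by (simp add: case_prod_beta')
  then have "has_op_integral (\<lambda>(k, h) f. ?\<phi> (k, h) *\<^sub>C T (weyl k h) f) (T (rank_one (gauss_l2 1)))"
    using T rank_one_weyl_integral unfolding gaussian_channel_def by blast
  then have "cinner f (T (rank_one (gauss_l2 1)) g)
      = (\<integral>p. cinner f ((case p of (k, h) \<Rightarrow> \<lambda>f. ?\<phi> (k, h) *\<^sub>C T (weyl k h) f) g) \<partial>lborel)"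
    unfolding has_op_integral_def by blast
  also have "\<dots> = (\<integral>p. (\<lambda>z. 1 / ?m * (gauss_symbol 1 z * exp (\<i> / 2 * of_real (z \<bullet> (Y *v z)))) * cinner f (weyl_vec (X *v z) g))
      (stack (fst p) (snd p)) \<partial>lborel)"
  proof (rule Bochner_Integration.integral_cong)
    fix p :: "(real^'n) \<times> (real^'n)"
    obtain k h where p: "p = (k, h)" by (cases p)
    have "T (weyl k h) = (\<lambda>f. exp (\<i> / 2 * of_real (stack k h \<bullet> (Y *v stack k h))) *\<^sub>C weyl_vec (X *v stack k h) f)"
      using T by (simp add: gaussian_channel_def)
    then show "cinner f ((case p of (k, h) \<Rightarrow> \<lambda>f. ?\<phi> (k, h) *\<^sub>C T (weyl k h) f) g)
      = (\<lambda>z. 1 / ?m * (gauss_symbol 1 z * exp (\<i> / 2 * of_real (z \<bullet> (Y *v z)))) * cinner f (weyl_vec (X *v z) g)) (stack (fst p) (snd p))"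
      by (simp add: p cinner_scaleC_right)
  qed simp
  also have "\<dots> = (\<integral>z. 1 / ?m * (gauss_symbol 1 z * exp (\<i> / 2 * of_real (z \<bullet> (Y *v z)))) * cinner f (weyl_vec (X *v z) g) \<partial>lborel)"
    by (rule lborel_integral_stack(2)) measurable
  finally show ?thesis by (simp only: weyl_form_def)
qed

text \<open>The left side does not involve \<open>a\<close>; leaving \<open>a\<close> free allows
  two channels to be evaluated with the same one.\<close>

lemma gaussian_channel_trace:
  fixes X Y :: "real^('n::finite + 'n)^('n + 'n)"
  assumes T: "gaussian_channel X Y T" and X: "invertible X"
  obtains \<epsilon> where "\<epsilon> > 0" "\<And>a. 0 < a \<Longrightarrow> a < \<epsilon> \<Longrightarrow>
    op_trace (T (rank_one (gauss_l2 1))) = 1 / gaussian_mass TYPE(real^'n) (gauss_decay 1)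
      * (gaussian_mass TYPE(real^'n) (gauss_decay a) * cinner (gauss_l2 (1 / a) :: (real^'n) l2) (gauss_l2 a) / of_real \<bar>det X\<bar>)"
proof (rule has_weyl_trace_channel_symbol[OF X, where Y = Y])
  fix \<epsilon> :: real assume \<epsilon>: "\<epsilon> > 0" and tr: "\<And>a. 0 < a \<Longrightarrow> a < \<epsilon> \<Longrightarrow>
    has_weyl_trace X (\<lambda>z. gauss_symbol 1 z * exp (\<i> / 2 * of_real (z \<bullet> (Y *v z))))
      (gaussian_mass TYPE(real^'n) (gauss_decay a) * cinner (gauss_l2 (1 / a) :: (real^'n) l2) (gauss_l2 a) / of_real \<bar>det X\<bar>)"
  show ?thesis
    by (rule that[OF \<epsilon>], rule op_trace_eqI[OF has_weyl_trace_scale[OF tr] gaussian_channel_coefficients[OF T]])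
qed

section \<open>Constancy of the determinant\<close>

lemma trace_preserved_abs_det_eq:
  fixes X Y X' Y' :: "real^('n::finite + 'n)^('n + 'n)"
  assumes T: "gaussian_channel X Y T" and X: "invertible X"
    and T': "gaussian_channel X' Y' T'" and X': "invertible X'"
    and tr: "op_trace (T (rank_one (gauss_l2 1))) = op_trace (T' (rank_one (gauss_l2 1)))"
  shows "\<bar>det X\<bar> = \<bar>det X'\<bar>"
proof -
  obtain \<epsilon> where \<epsilon>: "\<epsilon> > 0" "\<And>a. 0 < a \<Longrightarrow> a < \<epsilon> \<Longrightarrow>
    op_trace (T (rank_one (gauss_l2 1))) = 1 / gaussian_mass TYPE(real^'n) (gauss_decay 1)
      * (gaussian_mass TYPE(real^'n) (gauss_decay a) * cinner (gauss_l2 (1 / a) :: (real^'n) l2) (gauss_l2 a) / of_real \<bar>det X\<bar>)"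
    by (rule gaussian_channel_trace[OF T X]) blast
  obtain \<epsilon>' where \<epsilon>': "\<epsilon>' > 0" "\<And>a. 0 < a \<Longrightarrow> a < \<epsilon>' \<Longrightarrow>
    op_trace (T' (rank_one (gauss_l2 1))) = 1 / gaussian_mass TYPE(real^'n) (gauss_decay 1)
      * (gaussian_mass TYPE(real^'n) (gauss_decay a) * cinner (gauss_l2 (1 / a) :: (real^'n) l2) (gauss_l2 a) / of_real \<bar>det X'\<bar>)"
    by (rule gaussian_channel_trace[OF T' X']) blast
  \<comment> \<open>Halving the minimum puts \<open>a\<close> strictly below both thresholds, so
    both traces carry the same factor \<open>c\<close>.\<close>
  define a where "a = min \<epsilon> \<epsilon>' / 2"
  have a: "0 < a" "a < \<epsilon>" "a < \<epsilon>'" using \<epsilon>(1) \<epsilon>'(1) by (auto simp: a_def)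
  define c where "c = 1 / gaussian_mass TYPE(real^'n) (gauss_decay 1)
      * (gaussian_mass TYPE(real^'n) (gauss_decay a) * cinner (gauss_l2 (1 / a) :: (real^'n) l2) (gauss_l2 a))"
  have c: "c \<noteq> 0"
    using a(1) by (simp add: c_def gaussian_mass_nonzero gauss_decay_pos cinner_gauss_nonzero)
  have "c / of_real \<bar>det X\<bar> = c / of_real \<bar>det X'\<bar>"
    using \<epsilon>(2)[OF a(1,2)] \<epsilon>'(2)[OF a(1,3)] tr by (simp only: c_def times_divide_eq_right)
  moreover have "det X \<noteq> 0" "det X' \<noteq> 0" using X X' by (simp_all add: invertible_det_nz)
  ultimately have "complex_of_real \<bar>det X\<bar> = of_real \<bar>det X'\<bar>"
    using c by (simp only: divide_cancel_left) simp
  then show ?thesis by (simp only: of_real_eq_iff)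
qed

theorem theorem4p1:
  fixes X Y :: "real \<Rightarrow> real^('n::finite + 'n)^('n + 'n)"
    and T :: "real \<Rightarrow> 'n op \<Rightarrow> 'n op"
  assumes "\<forall>t\<ge>0. gaussian_channel (X t) (Y t) (T t)"
    and "P_divisible T"
    and "\<forall>t\<ge>0. invertible (X t)"
    and "(\<lambda>t. det (X t)) differentiable_on {0..}"
  shows "\<forall>t\<ge>0. vector_derivative (\<lambda>t. det (X t)) (at t within {0..}) \<le> 0"
proof -
  let ?A = "rank_one (gauss_l2 1) :: 'n op"
  let ?d = "\<lambda>t. det (X t)"
  \<comment> \<open>The intermediate map from time 0 to \<open>t\<close> preserves the trace of
    \<open>T 0 ?A\<close>, which is trace class by the first clause of
    \<open>P_divisible\<close>.\<close>
  have abs_const: "\<bar>?d t\<bar> = \<bar>?d 0\<bar>" if t: "t \<ge> 0" for t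
  proof -
    obtain \<Phi> where \<Phi>: "positive_trace_preserving \<Phi>" "T t ?A = \<Phi> (T 0 ?A)" and tc: "trace_class (T 0 ?A)"
      using assms(2) t trace_class_rank_one unfolding P_divisible_def by (metis order_refl)
    then have "op_trace (T t ?A) = op_trace (T 0 ?A)"
      by (simp add: positive_trace_preserving_def)
    then show ?thesis
      using assms(1,3) t by (intro trace_preserved_abs_det_eq[where T = "T t" and T' = "T 0"]) auto
  qed
  have nz: "?d t \<noteq> 0" if "t \<ge> 0" for t
    using assms(3) that by (simp add: invertible_det_nz)
  \<comment> \<open>A change of sign would force a zero in between, against invertibility.\<close>
  have const: "?d t = ?d 0" if t: "t \<ge> 0" for t
  proof (rule ccontr)
    assume "?d t \<noteq> ?d 0"
    with abs_const[OF t] have "?d t = - ?d 0" by linarith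
    moreover have cont: "continuous_on {0..t} ?d"
      using differentiable_imp_continuous_on[OF assms(4)] by (rule continuous_on_subset) auto
    ultimately have "\<exists>s\<ge>0. s \<le> t \<and> ?d s = 0"
      using IVT'[of ?d 0 0 t] IVT2'[of ?d t 0 0] t by (cases "?d 0 \<le> 0") auto
    then show False using nz by auto
  qed
  show ?thesis
  proof (intro allI impI)
    fix t :: real assume t: "t \<ge> 0"
    have "(?d has_vector_derivative 0) (at t within {0..})"
      by (rule has_vector_derivative_transform[where f = "\<lambda>_. ?d 0"]) (use t in \<open>auto intro: const\<close>)
    \<comment> \<open>\<open>vector_derivative\<close> is defined by choice, and its value is
      determined only where the filter is nontrivial. Approach from the right ensures this, also at
      the endpoint 0.\<close>
    moreover have "at_right t \<le> at t within {0..}"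
      using t by (intro at_le) auto
    then have "at t within {0..} \<noteq> bot"
      by (metis bot.extremum_unique trivial_limit_at_right_real)
    ultimately show "vector_derivative ?d (at t within {0..}) \<le> 0"
      using vector_derivative_within[of t "{0..}" ?d 0] by simp
  qed
qed

end
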